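(* There is no plane graph $(G,\Sigma)$ such that $G$ is $6$-critical and every vertex of $G$ is incident to at most three $3$-faces of $(G,\Sigma)$.
   Context: All graphs are finite and simple. $\Delta(G)$ denotes the maximum vertex-degree of $G$. A plane graph $(G,\Sigma)$ is a planar graph $G$ together with an embedding $\Sigma$ of $G$ into the Euclidean plane; its faces (including the unbounded one) form the set $F(G)$. The degree of a face is the length of its facial circuit, and a $k$-face is a face of degree $k$. A vertex is incident to a face if it lies on the boundary of that face. The edge-chromatic number $\chi'(G)$ is the minimum $k$ such that $G$ admits a proper $k$-edge-coloring. By Vizing's theorem, $\chi'(G)\in\{\Delta(G),\Delta(G)+1\}$; $G$ is a class 1 graph if $\chi'(G)=\Delta(G)$, and a class 2 graph otherwise. A class 2 graph $H$ is $k$-critical if $\Delta(H)=k$ and $\chi'(H')<\chi'(H)$ for every proper subgraph $H'$ of $H$. *)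

theory Defs
  imports "HOL-Analysis.Analysis"
begin

section \<open>Finite simple graphs\<close>

definition simple_graph :: "'a set \<Rightarrow> 'a set set \<Rightarrow> bool" where
  "simple_graph V E \<longleftrightarrow> finite V \<and> (\<forall>e\<in>E. e \<subseteq> V \<and> card e = 2)"

definition vertex_degree :: "'a set set \<Rightarrow> 'a \<Rightarrow> nat" where
  "vertex_degree E v = card {e \<in> E. v \<in> e}"

text \<open>The inserted \<open>0\<close> only matters for the graph without vertices.\<close>

definition max_degree :: "'a set \<Rightarrow> 'a set set \<Rightarrow> nat" where
  "max_degree V E = Max (insert 0 (vertex_degree E ` V))"

definition proper_subgraph :: "'a set \<Rightarrow> 'a set set \<Rightarrow> 'a set \<Rightarrow> 'a set set \<Rightarrow> bool" where
  "proper_subgraph V' E' V E \<longleftrightarrow>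
     simple_graph V' E' \<and> V' \<subseteq> V \<and> E' \<subseteq> E \<and> (V', E') \<noteq> (V, E)"


section \<open>Edge colourings and critical graphs\<close>

definition proper_edge_coloring :: "'a set set \<Rightarrow> nat \<Rightarrow> ('a set \<Rightarrow> nat) \<Rightarrow> bool" where
  "proper_edge_coloring E k c \<longleftrightarrow>
     (\<forall>e\<in>E. c e < k) \<and> (\<forall>e\<in>E. \<forall>e'\<in>E. e \<noteq> e' \<and> e \<inter> e' \<noteq> {} \<longrightarrow> c e \<noteq> c e')"

definition chromatic_index :: "'a set set \<Rightarrow> nat" where
  "chromatic_index E = (LEAST k. \<exists>c. proper_edge_coloring E k c)"

definition class_two :: "'a set \<Rightarrow> 'a set set \<Rightarrow> bool" where
  "class_two V E \<longleftrightarrow> simple_graph V E \<and> chromatic_index E \<noteq> max_degree V E"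

definition critical :: "nat \<Rightarrow> 'a set \<Rightarrow> 'a set set \<Rightarrow> bool" where
  "critical k V E \<longleftrightarrow> class_two V E \<and> max_degree V E = k \<and>
     (\<forall>V' E'. proper_subgraph V' E' V E \<longrightarrow> chromatic_index E' < chromatic_index E)"


section \<open>Plane graphs\<close>

text \<open>
  An embedding is given by the position \<open>pos v\<close> of each vertex \<open>v\<close> and, for each edge \<open>e\<close>, an
  injective curve \<open>\<gamma> e\<close> joining the positions of the two ends of \<open>e\<close> (in either direction).
  The Euclidean plane is \<^typ>\<open>complex\<close>, as in the library's Jordan curve theorem.
\<close>

definition plane_graph ::
  "'a set \<Rightarrow> 'a set set \<Rightarrow> ('a \<Rightarrow> complex) \<Rightarrow> ('a set \<Rightarrow> real \<Rightarrow> complex) \<Rightarrow> bool" where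
  "plane_graph V E pos \<gamma> \<longleftrightarrow>
     simple_graph V E \<and>
     inj_on pos V \<and>
     (\<forall>e\<in>E. arc (\<gamma> e) \<and> {pathstart (\<gamma> e), pathfinish (\<gamma> e)} = pos ` e) \<and>
     (\<forall>e\<in>E. path_image (\<gamma> e) \<inter> pos ` V = pos ` e) \<and>
     (\<forall>e\<in>E. \<forall>e'\<in>E. e \<noteq> e' \<longrightarrow> path_image (\<gamma> e) \<inter> path_image (\<gamma> e') = pos ` (e \<inter> e'))"

definition drawing ::
  "'a set \<Rightarrow> 'a set set \<Rightarrow> ('a \<Rightarrow> complex) \<Rightarrow> ('a set \<Rightarrow> real \<Rightarrow> complex) \<Rightarrow> complex set" where
  "drawing V E pos \<gamma> = pos ` V \<union> (\<Union>e\<in>E. path_image (\<gamma> e))"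

definition faces ::
  "'a set \<Rightarrow> 'a set set \<Rightarrow> ('a \<Rightarrow> complex) \<Rightarrow> ('a set \<Rightarrow> real \<Rightarrow> complex) \<Rightarrow> complex set set" where
  "faces V E pos \<gamma> = components (- drawing V E pos \<gamma>)"

definition incident :: "('a \<Rightarrow> complex) \<Rightarrow> 'a \<Rightarrow> complex set \<Rightarrow> bool" where
  "incident pos v f \<longleftrightarrow> pos v \<in> frontier f"

text \<open>
  A closed walk is represented by its cyclic list of vertices; its length is the length of the
  list, which is also the number of edges counted with repetitions.
\<close>

definition walk_edges :: "'a list \<Rightarrow> 'a set list" where
  "walk_edges w = map (\<lambda>i. {w ! i, w ! (Suc i mod length w)}) [0..<length w]"

text \<open>
  A facial circuit of \<open>f\<close> is a closed walk whose drawing is the boundary of \<open>f\<close>; it uses an edge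
  twice if \<open>f\<close> lies on both sides of that edge, and once otherwise. If the graph is 2-connected,
  as critical graphs are, the walk is a cycle. Several walks may satisfy the definition
  (rotations and reversals, and different traversals at cut vertices), but all of them use the
  same edges with the same multiplicities and so have the same length, the degree of \<open>f\<close>.
\<close>

definition facial_circuit ::
  "'a set \<Rightarrow> 'a set set \<Rightarrow> ('a \<Rightarrow> complex) \<Rightarrow> ('a set \<Rightarrow> real \<Rightarrow> complex) \<Rightarrow>
     complex set \<Rightarrow> 'a list \<Rightarrow> bool" where
  "facial_circuit V E pos \<gamma> f w \<longleftrightarrow>
     set (walk_edges w) \<subseteq> E \<and>
     (\<Union>e\<in>set (walk_edges w). path_image (\<gamma> e)) = frontier f \<and>
     (\<forall>e\<in>set (walk_edges w). count_list (walk_edges w) e =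
        (if \<exists>g\<in>faces V E pos \<gamma>. g \<noteq> f \<and> path_image (\<gamma> e) \<subseteq> frontier g then 1 else 2))"

definition k_face ::
  "nat \<Rightarrow> 'a set \<Rightarrow> 'a set set \<Rightarrow> ('a \<Rightarrow> complex) \<Rightarrow> ('a set \<Rightarrow> real \<Rightarrow> complex) \<Rightarrow>
     complex set \<Rightarrow> bool" where
  "k_face k V E pos \<gamma> f \<longleftrightarrow>
     f \<in> faces V E pos \<gamma> \<and> (\<exists>w. facial_circuit V E pos \<gamma> f w \<and> length w = k)"

end

theory Submission imports Defs begin

text \<open>
  Let a 6-critical plane graph with vertex set \<open>V\<close> and edge set \<open>E\<close> have at most three triangular
  faces at every vertex. Two counts of its triangular faces contradict each other.

  Euler's formula gives many of them. A critical graph is bridgeless, so every edge lies on exactly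
  two faces and every face has at least three edges on its boundary, and at least four if it is not
  triangular. With \<open>|F| \<ge> |E| - |V| + 2\<close> this yields at least \<open>2|E| - 4|V| + 8\<close> triangular faces
  (\<open>many_triangles\<close>), which is \<open>8\<close> more than the sum of \<open>d(v) - 4\<close> over all vertices. The
  bound on the number of faces is obtained by adding edges to a spanning forest one at a
  time: by the Jordan curve theorem each new edge, which closes a cycle, splits a face
  (\<open>linked_edge_splits_face\<close>). The local structure along an edge comes from Janiszewski's theorem:
  near an inner point of an edge of a closed curve, each side of the curve is connected
  (\<open>closed_curve_two_sided\<close>).

  Discharging shows that there are few of them (\<open>few_triangles\<close>). A vertex \<open>v\<close> has charge \<open>d(v) - 4\<close>,
  vertices of degree 5 and 6 send charge to the triangular faces around them and to their neighbours
  of degree 2 and 3; every triangle collects at least 1 (\<open>triangle_receives\<close>) and no vertex ends with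
  negative charge (\<open>all_balanced\<close>). Hence the number of triangles is at most the sum of \<open>d(v) - 4\<close>.
  A vertex can afford its payments because critical graphs have few edges between vertices of
  small degree. This is expressed by three adjacency statements, all proved by Kempe chains
  in a colouring of the graph with one edge removed: Vizing's adjacency lemma
  (\<open>vizing_adjacency\<close>), a bound on the degree of the last vertex of a path of length three
  that starts at a vertex of degree 2 (\<open>path_from_degree_two_vertex\<close>), and the absence of triangles through a neighbour of
  degree 3 at a vertex with two such neighbours (\<open>no_triangle_at_second_degree_three_neighbour\<close>).
\<close>

section \<open>Neighbours and missing colours\<close>

definition neighbours :: "'a set set \<Rightarrow> 'a \<Rightarrow> 'a set" where
  "neighbours E v = {u. u \<noteq> v \<and> {v, u} \<in> E}"

lemma edge_through_vertex:
  assumes "card e = 2" "v \<in> e"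
  obtains u where "u \<noteq> v" "e = {v, u}"
proof -
  obtain x y where "e = {x, y}" "x \<noteq> y" using assms(1) by (auto simp: card_2_iff)
  then show thesis using assms(2) that[of x] that[of y] by (auto simp: insert_commute)
qed

lemma simple_graph_finite_edges:
  assumes "simple_graph V E"
  shows "finite E"
proof (rule finite_subset)
  show "E \<subseteq> Pow V" using assms by (auto simp: simple_graph_def)
  show "finite (Pow V)" using assms by (auto simp: simple_graph_def)
qed

lemma vertex_degree_eq_card_neighbours:
  assumes "\<forall>e\<in>E. card e = 2"
  shows "vertex_degree E v = card (neighbours E v)"
proof -
  have "bij_betw (\<lambda>u. {v, u}) (neighbours E v) {e \<in> E. v \<in> e}"
  proof (rule bij_betwI')
    fix e assume "e \<in> {e \<in> E. v \<in> e}"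
    then have "e \<in> E" "card e = 2" "v \<in> e" using assms by auto
    moreover from this obtain u where "u \<noteq> v" "e = {v, u}" using edge_through_vertex[of e v] by blast
    ultimately show "\<exists>u\<in>neighbours E v. e = {v, u}" by (auto simp: neighbours_def)
  qed (auto simp: neighbours_def doubleton_eq_iff)
  then show ?thesis
    by (simp add: bij_betw_same_card vertex_degree_def)
qed

definition missing :: "'a set set \<Rightarrow> nat \<Rightarrow> ('a set \<Rightarrow> nat) \<Rightarrow> 'a \<Rightarrow> nat set" where
  "missing F k c v = {\<alpha>. \<alpha> < k \<and> (\<forall>e\<in>F. v \<in> e \<longrightarrow> c e \<noteq> \<alpha>)}"

lemma missing_eq_image: "missing F k c v = {..<k} - c ` {e \<in> F. v \<in> e}"
  by (auto simp: missing_def)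

lemma card_missing:
  assumes "finite F" "proper_edge_coloring F k c"
  shows "card (missing F k c v) + vertex_degree F v = k"
proof -
  let ?S = "{e \<in> F. v \<in> e}"
  have inj: "inj_on c ?S"
    using assms(2) unfolding proper_edge_coloring_def inj_on_def by blast
  have sub: "c ` ?S \<subseteq> {..<k}"
    using assms(2) unfolding proper_edge_coloring_def by auto
  have "missing F k c v = {..<k} - c ` ?S"
    by (auto simp: missing_def)
  moreover have "card ({..<k} - c ` ?S) = k - card ?S"
    using sub assms(1) inj by (subst card_Diff_subset) (auto simp: card_image)
  moreover have "card ?S \<le> k"
    using sub inj by (metis card_image card_lessThan card_mono finite_lessThan)
  ultimately show ?thesis by (simp add: vertex_degree_def)
qed

lemma finite_missing [simp]: "finite (missing F k c v)"
  by (rule finite_subset[of _ "{..<k}"]) (auto simp: missing_def)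

lemma missing_color:
  assumes "\<alpha> \<in> missing F k c v" "e \<in> F" "v \<in> e"
  shows "c e \<noteq> \<alpha>"
  using assms by (auto simp: missing_def)

lemma proper_edge_coloringD:
  assumes "proper_edge_coloring F k c" "e \<in> F" "e' \<in> F" "e \<noteq> e'" "v \<in> e" "v \<in> e'"
  shows "c e \<noteq> c e'"
  using assms unfolding proper_edge_coloring_def by blast

lemma proper_colors_differ:
  assumes "proper_edge_coloring F k c" "{v, x} \<in> F" "{v, y} \<in> F" "x \<noteq> y"
  shows "c {v, x} \<noteq> c {v, y}"
  using assms unfolding proper_edge_coloring_def
  by (metis doubleton_eq_iff insertI1 disjoint_iff)

lemma rtrancl_distinct_path:
  assumes "(u, v) \<in> R\<^sup>*"
  shows "\<exists>p. p \<noteq> [] \<and> hd p = u \<and> last p = v \<and> distinct p \<and> successively (\<lambda>x y. (x, y) \<in> R) p"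
  using assms
proof (induction rule: rtrancl_induct)
  case base
  show ?case by (intro exI[of _ "[u]"]) auto
next
  case (step y z)
  then obtain p where p: "p \<noteq> []" "hd p = u" "last p = y" "distinct p"
      "successively (\<lambda>x y. (x, y) \<in> R) p" by blast
  show ?case
  proof (cases "z \<in> set p")
    case True
    then obtain xs ys where "p = xs @ z # ys" by (meson split_list)
    then have "p = (xs @ [z]) @ ys" by simp
    then show ?thesis using p
      by (intro exI[of _ "xs @ [z]"]) (auto simp: successively_append_iff hd_append)
  next
    case False
    then show ?thesis using p step.hyps
      by (intro exI[of _ "p @ [z]"]) (auto simp: successively_append_iff)
  qed
qed

section \<open>Kempe chains\<close>

definition kempe_rel :: "'a set set \<Rightarrow> ('a set \<Rightarrow> nat) \<Rightarrow> nat \<Rightarrow> nat \<Rightarrow> ('a \<times> 'a) set" where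
  "kempe_rel F c \<alpha> \<beta> = {(u, v). {u, v} \<in> F \<and> c {u, v} \<in> {\<alpha>, \<beta>}}"

definition kempe_component :: "'a set set \<Rightarrow> ('a set \<Rightarrow> nat) \<Rightarrow> nat \<Rightarrow> nat \<Rightarrow> 'a \<Rightarrow> 'a set" where
  "kempe_component F c \<alpha> \<beta> u = {v. (u, v) \<in> (kempe_rel F c \<alpha> \<beta>)\<^sup>*}"

lemma kempe_component_self [simp]: "u \<in> kempe_component F c \<alpha> \<beta> u"
  by (simp add: kempe_component_def)

lemma kempe_component_sym:
  assumes "v \<in> kempe_component F c \<alpha> \<beta> u"
  shows "u \<in> kempe_component F c \<alpha> \<beta> v"
proof -
  have "sym (kempe_rel F c \<alpha> \<beta>)"
    by (auto simp: sym_def kempe_rel_def insert_commute)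
  then show ?thesis
    using assms sym_rtrancl by (fastforce simp: kempe_component_def dest: symD)
qed

lemma kempe_component_trans:
  assumes "v \<in> kempe_component F c \<alpha> \<beta> u" "w \<in> kempe_component F c \<alpha> \<beta> v"
  shows "w \<in> kempe_component F c \<alpha> \<beta> u"
  using assms by (auto simp: kempe_component_def)

definition kempe_closed :: "'a set set \<Rightarrow> ('a set \<Rightarrow> nat) \<Rightarrow> nat \<Rightarrow> nat \<Rightarrow> 'a set \<Rightarrow> bool" where
  "kempe_closed F c \<alpha> \<beta> K \<longleftrightarrow> (\<forall>u v. u \<in> K \<longrightarrow> {u, v} \<in> F \<longrightarrow> c {u, v} \<in> {\<alpha>, \<beta>} \<longrightarrow> v \<in> K)"

lemma kempe_closed_component: "kempe_closed F c \<alpha> \<beta> (kempe_component F c \<alpha> \<beta> u)"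
  unfolding kempe_closed_def kempe_component_def
  by (auto simp: kempe_rel_def intro: rtrancl_into_rtrancl)

lemma kempe_component_least:
  assumes "kempe_closed F c \<alpha> \<beta> K" "u \<in> K"
  shows "kempe_component F c \<alpha> \<beta> u \<subseteq> K"
proof
  fix v assume "v \<in> kempe_component F c \<alpha> \<beta> u"
  then have "(u, v) \<in> (kempe_rel F c \<alpha> \<beta>)\<^sup>*" by (simp add: kempe_component_def)
  then show "v \<in> K"
  proof (induction rule: rtrancl_induct)
    case (step y z)
    then show ?case using assms(1) unfolding kempe_closed_def kempe_rel_def by blast
  qed (rule assms(2))
qed

lemma two_kempe_edges:
  assumes "proper_edge_coloring F k c" "{v, x} \<in> F" "{v, y} \<in> F" "x \<noteq> y"
    and "c {v, x} \<in> {\<alpha>, \<beta>}" "c {v, y} \<in> {\<alpha>, \<beta>}"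
  shows "\<alpha> \<notin> missing F k c v" "\<beta> \<notin> missing F k c v"
proof -
  have "c {v, x} = \<alpha> \<or> c {v, y} = \<alpha>" "c {v, x} = \<beta> \<or> c {v, y} = \<beta>"
    using proper_colors_differ[OF assms(1-4)] assms(5,6) by (metis insertE singletonD)+
  then show "\<alpha> \<notin> missing F k c v" "\<beta> \<notin> missing F k c v"
    using missing_color[of _ F k c v "{v, x}"] missing_color[of _ F k c v "{v, y}"] assms(2,3) by blast+
qed

text \<open>
  Every vertex has at most two edges in the colours \<open>\<alpha>\<close> and \<open>\<beta>\<close>, so a Kempe component is a path or
  a cycle; a vertex that misses one of the two colours must be an end of the path. The proof takes a
  simple path from \<open>u\<close> to \<open>v\<close> and checks that no edge of the two colours leaves it.
\<close>

lemma kempe_component_three_ends: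
  assumes proper: "proper_edge_coloring F k c"
    and u: "\<alpha> \<in> missing F k c u \<or> \<beta> \<in> missing F k c u"
    and v: "\<alpha> \<in> missing F k c v \<or> \<beta> \<in> missing F k c v"
    and w: "\<alpha> \<in> missing F k c w \<or> \<beta> \<in> missing F k c w"
    and ne: "u \<noteq> v" "u \<noteq> w" "v \<noteq> w"
    and v_in: "v \<in> kempe_component F c \<alpha> \<beta> u" and w_in: "w \<in> kempe_component F c \<alpha> \<beta> u"
  shows False
proof -
  obtain p where p: "p \<noteq> []" "hd p = u" "last p = v" "distinct p"
      "successively (\<lambda>x y. (x, y) \<in> kempe_rel F c \<alpha> \<beta>) p"
    using v_in rtrancl_distinct_path[of u v "kempe_rel F c \<alpha> \<beta>"] unfolding kempe_component_def by blast
  have next_edge: "{p ! i, p ! Suc i} \<in> F \<and> c {p ! i, p ! Suc i} \<in> {\<alpha>, \<beta>}" if "Suc i < length p" for i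
    using p(5) that unfolding successively_conv_nth kempe_rel_def by auto
  have prev_edge: "{p ! Suc i, p ! i} \<in> F \<and> c {p ! Suc i, p ! i} \<in> {\<alpha>, \<beta>}" if "Suc i < length p" for i
    using next_edge[OF that] by (simp add: insert_commute)
  have u0: "p ! 0 = u" using p(1,2) by (simp add: hd_conv_nth)
  have vl: "p ! (length p - 1) = v" using p(1,3) by (simp add: last_conv_nth)
  have len: "length p \<ge> 2"
  proof -
    have "length p \<noteq> 0" "length p \<noteq> 1" using u0 vl ne(1) p(1) by auto
    then show ?thesis by linarith
  qed
  have interior: "\<alpha> \<notin> missing F k c (p ! Suc i)" "\<beta> \<notin> missing F k c (p ! Suc i)" if "Suc (Suc i) < length p" for i
  proof -
    have "p ! i \<noteq> p ! Suc (Suc i)" using that p(4) by (simp add: nth_eq_iff_index_eq)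
    then show "\<alpha> \<notin> missing F k c (p ! Suc i)" "\<beta> \<notin> missing F k c (p ! Suc i)"
      using two_kempe_edges[OF proper, of "p ! Suc i" "p ! i" "p ! Suc (Suc i)" \<alpha> \<beta>] next_edge[of "Suc i"] prev_edge[of i]
        that by simp_all
  qed
  have "kempe_closed F c \<alpha> \<beta> (set p)"
    unfolding kempe_closed_def
  proof (intro allI impI)
    fix a b assume a: "a \<in> set p" and ab: "{a, b} \<in> F" "c {a, b} \<in> {\<alpha>, \<beta>}"
    then obtain i where i: "i < length p" "p ! i = a" by (auto simp: in_set_conv_nth)
    show "b \<in> set p"
    proof (rule ccontr)
      assume b: "b \<notin> set p"
      have nb: "b \<noteq> p ! j" if "j < length p" for j using b that by auto
      show False
      proof (cases "i = 0")
        case True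
        then have "a = u" using u0 i by simp
        then show False
          using two_kempe_edges[OF proper, of a b "p ! Suc 0" \<alpha> \<beta>] next_edge[of 0] ab nb[of "Suc 0"] u len True i
          by auto
      next
        case False
        then obtain j where j: "i = Suc j" by (cases i) auto
        show False
        proof (cases "Suc i < length p")
          case True
          have ne': "p ! j \<noteq> p ! Suc i" using True j p(4) by (simp add: nth_eq_iff_index_eq)
          have nx: "{a, p ! Suc i} \<in> F" "c {a, p ! Suc i} \<in> {\<alpha>, \<beta>}" using next_edge[of i] True i by auto
          have pv: "{a, p ! j} \<in> F" "c {a, p ! j} \<in> {\<alpha>, \<beta>}" using prev_edge[of j] i j by auto
          have "c {a, p ! j} \<noteq> c {a, p ! Suc i}"
            using proper_colors_differ[OF proper pv(1) nx(1) ne'] .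
          moreover have "c {a, b} \<noteq> c {a, p ! j}"
            using proper_colors_differ[OF proper ab(1) pv(1)] nb[of j] i j by simp
          moreover have "c {a, b} \<noteq> c {a, p ! Suc i}"
            using proper_colors_differ[OF proper ab(1) nx(1)] nb[of "Suc i"] True by simp
          ultimately show False using nx(2) pv(2) ab(2) by auto
        next
          case False
          then have "a = v" using vl i by (metis Suc_lessI diff_Suc_1)
          then show False
            using two_kempe_edges[OF proper, of a b "p ! j" \<alpha> \<beta>] prev_edge[of j] ab nb[of j] v i j
            by auto
        qed
      qed
    qed
  qed
  moreover have "u \<in> set p" using p by (metis hd_in_set)
  ultimately have "w \<in> set p" using w_in kempe_component_least[of F c \<alpha> \<beta> "set p" u] by auto
  then obtain i where i: "i < length p" "p ! i = w" by (auto simp: in_set_conv_nth)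
  have "i \<noteq> 0" using i u0 ne(2) by metis
  then obtain j where j: "i = Suc j" by (cases i) auto
  have "Suc i < length p" using i vl ne by (metis Suc_lessI diff_Suc_1)
  then show False using interior[of j] w i j by auto
qed

definition kempe_swap :: "'a set \<Rightarrow> nat \<Rightarrow> nat \<Rightarrow> ('a set \<Rightarrow> nat) \<Rightarrow> 'a set \<Rightarrow> nat" where
  "kempe_swap K \<alpha> \<beta> c e = (if e \<inter> K = {} then c e else Transposition.transpose \<alpha> \<beta> (c e))"

lemma kempe_swap_inside:
  assumes "v \<in> K" "v \<in> e"
  shows "kempe_swap K \<alpha> \<beta> c e = Transposition.transpose \<alpha> \<beta> (c e)"
  using assms by (auto simp: kempe_swap_def)

lemma kempe_swap_outside:
  assumes "kempe_closed F c \<alpha> \<beta> K" "\<forall>e\<in>F. card e = 2" "e \<in> F" "v \<in> e" "v \<notin> K"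
  shows "kempe_swap K \<alpha> \<beta> c e = c e"
proof (cases "e \<inter> K = {}")
  case False
  have "card e = 2" using assms(2,3) by auto
  then obtain u where e: "e = {v, u}" using assms(4) edge_through_vertex[of e v] by blast
  then have "u \<in> K" using False assms(5) by auto
  then have "c e \<notin> {\<alpha>, \<beta>}"
    using assms(1,3,5) e unfolding kempe_closed_def by (metis insert_commute)
  then show ?thesis by (simp add: kempe_swap_def Transposition.transpose_def)
qed (simp add: kempe_swap_def)

lemma kempe_swap_other_color:
  assumes "c e \<notin> {\<alpha>, \<beta>}"
  shows "kempe_swap K \<alpha> \<beta> c e = c e"
  using assms by (simp add: kempe_swap_def Transposition.transpose_def)

lemma proper_kempe_swap:
  assumes "proper_edge_coloring F k c" "kempe_closed F c \<alpha> \<beta> K" "\<forall>e\<in>F. card e = 2" "\<alpha> < k" "\<beta> < k"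
  shows "proper_edge_coloring F k (kempe_swap K \<alpha> \<beta> c)"
  unfolding proper_edge_coloring_def
proof (intro conjI ballI impI)
  fix e assume "e \<in> F"
  then show "kempe_swap K \<alpha> \<beta> c e < k"
    using assms(1,4,5) unfolding proper_edge_coloring_def kempe_swap_def Transposition.transpose_def by auto
next
  fix e e' assume e: "e \<in> F" "e' \<in> F" "e \<noteq> e' \<and> e \<inter> e' \<noteq> {}"
  then obtain v where v: "v \<in> e" "v \<in> e'" by auto
  have "c e \<noteq> c e'" using assms(1) e unfolding proper_edge_coloring_def by blast
  then show "kempe_swap K \<alpha> \<beta> c e \<noteq> kempe_swap K \<alpha> \<beta> c e'"
    using kempe_swap_inside[of v K] kempe_swap_outside[OF assms(2,3), of _ v] v e(1,2)
    by (cases "v \<in> K") (metis Transposition.transpose_involutory)+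
qed

lemma missing_kempe_swap_inside:
  assumes "v \<in> K" "\<alpha> < k" "\<beta> < k"
  shows "\<gamma> \<in> missing F k (kempe_swap K \<alpha> \<beta> c) v \<longleftrightarrow> Transposition.transpose \<alpha> \<beta> \<gamma> \<in> missing F k c v"
proof -
  have "Transposition.transpose \<alpha> \<beta> \<gamma> < k \<longleftrightarrow> \<gamma> < k"
    using assms by (auto simp: Transposition.transpose_def)
  moreover have "Transposition.transpose \<alpha> \<beta> (c e) = \<gamma> \<longleftrightarrow> c e = Transposition.transpose \<alpha> \<beta> \<gamma>" for e
    by (metis Transposition.transpose_involutory)
  ultimately show ?thesis
    using kempe_swap_inside[OF assms(1)] unfolding missing_def by auto
qed

lemma missing_kempe_swap_outside:
  assumes "kempe_closed F c \<alpha> \<beta> K" "\<forall>e\<in>F. card e = 2" "v \<notin> K"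
  shows "missing F k (kempe_swap K \<alpha> \<beta> c) v = missing F k c v"
  using kempe_swap_outside[OF assms(1,2) _ _ assms(3)] unfolding missing_def by auto

lemma proper_recolor:
  assumes "proper_edge_coloring F k c" "{p, q} \<in> F" "\<beta> \<in> missing F k c p" "\<beta> \<in> missing F k c q"
  shows "proper_edge_coloring F k (c({p, q} := \<beta>))"
  using assms unfolding proper_edge_coloring_def missing_def by auto

lemma missing_recolor_other:
  assumes "v \<notin> e"
  shows "missing F k (c(e := \<beta>)) v = missing F k c v"
  using assms unfolding missing_def by auto

lemma missing_recolor_gain:
  assumes "proper_edge_coloring F k c" "e \<in> F" "v \<in> e" "\<beta> \<in> missing F k c v"
  shows "c e \<in> missing F k (c(e := \<beta>)) v"
  using assms unfolding missing_def proper_edge_coloring_def by auto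

section \<open>Graphs that become colourable when any edge is deleted\<close>

text \<open>
  The elementary step of a Vizing fan: the uncoloured edge moves from \<open>{x, y}\<close> to \<open>{x, z}\<close>, whose
  colour is handed to \<open>{x, y}\<close>. The centre \<open>x\<close> sees the same colours before and after.
\<close>

lemma shift_uncolored_edge:
  fixes x y z :: 'a
  assumes two: "\<forall>e\<in>E. card e = 2" and yE: "{x, y} \<in> E" and zE: "{x, z} \<in> E" and yz: "y \<noteq> z"
    and proper: "proper_edge_coloring (E - {{x, y}}) k c"
    and miss: "c {x, z} \<in> missing (E - {{x, y}}) k c y"
  defines "c' \<equiv> c({x, y} := c {x, z})"
  shows "proper_edge_coloring (E - {{x, z}}) k c'"
    and "missing (E - {{x, z}}) k c' x = missing (E - {{x, y}}) k c x"
    and "missing (E - {{x, z}}) k c' y = missing (E - {{x, y}}) k c y - {c {x, z}}"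
    and "missing (E - {{x, z}}) k c' z = insert (c {x, z}) (missing (E - {{x, y}}) k c z)"
    and "\<And>v. v \<notin> {x, y, z} \<Longrightarrow> missing (E - {{x, z}}) k c' v = missing (E - {{x, y}}) k c v"
proof -
  have ne: "x \<noteq> y" "x \<noteq> z" using two yE zE by fastforce+
  have neq: "{x, y} \<noteq> {x, z}" using yz by (auto simp: doubleton_eq_iff)
  have zF: "{x, z} \<in> E - {{x, y}}" using zE neq by auto
  have c'_other: "c' e = c e" if "e \<noteq> {x, y}" for e using that by (simp add: c'_def)
  have c'_new: "c' {x, y} = c {x, z}" by (simp add: c'_def)
  have lt: "c {x, z} < k" using miss by (simp add: missing_def)
  have clash: "c e \<noteq> c {x, z}" if e: "e \<in> E" "e \<noteq> {x, y}" "e \<noteq> {x, z}" "x \<in> e \<or> y \<in> e \<or> z \<in> e" for e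
  proof (cases "y \<in> e")
    case True
    then show ?thesis using miss e unfolding missing_def by auto
  next
    case False
    then have "x \<in> e \<or> z \<in> e" using e(4) by auto
    moreover have "e \<in> E - {{x, y}}" using e by simp
    ultimately show ?thesis using proper_edge_coloringD[OF proper _ zF] e(3) by blast
  qed
  show "proper_edge_coloring (E - {{x, z}}) k c'"
    unfolding proper_edge_coloring_def
  proof (intro conjI ballI impI)
    fix e assume "e \<in> E - {{x, z}}"
    then show "c' e < k"
      using proper lt c'_new c'_other[of e] unfolding proper_edge_coloring_def by (cases "e = {x, y}") auto
  next
    fix e e' assume e: "e \<in> E - {{x, z}}" "e' \<in> E - {{x, z}}" "e \<noteq> e' \<and> e \<inter> e' \<noteq> {}"
    show "c' e \<noteq> c' e'"
    proof (cases "e = {x, y}")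
      case True
      then have e': "e' \<in> E" "e' \<noteq> {x, y}" "e' \<noteq> {x, z}" "x \<in> e' \<or> y \<in> e' \<or> z \<in> e'" using e by auto
      show ?thesis using clash[OF e'] c'_new c'_other[OF e'(2)] True by simp
    next
      case False
      show ?thesis
      proof (cases "e' = {x, y}")
        case True
        then have e'': "e \<in> E" "e \<noteq> {x, z}" "x \<in> e \<or> y \<in> e \<or> z \<in> e" using e by auto
        show ?thesis using clash[OF e''(1) False e''(2,3)] c'_new c'_other[OF False] True by simp
      next
        case e': False
        obtain v where "v \<in> e" "v \<in> e'" using e(3) by auto
        then have "c e \<noteq> c e'" using proper_edge_coloringD[OF proper, of e e' v] e False e' by auto
        then show ?thesis using c'_other False e' by simp
      qed
    qed
  qed
  define S where "S v = {e \<in> E. v \<in> e} - {{x, y}, {x, z}}" for v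
  have image: "c' ` S v = c ` S v" for v
    by (rule image_cong) (auto simp: S_def c'_def)
  have y: "y \<notin> {x, z}" and z: "z \<notin> {x, y}" using ne yz by auto
  have "{e \<in> E - {{x, z}}. x \<in> e} = insert {x, y} (S x)" "{e \<in> E - {{x, y}}. x \<in> e} = insert {x, z} (S x)"
    using yE zE neq by (auto simp: S_def)
  then show "missing (E - {{x, z}}) k c' x = missing (E - {{x, y}}) k c x"
    by (simp add: missing_eq_image image c'_new)
  have "{e \<in> E - {{x, z}}. y \<in> e} = insert {x, y} (S y)" "{e \<in> E - {{x, y}}. y \<in> e} = S y"
    using yE neq y by (auto simp: S_def)
  then show "missing (E - {{x, z}}) k c' y = missing (E - {{x, y}}) k c y - {c {x, z}}"
    by (auto simp: missing_eq_image image c'_new)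
  have "{e \<in> E - {{x, z}}. z \<in> e} = S z" "{e \<in> E - {{x, y}}. z \<in> e} = insert {x, z} (S z)"
    using zE neq z by (auto simp: S_def)
  moreover have "c {x, z} \<notin> c ` S z" using clash unfolding S_def by fastforce
  ultimately show "missing (E - {{x, z}}) k c' z = insert (c {x, z}) (missing (E - {{x, y}}) k c z)"
    using lt by (auto simp: missing_eq_image image)
  show "missing (E - {{x, z}}) k c' v = missing (E - {{x, y}}) k c v" if v: "v \<notin> {x, y, z}" for v
  proof -
    have "{e \<in> E - {{x, z}}. v \<in> e} = S v" "{e \<in> E - {{x, y}}. v \<in> e} = S v"
      using v by (auto simp: S_def)
    then show ?thesis by (simp add: missing_eq_image image)
  qed
qed

text \<open>
  This is the situation of a critical graph when \<open>k\<close> is one less than the chromatic index. That \<open>k\<close> is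
  the maximum degree is a consequence: the adjacency lemma produces a vertex of degree \<open>k\<close>.
\<close>

locale edge_critical =
  fixes V :: "'a set" and E :: "'a set set" and k :: nat
  assumes simple: "simple_graph V E"
    and degree_le: "\<And>v. vertex_degree E v \<le> k"
    and uncolorable: "\<And>c. \<not> proper_edge_coloring E k c"
    and deletion_colorable: "\<And>e. e \<in> E \<Longrightarrow> \<exists>c. proper_edge_coloring (E - {e}) k c"
begin

lemma two: "\<forall>e\<in>E. card e = 2" using simple by (auto simp: simple_graph_def)

lemma two': "\<forall>e\<in>E - F. card e = 2" using two by auto

lemma finite_E: "finite E" using simple simple_graph_finite_edges by blast

lemma edge_ends_neq: "{x, y} \<in> E \<Longrightarrow> x \<noteq> y" using two by fastforce

abbreviation miss :: "'a set \<Rightarrow> ('a set \<Rightarrow> nat) \<Rightarrow> 'a \<Rightarrow> nat set" where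
  "miss e c v \<equiv> missing (E - {e}) k c v"

abbreviation pcol :: "'a set \<Rightarrow> ('a set \<Rightarrow> nat) \<Rightarrow> bool" where
  "pcol e c \<equiv> proper_edge_coloring (E - {e}) k c"

lemma card_miss:
  assumes "pcol e c" "e \<in> E"
  shows "card (miss e c v) + vertex_degree E v = (if v \<in> e then Suc k else k)"
proof -
  let ?S = "{e' \<in> E. v \<in> e'}"
  have "{e' \<in> E - {e}. v \<in> e'} = ?S - {e}" by auto
  then have "vertex_degree (E - {e}) v = (if v \<in> e then vertex_degree E v - 1 else vertex_degree E v)"
    using assms(2) finite_E by (auto simp: vertex_degree_def card_Diff_singleton_if)
  moreover have "v \<in> e \<Longrightarrow> vertex_degree E v > 0"
    using assms(2) finite_E by (auto simp: vertex_degree_def card_gt_0_iff)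
  moreover have "card (miss e c v) + vertex_degree (E - {e}) v = k"
    by (rule card_missing[OF _ assms(1)]) (simp add: finite_E)
  ultimately show ?thesis by auto
qed

lemma miss_end_nonempty:
  assumes "pcol e c" "e \<in> E" "v \<in> e"
  shows "miss e c v \<noteq> {}"
  using card_miss[OF assms(1,2), of v] degree_le[of v] assms(3) by auto

lemma ends_miss_disjoint:
  assumes "pcol {x, y} c" "{x, y} \<in> E" "\<alpha> \<in> miss {x, y} c x" "\<alpha> \<in> miss {x, y} c y"
  shows False
proof -
  have "proper_edge_coloring E k (c({x, y} := \<alpha>))"
    unfolding proper_edge_coloring_def
  proof (intro conjI ballI impI)
    fix e assume "e \<in> E"
    then show "(c({x, y} := \<alpha>)) e < k"
      using assms unfolding proper_edge_coloring_def missing_def by auto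
  next
    fix e e' assume "e \<in> E" "e' \<in> E" "e \<noteq> e' \<and> e \<inter> e' \<noteq> {}"
    then show "(c({x, y} := \<alpha>)) e \<noteq> (c({x, y} := \<alpha>)) e'"
      using assms unfolding proper_edge_coloring_def missing_def by auto
  qed
  then show False using uncolorable by blast
qed

lemma missing_lt: "\<alpha> \<in> missing F k c v \<Longrightarrow> \<alpha> < k" by (simp add: missing_def)

text \<open>
  Otherwise the colours could be exchanged on the component of \<open>x\<close> alone. Both ends of the edge would
  then miss \<open>\<beta>\<close>, and the edge could be coloured.
\<close>

lemma ends_linked:
  assumes c: "pcol {x, y} c" and e: "{x, y} \<in> E" and \<alpha>: "\<alpha> \<in> miss {x, y} c x" and \<beta>: "\<beta> \<in> miss {x, y} c y"
  shows "y \<in> kempe_component (E - {{x, y}}) c \<alpha> \<beta> x"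
proof (rule ccontr)
  let ?F = "E - {{x, y}}" and ?K = "kempe_component (E - {{x, y}}) c \<alpha> \<beta> x"
  assume y: "y \<notin> ?K"
  let ?c = "kempe_swap ?K \<alpha> \<beta> c"
  note lt = missing_lt[OF \<alpha>] missing_lt[OF \<beta>]
  have "pcol {x, y} ?c"
    by (rule proper_kempe_swap[OF c kempe_closed_component two' lt])
  moreover have "\<beta> \<in> miss {x, y} ?c x"
    by (subst missing_kempe_swap_inside) (use lt \<alpha> in simp_all)
  moreover have "\<beta> \<in> miss {x, y} ?c y"
    using missing_kempe_swap_outside[OF kempe_closed_component two' y] \<beta> by simp
  ultimately show False using ends_miss_disjoint e by blast
qed

text \<open>
  The two ends of the \<open>\<alpha>\<close>-\<open>\<beta>\<close> chain of \<open>x\<close> are \<open>x\<close> and \<open>y\<close>, so a third vertex that misses one of these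
  colours has a different chain. Exchanging the colours there is invisible at \<open>x\<close> and \<open>y\<close>.
\<close>

lemma swap_third_vertex:
  assumes c: "pcol {x, y} c" and e: "{x, y} \<in> E" and \<alpha>: "\<alpha> \<in> miss {x, y} c x" and \<beta>: "\<beta> \<in> miss {x, y} c y"
    and z: "z \<noteq> x" "z \<noteq> y" and z_end: "\<alpha> \<in> miss {x, y} c z \<or> \<beta> \<in> miss {x, y} c z"
  shows "\<exists>c'. pcol {x, y} c' \<and>
    miss {x, y} c' x = miss {x, y} c x \<and> miss {x, y} c' y = miss {x, y} c y \<and>
    (\<forall>\<gamma>. \<gamma> \<in> miss {x, y} c' z \<longleftrightarrow> Transposition.transpose \<alpha> \<beta> \<gamma> \<in> miss {x, y} c z) \<and>
    (\<forall>f\<in>E - {{x, y}}. x \<in> f \<or> y \<in> f \<longrightarrow> c' f = c f) \<and>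
    (\<forall>f. z \<in> f \<longrightarrow> c' f = Transposition.transpose \<alpha> \<beta> (c f)) \<and>
    (\<forall>f. c f \<notin> {\<alpha>, \<beta>} \<longrightarrow> c' f = c f)"
proof -
  let ?F = "E - {{x, y}}" and ?K = "kempe_component (E - {{x, y}}) c \<alpha> \<beta> z"
  let ?c = "kempe_swap ?K \<alpha> \<beta> c"
  note lt = missing_lt[OF \<alpha>] missing_lt[OF \<beta>]
  have link: "y \<in> kempe_component ?F c \<alpha> \<beta> x" using ends_linked[OF c e \<alpha> \<beta>] .
  have x: "x \<notin> ?K"
  proof
    assume "x \<in> ?K"
    then have "z \<in> kempe_component ?F c \<alpha> \<beta> x" by (rule kempe_component_sym)
    then show False
      using kempe_component_three_ends[OF c, of \<alpha> x \<beta> y z] \<alpha> \<beta> z_end z edge_ends_neq[OF e] link by metis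
  qed
  then have y: "y \<notin> ?K"
    using kempe_component_trans kempe_component_sym[OF link] by metis
  note out = kempe_swap_outside[OF kempe_closed_component two' ] missing_kempe_swap_outside[OF kempe_closed_component two']
  show ?thesis
  proof (intro exI[of _ ?c] conjI allI ballI impI)
    show "pcol {x, y} ?c"
      by (rule proper_kempe_swap[OF c kempe_closed_component two' lt])
    show "miss {x, y} ?c x = miss {x, y} c x" by (rule out(2)[OF x])
    show "miss {x, y} ?c y = miss {x, y} c y" by (rule out(2)[OF y])
    show "\<gamma> \<in> miss {x, y} ?c z \<longleftrightarrow> Transposition.transpose \<alpha> \<beta> \<gamma> \<in> miss {x, y} c z" for \<gamma>
      by (rule missing_kempe_swap_inside) (use lt in simp_all)
    show "?c f = c f" if "f \<in> ?F" "x \<in> f \<or> y \<in> f" for f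
      using that out(1)[OF that(1) _ x] out(1)[OF that(1) _ y] by blast
    show "?c f = Transposition.transpose \<alpha> \<beta> (c f)" if "z \<in> f" for f
      by (rule kempe_swap_inside[OF _ that]) simp
    show "?c f = c f" if "c f \<notin> {\<alpha>, \<beta>}" for f
      using that by (rule kempe_swap_other_color)
  qed
qed

section \<open>Vizing fans and the adjacency lemma\<close>

text \<open>
  A colour missing at the centre and at the last vertex of a fan could be used there once the
  uncoloured edge has been shifted along the fan.
\<close>

lemma fan_path_ends_disjoint:
  assumes "{x, y} \<in> E" "pcol {x, y} c" "distinct (y # ys)"
    and "\<And>i. i < length ys \<Longrightarrow> {x, ys ! i} \<in> E"
    and "\<And>i. i < length ys \<Longrightarrow> c {x, ys ! i} \<in> miss {x, y} c ((y # ys) ! i)"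
    and "\<alpha> \<in> miss {x, y} c x" "\<alpha> \<in> miss {x, y} c (last (y # ys))"
  shows False
  using assms
proof (induction ys arbitrary: c y)
  case Nil
  then show ?case using ends_miss_disjoint by simp
next
  case (Cons z zs)
  have zE: "{x, z} \<in> E" using Cons.prems(4)[of 0] by simp
  have yz: "y \<noteq> z" using Cons.prems(3) by auto
  have cz: "c {x, z} \<in> miss {x, y} c y" using Cons.prems(5)[of 0] by simp
  note s = shift_uncolored_edge[OF two Cons.prems(1) zE yz Cons.prems(2) cz]
  let ?c = "c({x, y} := c {x, z})"
  have grow: "miss {x, y} c v \<subseteq> miss {x, z} ?c v" if "v \<noteq> y" for v
    using that s(2,4) s(5)[of v] by (cases "v = x"; cases "v = z") auto
  show False
  proof (rule Cons.IH[OF zE s(1)])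
    show "distinct (z # zs)" using Cons.prems(3) by simp
    show "{x, zs ! i} \<in> E" if "i < length zs" for i using Cons.prems(4)[of "Suc i"] that by simp
    show "?c {x, zs ! i} \<in> miss {x, z} ?c ((z # zs) ! i)" if i: "i < length zs" for i
    proof -
      have "y \<notin> set (z # zs)" using Cons.prems(3) by simp
      moreover have "zs ! i \<in> set (z # zs)" "(z # zs) ! i \<in> set (z # zs)" using i by (auto simp: nth_Cons')
      ultimately have "zs ! i \<noteq> y" "(z # zs) ! i \<noteq> y" by metis+
      then have "?c {x, zs ! i} = c {x, zs ! i}" "miss {x, y} c ((z # zs) ! i) \<subseteq> miss {x, z} ?c ((z # zs) ! i)"
        using grow by (auto simp: doubleton_eq_iff)
      then show ?thesis using Cons.prems(5)[of "Suc i"] i by auto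
    qed
    show "\<alpha> \<in> miss {x, z} ?c x" using Cons.prems(6) s(2) by simp
    define w where "w = last (z # zs)"
    have "w \<in> set (z # zs)" unfolding w_def by (rule last_in_set) simp
    then have "w \<noteq> y" using Cons.prems(3) by auto
    moreover have "\<alpha> \<in> miss {x, y} c w" using Cons.prems(7) by (simp add: w_def)
    ultimately show "\<alpha> \<in> miss {x, z} ?c (last (z # zs))"
      using grow unfolding w_def[symmetric] by blast
  qed
qed

text \<open>
  Instead of one maximal sequence, the fan at \<open>x\<close> is the set of all vertices reachable from \<open>y\<close> by
  steps along which a shift is possible. Its members lie on linear fans (\<open>fan_path\<close>), and it is
  maximal by construction.
\<close>

definition fan_rel :: "'a \<Rightarrow> 'a \<Rightarrow> ('a set \<Rightarrow> nat) \<Rightarrow> ('a \<times> 'a) set" where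
  "fan_rel x y c = {(u, v). {x, v} \<in> E - {{x, y}} \<and> c {x, v} \<in> miss {x, y} c u}"

definition fan :: "'a \<Rightarrow> 'a \<Rightarrow> ('a set \<Rightarrow> nat) \<Rightarrow> 'a set" where
  "fan x y c = {v. (y, v) \<in> (fan_rel x y c)\<^sup>*}"

lemma fan_path:
  assumes "v \<in> fan x y c"
  obtains ys where "distinct (y # ys)" "last (y # ys) = v"
    "\<And>i. i < length ys \<Longrightarrow> {x, ys ! i} \<in> E - {{x, y}} \<and> c {x, ys ! i} \<in> miss {x, y} c ((y # ys) ! i)"
proof -
  obtain p where p: "p \<noteq> []" "hd p = y" "last p = v" "distinct p" "successively (\<lambda>u v. (u, v) \<in> fan_rel x y c) p"
    using rtrancl_distinct_path[of y v "fan_rel x y c"] assms by (auto simp: fan_def)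
  obtain ys where ys: "p = y # ys" using p(1,2) by (cases p) auto
  show thesis
  proof (rule that[of ys])
    fix i assume "i < length ys"
    then have "((y # ys) ! i, (y # ys) ! Suc i) \<in> fan_rel x y c"
      using p(5) ys unfolding successively_conv_nth by simp
    then show "{x, ys ! i} \<in> E - {{x, y}} \<and> c {x, ys ! i} \<in> miss {x, y} c ((y # ys) ! i)"
      by (simp add: fan_rel_def)
  qed (use p ys in auto)
qed

lemma fan_miss_disjoint_center:
  assumes "{x, y} \<in> E" "pcol {x, y} c" "v \<in> fan x y c" "\<alpha> \<in> miss {x, y} c x" "\<alpha> \<in> miss {x, y} c v"
  shows False
proof -
  obtain ys where "distinct (y # ys)" "last (y # ys) = v"
    "\<And>i. i < length ys \<Longrightarrow> {x, ys ! i} \<in> E - {{x, y}} \<and> c {x, ys ! i} \<in> miss {x, y} c ((y # ys) ! i)"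
    using fan_path[OF assms(3)] by blast
  then show False using fan_path_ends_disjoint[OF assms(1,2), of ys \<alpha>] assms(4,5) by auto
qed

text \<open>
  If \<open>x\<close> and \<open>v\<close> were not linked, then after exchanging \<open>\<alpha>\<close> and \<open>\<eta>\<close> on the component of \<open>v\<close> both \<open>x\<close>
  and \<open>v\<close> would miss \<open>\<alpha>\<close>. The fan leading to \<open>v\<close> may be damaged by the exchange, but only behind a
  vertex that misses \<open>\<alpha>\<close> already; so its part up to the first such vertex is intact and
  \<open>fan_path_ends_disjoint\<close> applies.
\<close>

lemma fan_linked:
  assumes e: "{x, y} \<in> E" and c: "pcol {x, y} c" and v: "v \<in> fan x y c"
    and \<alpha>: "\<alpha> \<in> miss {x, y} c x" and \<eta>: "\<eta> \<in> miss {x, y} c v"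
  shows "v \<in> kempe_component (E - {{x, y}}) c \<alpha> \<eta> x"
proof (rule ccontr)
  assume unlinked: "v \<notin> kempe_component (E - {{x, y}}) c \<alpha> \<eta> x"
  let ?F = "E - {{x, y}}" and ?K = "kempe_component (E - {{x, y}}) c \<alpha> \<eta> v"
  let ?c = "kempe_swap ?K \<alpha> \<eta> c"
  note lt = missing_lt[OF \<alpha>] missing_lt[OF \<eta>]
  have x: "x \<notin> ?K" using unlinked kempe_component_sym by metis
  have c': "pcol {x, y} ?c"
    by (rule proper_kempe_swap[OF c kempe_closed_component two' lt])
  have \<alpha>': "\<alpha> \<in> miss {x, y} ?c x"
    using missing_kempe_swap_outside[OF kempe_closed_component two' x] \<alpha> by simp
  have at_x: "?c f = c f" if "f \<in> ?F" "x \<in> f" for f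
    using kempe_swap_outside[OF kempe_closed_component two' that x] .
  obtain ys where ys: "distinct (y # ys)" "last (y # ys) = v"
    and step: "\<And>i. i < length ys \<Longrightarrow> {x, ys ! i} \<in> ?F \<and> c {x, ys ! i} \<in> miss {x, y} c ((y # ys) ! i)"
    using fan_path[OF v] by blast
  have "\<alpha> \<in> miss {x, y} ?c v"
    by (subst missing_kempe_swap_inside) (use lt \<eta> in simp_all)
  moreover have "(y # ys) ! length ys = v"
    using ys(2) last_conv_nth[of "y # ys"] by (metis diff_Suc_1 length_Cons list.distinct(1))
  ultimately have "\<exists>l \<le> length ys. \<alpha> \<in> miss {x, y} ?c ((y # ys) ! l)" by auto
  then obtain m where m: "m \<le> length ys" "\<alpha> \<in> miss {x, y} ?c ((y # ys) ! m)" by blast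
  define l where "l = (LEAST l. \<alpha> \<in> miss {x, y} ?c ((y # ys) ! l))"
  have l: "l \<le> length ys" "\<alpha> \<in> miss {x, y} ?c ((y # ys) ! l)"
    using Least_le[of "\<lambda>l. \<alpha> \<in> miss {x, y} ?c ((y # ys) ! l)" m] m
      LeastI[of "\<lambda>l. \<alpha> \<in> miss {x, y} ?c ((y # ys) ! l)" m] by (auto simp: l_def)
  have first: "\<alpha> \<notin> miss {x, y} ?c ((y # ys) ! j)" if "j < l" for j
    using that unfolding l_def by (rule not_less_Least)
  show False
  proof (rule fan_path_ends_disjoint[OF e c', of "take l ys" \<alpha>])
    have "y # take l ys = take (Suc l) (y # ys)" by simp
    then show "distinct (y # take l ys)" using ys(1) distinct_take by metis
    show "{x, take l ys ! i} \<in> E" if "i < length (take l ys)" for i using step[of i] that by auto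
    show "?c {x, take l ys ! i} \<in> miss {x, y} ?c ((y # take l ys) ! i)" if i: "i < length (take l ys)" for i
    proof -
      let ?u = "(y # ys) ! i" and ?\<gamma> = "c {x, ys ! i}"
      have i': "i < l" "i < length ys" using i by auto
      have u: "(y # take l ys) ! i = ?u" using i' by (cases i) auto
      have f: "{x, ys ! i} \<in> ?F" "?\<gamma> \<in> miss {x, y} c ?u" using step[OF i'(2)] by auto
      have col: "?c {x, take l ys ! i} = ?\<gamma>" using at_x[OF f(1)] i' by simp
      have "?\<gamma> \<in> miss {x, y} ?c ?u"
      proof (cases "?u \<in> ?K")
        case False
        then show ?thesis using missing_kempe_swap_outside[OF kempe_closed_component two' False] f(2) by simp
      next
        case True
        have "?\<gamma> \<noteq> \<alpha>" using missing_color[OF \<alpha> f(1)] by simp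
        moreover have "?\<gamma> \<noteq> \<eta>"
        proof
          assume "?\<gamma> = \<eta>"
          then have "\<alpha> \<in> miss {x, y} ?c ?u"
            using f(2) by (subst missing_kempe_swap_inside[OF True lt]) simp
          then show False using first[OF i'(1)] by simp
        qed
        ultimately show ?thesis
          using f(2) by (subst missing_kempe_swap_inside[OF True lt]) (simp add: Transposition.transpose_def)
      qed
      then show ?thesis using col u by simp
    qed
    show "\<alpha> \<in> miss {x, y} ?c x" by (rule \<alpha>')
    have "last (y # take l ys) = (y # ys) ! l"
      using l(1) by (cases l) (auto simp: last_conv_nth)
    then show "\<alpha> \<in> miss {x, y} ?c (last (y # take l ys))" using l(2) by simp
  qed
qed

lemma fan_not_center:
  assumes e: "{x, y} \<in> E" and v: "v \<in> fan x y c"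
  shows "v \<noteq> x"
proof -
  have "(y, v) \<in> (fan_rel x y c)\<^sup>*" using v by (simp add: fan_def)
  then show ?thesis
  proof (cases rule: rtranclE)
    case base
    then show ?thesis using edge_ends_neq[OF e] by simp
  next
    case (step u)
    then show ?thesis using edge_ends_neq[of x v] by (auto simp: fan_rel_def)
  qed
qed

text \<open>
  Two fan vertices missing \<open>\<eta>\<close> would both be linked to \<open>x\<close>, giving three ends of one chain.
\<close>

lemma fan_miss_disjoint:
  assumes e: "{x, y} \<in> E" and c: "pcol {x, y} c" and u: "u \<in> fan x y c" and v: "v \<in> fan x y c" and uv: "u \<noteq> v"
  shows "miss {x, y} c u \<inter> miss {x, y} c v = {}"
proof (rule ccontr)
  assume "miss {x, y} c u \<inter> miss {x, y} c v \<noteq> {}"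
  then obtain \<eta> where \<eta>: "\<eta> \<in> miss {x, y} c u" "\<eta> \<in> miss {x, y} c v" by auto
  obtain \<alpha> where \<alpha>: "\<alpha> \<in> miss {x, y} c x" using miss_end_nonempty[OF c e] by blast
  show False
    using kempe_component_three_ends[OF c, of \<alpha> x \<eta> u v] \<alpha> \<eta> uv fan_not_center[OF e] u v
      fan_linked[OF e c u \<alpha> \<eta>(1)] fan_linked[OF e c v \<alpha> \<eta>(2)] by metis
qed

lemma edges_at_vertex:
  assumes "f \<in> E" "x \<in> f"
  obtains z where "f = {x, z}" "z \<noteq> x"
  using edge_through_vertex[of f x] two assms by blast

text \<open>
  Vizing's adjacency lemma. By maximality the fan, without \<open>y\<close>, is in bijection with the colours
  missing at its vertices, and these sets of colours are disjoint. So the numbers of missing colours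
  add up to the number of fan vertices other than \<open>y\<close>. Since \<open>y\<close> contributes \<open>k - d(y) + 1\<close>, that many of
  the others must contribute nothing, that is, have degree \<open>k\<close>.
\<close>

theorem vizing_adjacency:
  assumes e: "{x, y} \<in> E"
  shows "k + 1 \<le> card {z \<in> neighbours E x - {y}. vertex_degree E z = k} + vertex_degree E y"
proof -
  obtain c where c: "pcol {x, y} c" using deletion_colorable[OF e] by blast
  let ?S = "fan x y c" and ?F = "E - {{x, y}}" and ?m = "miss {x, y} c"
  let ?S' = "?S - {y}"
  have y: "y \<in> ?S" by (simp add: fan_def)
  have reach: "{x, z} \<in> ?F \<and> (\<exists>u\<in>?S. c {x, z} \<in> ?m u)" if z: "z \<in> ?S'" for z
  proof -
    have "(y, z) \<in> (fan_rel x y c)\<^sup>*" using z by (simp add: fan_def)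
    then show ?thesis
    proof (cases rule: rtranclE)
      case base
      then show ?thesis using z by simp
    next
      case (step u)
      then show ?thesis by (auto simp: fan_rel_def fan_def)
    qed
  qed
  have sub: "?S' \<subseteq> neighbours E x - {y}"
    using reach fan_not_center[OF e] by (auto simp: neighbours_def)
  have "finite (neighbours E x)"
  proof (rule finite_subset)
    show "neighbours E x \<subseteq> V" using simple by (auto simp: neighbours_def simple_graph_def)
    show "finite V" using simple by (simp add: simple_graph_def)
  qed
  then have fin2: "finite (neighbours E x - {y})" by (rule finite_Diff)
  have fin: "finite ?S'" by (rule finite_subset[OF sub fin2])
  then have finS: "finite ?S" by simp
  have inj: "inj_on (\<lambda>z. c {x, z}) ?S'"
  proof (rule inj_onI)
    fix z z' assume "z \<in> ?S'" "z' \<in> ?S'" "c {x, z} = c {x, z'}"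
    then show "z = z'" using proper_colors_differ[OF c, of x z z'] reach by blast
  qed
  have image: "(\<lambda>z. c {x, z}) ` ?S' = (\<Union>u\<in>?S. ?m u)"
  proof (intro equalityI subsetI)
    fix \<gamma> assume "\<gamma> \<in> (\<Union>u\<in>?S. ?m u)"
    then obtain u where u: "u \<in> ?S" "\<gamma> \<in> ?m u" by blast
    then have "\<gamma> \<notin> ?m x" using fan_miss_disjoint_center[OF e c] by blast
    then obtain f where f: "f \<in> ?F" "x \<in> f" "c f = \<gamma>"
      using missing_lt[OF u(2)] by (auto simp: missing_def)
    then obtain z where z: "f = {x, z}" using edges_at_vertex[of f x] by blast
    then have "(u, z) \<in> fan_rel x y c" using f u by (auto simp: fan_rel_def)
    then have "z \<in> ?S" using u(1) by (auto simp: fan_def intro: rtrancl_into_rtrancl)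
    moreover have "z \<noteq> y" using f(1) z by auto
    ultimately show "\<gamma> \<in> (\<lambda>z. c {x, z}) ` ?S'" using f z by blast
  qed (use reach in blast)
  have "card ?S' = card (\<Union>u\<in>?S. ?m u)"
    using card_image[OF inj] image by simp
  also have "\<dots> = (\<Sum>u\<in>?S. card (?m u))"
    by (rule card_UN_disjoint[OF finS]) (use fan_miss_disjoint[OF e c] in auto)
  also have "\<dots> = card (?m y) + (\<Sum>u\<in>?S'. card (?m u))"
    by (rule sum.remove[OF finS y])
  finally have count: "card ?S' = card (?m y) + (\<Sum>u\<in>?S'. card (?m u))" .
  have my: "card (?m y) + vertex_degree E y = k + 1" using card_miss[OF c e, of y] by simp
  let ?A = "{z \<in> ?S'. vertex_degree E z = k}"
  have "card (?S' - ?A) = (\<Sum>u\<in>?S' - ?A. 1)" by simp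
  also have "\<dots> \<le> (\<Sum>u\<in>?S' - ?A. card (?m u))"
  proof (rule sum_mono)
    fix u assume u: "u \<in> ?S' - ?A"
    then have "u \<notin> {x, y}" using fan_not_center[OF e] by auto
    then have "card (?m u) + vertex_degree E u = k" using card_miss[OF c e, of u] by simp
    then show "1 \<le> card (?m u)" using u by auto
  qed
  also have "\<dots> \<le> (\<Sum>u\<in>?S'. card (?m u))"
    by (rule sum_mono2) (use fin in auto)
  finally have "card ?S' - card ?A \<le> (\<Sum>u\<in>?S'. card (?m u))"
    using fin by (subst (asm) card_Diff_subset) auto
  moreover have "card ?A \<le> card ?S'" using fin by (intro card_mono) auto
  ultimately have "k + 1 \<le> card ?A + vertex_degree E y" using count my by linarith
  moreover have "card ?A \<le> card {z \<in> neighbours E x - {y}. vertex_degree E z = k}"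
    by (rule card_mono) (use fin2 sub in auto)
  ultimately show ?thesis by linarith
qed

section \<open>Neighbourhoods of vertices of degree two and three\<close>

text \<open>
  Exchanging \<open>\<alpha>\<close> with colours missing at \<open>y\<close> on the chain of \<open>z\<close> replaces any two colours missing at \<open>z\<close>
  by \<open>\<alpha>\<close> and a prescribed \<open>\<beta>\<close>: first \<open>\<alpha>\<close> is made to be missing, then traded for \<open>\<beta>\<close>, and finally \<open>\<alpha>\<close> is
  regained in exchange for the second colour.
\<close>

lemma force_missing_colors:
  assumes c: "pcol {x, y} c" and e: "{x, y} \<in> E" and \<alpha>: "\<alpha> \<in> miss {x, y} c x" and \<beta>: "\<beta> \<in> miss {x, y} c y"
    and z: "z \<noteq> x" "z \<noteq> y" and sub: "miss {x, y} c z \<subseteq> insert \<alpha> (miss {x, y} c y)"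
    and two_missing: "card (miss {x, y} c z) \<ge> 2"
  shows "\<exists>c'. pcol {x, y} c' \<and>
    miss {x, y} c' x = miss {x, y} c x \<and> miss {x, y} c' y = miss {x, y} c y \<and>
    (\<forall>f\<in>E - {{x, y}}. x \<in> f \<or> y \<in> f \<longrightarrow> c' f = c f) \<and>
    \<alpha> \<in> miss {x, y} c' z \<and> \<beta> \<in> miss {x, y} c' z"
proof -
  let ?F = "E - {{x, y}}" and ?m = "miss {x, y}"
  define Q where "Q c1 \<longleftrightarrow> pcol {x, y} c1 \<and> ?m c1 x = ?m c x \<and> ?m c1 y = ?m c y \<and>
     (\<forall>f\<in>?F. x \<in> f \<or> y \<in> f \<longrightarrow> c1 f = c f) \<and> ?m c1 z \<subseteq> insert \<alpha> (?m c y)" for c1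
  have Qc: "Q c" using c sub by (simp add: Q_def)
  have swap: "\<exists>c2. Q c2 \<and> (\<forall>\<gamma>. \<gamma> \<in> ?m c2 z \<longleftrightarrow> Transposition.transpose \<alpha> \<eta> \<gamma> \<in> ?m c1 z)"
    if Q: "Q c1" and \<eta>: "\<eta> \<in> ?m c y" and fin: "\<alpha> \<in> ?m c1 z \<or> \<eta> \<in> ?m c1 z" for c1 \<eta>
  proof -
    have c1: "pcol {x, y} c1" "\<alpha> \<in> ?m c1 x" "\<eta> \<in> ?m c1 y" using Q \<alpha> \<eta> by (auto simp: Q_def)
    obtain c2 where c2: "pcol {x, y} c2" "?m c2 x = ?m c1 x" "?m c2 y = ?m c1 y"
      "\<forall>\<gamma>. \<gamma> \<in> ?m c2 z \<longleftrightarrow> Transposition.transpose \<alpha> \<eta> \<gamma> \<in> ?m c1 z"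
      "\<forall>f\<in>?F. x \<in> f \<or> y \<in> f \<longrightarrow> c2 f = c1 f"
      using swap_third_vertex[OF c1(1) e c1(2,3) z fin] by (elim exE conjE) (rule that; assumption)
    have "?m c2 z \<subseteq> insert \<alpha> (?m c y)"
    proof
      fix \<gamma> assume "\<gamma> \<in> ?m c2 z"
      then have "Transposition.transpose \<alpha> \<eta> \<gamma> \<in> insert \<alpha> (?m c y)" using c2(4) Q by (auto simp: Q_def)
      then show "\<gamma> \<in> insert \<alpha> (?m c y)"
        using \<eta> by (cases "\<gamma> = \<alpha>"; cases "\<gamma> = \<eta>") (auto simp: Transposition.transpose_def)
    qed
    then have "Q c2" using c2 Q by (simp add: Q_def)
    then show ?thesis using c2(4) by blast
  qed
  obtain \<theta>1 \<theta>2 where \<theta>: "\<theta>1 \<in> ?m c z" "\<theta>2 \<in> ?m c z" "\<theta>1 \<noteq> \<theta>2"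
  proof -
    obtain T where "T \<subseteq> ?m c z" "card T = 2" using two_missing obtain_subset_with_card_n by metis
    then show thesis using that by (auto simp: card_2_iff)
  qed
  \<comment> \<open>Exchanges with \<open>\<alpha>\<close> at \<open>z\<close> preserve \<open>Q\<close>, so they can be iterated.\<close>
  have "\<exists>c1 \<theta>. Q c1 \<and> \<alpha> \<in> ?m c1 z \<and> \<theta> \<in> ?m c1 z \<and> \<theta> \<noteq> \<alpha>"
  proof (cases "\<alpha> \<in> ?m c z")
    case True
    then show ?thesis using Qc \<theta> by metis
  next
    case False
    then have ne: "\<theta>1 \<noteq> \<alpha>" "\<theta>2 \<noteq> \<alpha>" using \<theta> by auto
    then have "\<theta>1 \<in> ?m c y" using \<theta>(1) sub by auto
    then obtain c1 where c1: "Q c1" "\<And>\<gamma>. \<gamma> \<in> ?m c1 z \<longleftrightarrow> Transposition.transpose \<alpha> \<theta>1 \<gamma> \<in> ?m c z"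
      using swap[OF Qc] \<theta>(1) by metis
    have "\<alpha> \<in> ?m c1 z" using c1(2) \<theta>(1) by simp
    moreover have "\<theta>2 \<in> ?m c1 z" using c1(2)[of \<theta>2] \<theta> ne by (simp add: Transposition.transpose_def)
    ultimately show ?thesis using c1(1) ne by metis
  qed
  then obtain c1 \<theta> where c1: "Q c1" "\<alpha> \<in> ?m c1 z" "\<theta> \<in> ?m c1 z" "\<theta> \<noteq> \<alpha>" by blast
  have "\<alpha> \<noteq> \<beta>" using ends_miss_disjoint[OF c e \<alpha>] \<beta> by metis
  have "\<exists>c3. Q c3 \<and> \<alpha> \<in> ?m c3 z \<and> \<beta> \<in> ?m c3 z"
  proof (cases "\<beta> \<in> ?m c1 z")
    case True
    then show ?thesis using c1 by metis
  next
    case False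
    then have "\<theta> \<noteq> \<beta>" using c1 by auto
    obtain c2 where c2: "Q c2" "\<And>\<gamma>. \<gamma> \<in> ?m c2 z \<longleftrightarrow> Transposition.transpose \<alpha> \<beta> \<gamma> \<in> ?m c1 z"
      using swap[OF c1(1) \<beta>] c1(2) by metis
    have \<theta>2: "\<theta> \<in> ?m c2 z" using c2(2)[of \<theta>] c1 \<open>\<theta> \<noteq> \<beta>\<close> by (simp add: Transposition.transpose_def)
    have \<beta>2: "\<beta> \<in> ?m c2 z" using c2(2)[of \<beta>] c1 by simp
    have "\<theta> \<in> ?m c y" using c2(1) \<theta>2 c1(4) by (auto simp: Q_def)
    then obtain c3 where c3: "Q c3" "\<And>\<gamma>. \<gamma> \<in> ?m c3 z \<longleftrightarrow> Transposition.transpose \<alpha> \<theta> \<gamma> \<in> ?m c2 z"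
      using swap[OF c2(1)] \<theta>2 by metis
    have "\<alpha> \<in> ?m c3 z" using c3(2)[of \<alpha>] \<theta>2 by simp
    moreover have "\<beta> \<in> ?m c3 z"
      using c3(2)[of \<beta>] \<beta>2 \<open>\<theta> \<noteq> \<beta>\<close> \<open>\<alpha> \<noteq> \<beta>\<close> by (simp add: Transposition.transpose_def)
    ultimately show ?thesis using c3(1) by metis
  qed
  then obtain c3 where "Q c3" "\<alpha> \<in> ?m c3 z" "\<beta> \<in> ?m c3 z" by blast
  then show ?thesis unfolding Q_def by blast
qed

text \<open>
  Suppose that \<open>q\<close> misses two colours when \<open>{a, x}\<close> is uncoloured. As \<open>x\<close> has degree 2, it misses all
  colours but \<open>\<alpha>\<close>, the one missing at \<open>a\<close>; so the colour \<open>\<beta>\<close> of \<open>{a, p}\<close> and the colour \<open>\<delta>\<close> of \<open>{p, q}\<close>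
  are both exchangeable with \<open>\<alpha>\<close> at \<open>q\<close>. In this way \<open>q\<close> comes to miss \<open>\<beta>\<close> while \<open>{p, q}\<close> gets colour
  \<open>\<alpha>\<close>. After shifting the uncoloured edge to \<open>{a, p}\<close>, both \<open>p\<close> and \<open>q\<close> miss \<open>\<beta>\<close>; recolouring \<open>{p, q}\<close>
  with \<open>\<beta>\<close> frees \<open>\<alpha>\<close> for \<open>{a, p}\<close>.
\<close>

lemma path_from_degree_two_vertex:
  assumes xa: "{x, a} \<in> E" and ap: "{a, p} \<in> E" and pq: "{p, q} \<in> E"
    and dx: "vertex_degree E x = 2" and q: "q \<noteq> x" "q \<noteq> a" and px: "p \<noteq> x"
  shows "k \<le> vertex_degree E q + 1"
proof (rule ccontr)
  assume "\<not> k \<le> vertex_degree E q + 1"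
  then have dq: "vertex_degree E q + 2 \<le> k" by simp
  obtain c where c: "pcol {a, x} c" using deletion_colorable xa by (metis insert_commute)
  have ax: "{a, x} \<in> E" using xa by (simp add: insert_commute)
  note ne = edge_ends_neq[OF xa] edge_ends_neq[OF ap] edge_ends_neq[OF pq]
  let ?m = "miss {a, x}"
  obtain \<alpha> where \<alpha>: "\<alpha> \<in> ?m c a" using miss_end_nonempty[OF c ax] by blast
  have "card (?m c x) = k - 1" using card_miss[OF c ax, of x] dx by simp
  moreover have sub: "?m c x \<subseteq> {..<k} - {\<alpha>}"
    using ends_miss_disjoint[OF c ax \<alpha>] missing_lt by fastforce
  moreover have "card ({..<k} - {\<alpha>}) = k - 1" using missing_lt[OF \<alpha>] by simp
  ultimately have mx: "?m c x = {..<k} - {\<alpha>}" by (intro card_subset_eq) auto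
  have apF: "{a, p} \<in> E - {{a, x}}" using ap px by (auto simp: doubleton_eq_iff)
  have pqF: "{p, q} \<in> E - {{a, x}}" using pq q by (auto simp: doubleton_eq_iff)
  define \<beta> where "\<beta> = c {a, p}"
  have "\<beta> \<noteq> \<alpha>" using missing_color[OF \<alpha> apF] by (simp add: \<beta>_def)
  moreover have "\<beta> < k" using c apF by (auto simp: \<beta>_def proper_edge_coloring_def)
  ultimately have \<beta>: "\<beta> \<in> ?m c x" by (simp add: mx)
  have two_q: "card (?m c q) \<ge> 2" using card_miss[OF c ax, of q] dq q by simp
  have sub_q: "?m c q \<subseteq> insert \<alpha> (?m c x)" using mx by (auto dest: missing_lt)
  obtain c1 where c1: "pcol {a, x} c1" "?m c1 a = ?m c a" "?m c1 x = ?m c x"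
    "\<forall>f\<in>E - {{a, x}}. a \<in> f \<or> x \<in> f \<longrightarrow> c1 f = c f"
    "\<alpha> \<in> ?m c1 q" "\<beta> \<in> ?m c1 q"
    using force_missing_colors[OF c ax \<alpha> \<beta> q(2,1) sub_q two_q]
    by (elim exE conjE) (rule that; assumption)
  define \<delta> where "\<delta> = c1 {p, q}"
  have \<delta>_ne: "\<delta> \<noteq> \<alpha>" "\<delta> \<noteq> \<beta>"
    using missing_color[OF c1(5) pqF] missing_color[OF c1(6) pqF] by (auto simp: \<delta>_def)
  moreover have "\<delta> < k" using c1(1) pqF by (auto simp: \<delta>_def proper_edge_coloring_def)
  ultimately have \<delta>: "\<delta> \<in> ?m c1 x" using mx c1(3) by simp
  have \<alpha>1: "\<alpha> \<in> ?m c1 a" using \<alpha> c1(2) by simp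
  obtain c2 where c2: "pcol {a, x} c2" "?m c2 a = ?m c1 a" "?m c2 x = ?m c1 x"
    "\<forall>\<gamma>. \<gamma> \<in> ?m c2 q \<longleftrightarrow> Transposition.transpose \<alpha> \<delta> \<gamma> \<in> ?m c1 q"
    "\<forall>f\<in>E - {{a, x}}. a \<in> f \<or> x \<in> f \<longrightarrow> c2 f = c1 f"
    "\<forall>f. q \<in> f \<longrightarrow> c2 f = Transposition.transpose \<alpha> \<delta> (c1 f)"
    using swap_third_vertex[OF c1(1) ax \<alpha>1 \<delta> q(2,1) disjI1[OF c1(5)]]
    by (elim exE conjE) (rule that; assumption)
  have c2pq: "c2 {p, q} = \<alpha>" using c2(6) by (simp add: \<delta>_def)
  have c2ap: "c2 {a, p} = \<beta>" using c2(5) c1(4) apF by (simp add: \<beta>_def)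
  have \<beta>q: "\<beta> \<in> ?m c2 q" using c2(4) c1(6) \<delta>_ne \<open>\<beta> \<noteq> \<alpha>\<close> by (simp add: Transposition.transpose_def)
  have \<beta>x: "c2 {a, p} \<in> ?m c2 x" using c2ap c2(3) c1(3) \<beta> by simp
  define c3 where "c3 = c2({a, x} := c2 {a, p})"
  note s = shift_uncolored_edge[OF two ax ap px[symmetric] c2(1) \<beta>x, folded c3_def]
  have c3p: "\<beta> \<in> miss {a, p} c3 p" using s(4) c2ap by simp
  have "q \<notin> {a, x, p}" using q ne by auto
  then have c3q: "\<beta> \<in> miss {a, p} c3 q" using s(5)[of q] \<beta>q by simp
  have pqF': "{p, q} \<in> E - {{a, p}}" using pq q by (auto simp: doubleton_eq_iff)
  have c3pq: "c3 {p, q} = \<alpha>" using c2pq pqF by (simp add: c3_def)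
  define c4 where "c4 = c3({p, q} := \<beta>)"
  have "pcol {a, p} c4" unfolding c4_def by (rule proper_recolor[OF s(1) pqF' c3p c3q])
  moreover have "\<alpha> \<in> miss {a, p} c4 p"
    using missing_recolor_gain[OF s(1) pqF', of p \<beta>] c3p c3pq by (simp add: c4_def)
  moreover have "\<alpha> \<in> miss {a, p} c4 a"
  proof -
    have "a \<notin> {p, q}" using q ne by auto
    then have "miss {a, p} c4 a = miss {a, p} c3 a" unfolding c4_def by (rule missing_recolor_other)
    then show ?thesis using s(2) c2(2) c1(2) \<alpha> by simp
  qed
  ultimately show False using ends_miss_disjoint ap by blast
qed

text \<open>
  Leave \<open>{a, y}\<close> uncoloured. Let \<open>\<alpha>\<close> be the colour missing at \<open>a\<close> and \<open>\<zeta>\<close> that of \<open>{a, z}\<close>. The vertices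
  \<open>y\<close> and \<open>z\<close> miss \<open>4 + 3 > 6\<close> colours, so \<open>z\<close> is not in the fan of \<open>y\<close> and \<open>y\<close> sees exactly \<open>\<alpha>\<close> and \<open>\<zeta>\<close>.
  Hence the colours \<open>\<beta>\<close> of \<open>{a, b}\<close> and \<open>\<delta>\<close> of \<open>{z, b}\<close> are missing at \<open>y\<close>, once \<open>z\<close> is made to miss \<open>\<alpha>\<close>
  and \<open>\<beta>\<close>. Shifting the uncoloured edge to \<open>{a, b}\<close>, giving \<open>{z, b}\<close> the colour \<open>\<beta>\<close> and \<open>{a, y}\<close> the
  colour \<open>\<alpha>\<close>, one reaches a colouring in which \<open>a\<close> misses \<open>\<beta>\<close> and \<open>b\<close> misses \<open>\<delta>\<close>, but the
  \<open>\<beta>\<close>-\<open>\<delta>\<close> chain of \<open>b\<close> is the single edge \<open>{b, z}\<close> and does not reach \<open>a\<close>.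
\<close>

lemma no_triangle_at_second_degree_three_neighbour:
  assumes k: "k = 6" and ay: "{a, y} \<in> E" and az: "{a, z} \<in> E" and ab: "{a, b} \<in> E" and zb: "{z, b} \<in> E"
    and yz: "y \<noteq> z" and by': "b \<noteq> y"
    and da: "vertex_degree E a = 6" and dy: "vertex_degree E y = 3" and dz: "vertex_degree E z = 3"
  shows False
proof -
  obtain c where c: "pcol {a, y} c" using deletion_colorable[OF ay] by blast
  note ne = edge_ends_neq[OF ay] edge_ends_neq[OF az] edge_ends_neq[OF ab] edge_ends_neq[OF zb]
  let ?m = "miss {a, y}"
  have card_m: "card (?m c a) = 1" "card (?m c y) = 4" "card (?m c z) = 3"
    using card_miss[OF c ay, of a] card_miss[OF c ay, of y] card_miss[OF c ay, of z] k da dy dz ne yz by auto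
  obtain \<alpha> where \<alpha>: "\<alpha> \<in> ?m c a" using miss_end_nonempty[OF c ay] by blast
  have azF: "{a, z} \<in> E - {{a, y}}" and abF: "{a, b} \<in> E - {{a, y}}" and zbF: "{z, b} \<in> E - {{a, y}}"
    using az ab zb yz by' ne by (auto simp: doubleton_eq_iff)
  define \<zeta> where "\<zeta> = c {a, z}"
  have \<zeta>\<alpha>: "\<zeta> \<noteq> \<alpha>" using missing_color[OF \<alpha> azF] by (simp add: \<zeta>_def)
  have \<zeta>k: "\<zeta> < 6" using c azF k by (auto simp: \<zeta>_def proper_edge_coloring_def)
  have \<zeta>y: "\<zeta> \<notin> ?m c y"
  proof
    assume "\<zeta> \<in> ?m c y"
    then have "(y, z) \<in> fan_rel a y c" using azF by (simp add: fan_rel_def \<zeta>_def)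
    then have "z \<in> fan a y c" "y \<in> fan a y c" by (auto simp: fan_def)
    then have "?m c y \<inter> ?m c z = {}" using fan_miss_disjoint[OF ay c] yz by metis
    then have "card (?m c y \<union> ?m c z) = 7" using card_m by (simp add: card_Un_disjoint)
    moreover have "card (?m c y \<union> ?m c z) \<le> card {..<6::nat}"
      by (rule card_mono) (use missing_lt k in auto)
    ultimately show False by simp
  qed
  have \<alpha>y: "\<alpha> \<notin> ?m c y" using ends_miss_disjoint[OF c ay \<alpha>] by blast
  have my: "?m c y = {..<6} - {\<alpha>, \<zeta>}"
  proof (rule card_subset_eq)
    show "?m c y \<subseteq> {..<6} - {\<alpha>, \<zeta>}" using missing_lt k \<alpha>y \<zeta>y by auto
    have "card ({..<6} - {\<alpha>, \<zeta>}) = 6 - 2"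
      using \<zeta>\<alpha> \<zeta>k missing_lt[OF \<alpha>] k by (subst card_Diff_subset) auto
    then show "card (?m c y) = card ({..<6} - {\<alpha>, \<zeta>})" using card_m by simp
  qed simp
  define \<beta> where "\<beta> = c {a, b}"
  have "\<beta> < 6" using c abF k by (auto simp: \<beta>_def proper_edge_coloring_def)
  moreover have "\<beta> \<noteq> \<alpha>" using missing_color[OF \<alpha> abF] by (simp add: \<beta>_def)
  moreover have "\<beta> \<noteq> \<zeta>"
    unfolding \<beta>_def \<zeta>_def using proper_colors_differ[OF c abF azF] ne by simp
  ultimately have \<beta>: "\<beta> \<in> ?m c y" by (simp add: my)
  have \<zeta>z: "\<zeta> \<notin> ?m c z" using missing_color[of \<zeta> _ k c z "{a, z}"] azF by (auto simp: \<zeta>_def)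
  have two_z: "2 \<le> card (?m c z)" using card_m(3) by simp
  have sub_z: "?m c z \<subseteq> insert \<alpha> (?m c y)"
  proof
    fix \<gamma> assume \<gamma>: "\<gamma> \<in> ?m c z"
    then have "\<gamma> < 6" "\<gamma> \<noteq> \<zeta>" using missing_lt[OF \<gamma>] k \<zeta>z by auto
    then show "\<gamma> \<in> insert \<alpha> (?m c y)" unfolding my by simp
  qed
  obtain c1 where c1: "pcol {a, y} c1" "?m c1 a = ?m c a" "?m c1 y = ?m c y"
    "\<forall>f\<in>E - {{a, y}}. a \<in> f \<or> y \<in> f \<longrightarrow> c1 f = c f"
    "\<alpha> \<in> ?m c1 z" "\<beta> \<in> ?m c1 z"
    using force_missing_colors[OF c ay \<alpha> \<beta> ne(2)[symmetric] yz[symmetric] sub_z two_z]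
    by (elim exE conjE) (rule that; assumption)
  define \<delta> where "\<delta> = c1 {z, b}"
  have "\<delta> < 6" using c1(1) zbF k by (auto simp: \<delta>_def proper_edge_coloring_def)
  moreover have \<delta>_ne: "\<delta> \<noteq> \<alpha>" "\<delta> \<noteq> \<beta>"
    using missing_color[OF c1(5) zbF] missing_color[OF c1(6) zbF] by (auto simp: \<delta>_def)
  moreover have "\<delta> \<noteq> \<zeta>"
  proof -
    have "{z, a} \<in> E - {{a, y}}" using azF by (simp add: insert_commute)
    then have "c1 {z, b} \<noteq> c1 {z, a}" using proper_colors_differ[OF c1(1) zbF] ne by metis
    then show ?thesis using bspec[OF c1(4) azF] by (simp add: \<delta>_def \<zeta>_def insert_commute)
  qed
  ultimately have \<delta>: "\<delta> \<in> ?m c1 y" using my c1(3) by simp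
  have c1ab: "c1 {a, b} = \<beta>" using bspec[OF c1(4) abF] by (simp add: \<beta>_def)
  have \<beta>1: "c1 {a, b} \<in> ?m c1 y" using c1ab \<beta> c1(3) by simp
  let ?n = "miss {a, b}"
  \<comment> \<open>From here on \<open>{a, b}\<close> is uncoloured and \<open>{a, y}\<close> has colour \<open>\<beta>\<close>.\<close>
  define c2 where "c2 = c1({a, y} := c1 {a, b})"
  note s = shift_uncolored_edge[OF two ay ab by'[symmetric] c1(1) \<beta>1, folded c2_def, unfolded c1ab]
  have n2: "\<alpha> \<in> ?n c2 a" "\<beta> \<in> ?n c2 b" "\<delta> \<in> ?n c2 y" "\<alpha> \<in> ?n c2 z" "\<beta> \<in> ?n c2 z"
    using s c1 \<alpha> \<delta> \<delta>_ne yz ne by auto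
  have zbF': "{z, b} \<in> E - {{a, b}}" and ayF': "{a, y} \<in> E - {{a, b}}"
    using zb ay ne by' by (auto simp: doubleton_eq_iff)
  have c2zb: "c2 {z, b} = \<delta>" using zbF by (simp add: c2_def \<delta>_def)
  define c3 where "c3 = c2({z, b} := \<beta>)"
  have c3: "pcol {a, b} c3" unfolding c3_def by (rule proper_recolor[OF s(1) zbF' n2(5,2)])
  have gain: "\<delta> \<in> ?n c3 b" "\<delta> \<in> ?n c3 z"
    using missing_recolor_gain[OF s(1) zbF', of b \<beta>] missing_recolor_gain[OF s(1) zbF', of z \<beta>] n2 c2zb
    by (auto simp: c3_def)
  have "a \<notin> {z, b}" "y \<notin> {z, b}" using ne yz by' by auto
  then have other: "\<alpha> \<in> ?n c3 a" "\<delta> \<in> ?n c3 y"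
    using n2 missing_recolor_other[of _ "{z, b}"] unfolding c3_def by metis+
  have c3z: "\<alpha> \<noteq> c3 f \<and> \<delta> \<noteq> c3 f" if "f \<in> E - {{a, b}}" "z \<in> f" for f
  proof
    show "\<delta> \<noteq> c3 f" using missing_color[OF gain(2) that] by simp
    show "\<alpha> \<noteq> c3 f"
      using missing_color[OF n2(4) that] missing_lt \<open>\<beta> \<noteq> \<alpha>\<close> by (auto simp: c3_def)
  qed
  \<comment> \<open>\<open>y\<close> trades \<open>\<delta>\<close> for \<open>\<alpha>\<close>, so that \<open>{a, y}\<close> can be recoloured; \<open>z\<close> misses both colours
      and is left alone.\<close>
  obtain c4 where c4: "pcol {a, b} c4" "?n c4 a = ?n c3 a" "?n c4 b = ?n c3 b"
    "\<forall>\<gamma>. \<gamma> \<in> ?n c4 y \<longleftrightarrow> Transposition.transpose \<alpha> \<delta> \<gamma> \<in> ?n c3 y"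
    "\<forall>f\<in>E - {{a, b}}. a \<in> f \<or> b \<in> f \<longrightarrow> c4 f = c3 f"
    "\<forall>f. c3 f \<notin> {\<alpha>, \<delta>} \<longrightarrow> c4 f = c3 f"
    using swap_third_vertex[OF c3 ab other(1) gain(1) ne(1)[symmetric] by'[symmetric] disjI2[OF other(2)]]
    by (elim exE conjE) (rule that; assumption)
  have \<alpha>4: "\<alpha> \<in> ?n c4 a" "\<alpha> \<in> ?n c4 y" using c4(2) c4(4) other by auto
  have c4ay: "c4 {a, y} = \<beta>"
  proof -
    have "{a, y} \<noteq> {z, b}" using ne by (auto simp: doubleton_eq_iff)
    then have "c3 {a, y} = \<beta>" by (simp add: c3_def c2_def c1ab)
    then show ?thesis using c4(5) ayF' by simp
  qed
  have c4zb: "c4 {z, b} = \<beta>" using c4(5) zbF' by (simp add: c3_def)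
  have \<delta>4: "\<delta> \<in> ?n c4 z"
  proof -
    have "c4 f \<noteq> \<delta>" if f: "f \<in> E - {{a, b}}" "z \<in> f" for f
    proof -
      have "c3 f \<notin> {\<alpha>, \<delta>}" using c3z[OF f] by auto
      then have "c4 f = c3 f" using c4(6) by blast
      then show ?thesis using c3z[OF f] by simp
    qed
    then show ?thesis using missing_lt[OF gain(2)] by (simp add: missing_def)
  qed
  define c5 where "c5 = c4({a, y} := \<alpha>)"
  have c5: "pcol {a, b} c5" unfolding c5_def by (rule proper_recolor[OF c4(1) ayF' \<alpha>4])
  have "\<beta> \<in> ?n c5 a"
    using missing_recolor_gain[OF c4(1) ayF', of a \<alpha>] \<alpha>4 c4ay by (simp add: c5_def)
  moreover have \<delta>b: "\<delta> \<in> ?n c5 b"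
  proof -
    have "b \<notin> {a, y}" using ne by' by auto
    then have "?n c5 b = ?n c4 b" unfolding c5_def by (rule missing_recolor_other)
    then show ?thesis using c4(3) gain by simp
  qed
  ultimately have "b \<in> kempe_component (E - {{a, b}}) c5 \<beta> \<delta> a"
    using ends_linked[OF c5 ab] by blast
  then have linked: "a \<in> kempe_component (E - {{a, b}}) c5 \<beta> \<delta> b" by (rule kempe_component_sym)
  have \<delta>z: "\<delta> \<in> ?n c5 z"
  proof -
    have "z \<notin> {a, y}" using ne yz by auto
    then have "?n c5 z = ?n c4 z" unfolding c5_def by (rule missing_recolor_other)
    then show ?thesis using \<delta>4 by simp
  qed
  have "{a, y} \<noteq> {z, b}" using ne by (auto simp: doubleton_eq_iff)
  then have c5zb: "c5 {z, b} = \<beta>" using c4zb by (simp add: c5_def)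
  have "kempe_closed (E - {{a, b}}) c5 \<beta> \<delta> {z, b}"
    unfolding kempe_closed_def
  proof (intro allI impI)
    fix u v assume u: "u \<in> {z, b}" and uv: "{u, v} \<in> E - {{a, b}}" "c5 {u, v} \<in> {\<beta>, \<delta>}"
    have "\<delta> \<in> ?n c5 u" using u \<delta>z \<delta>b by auto
    then have "c5 {u, v} = \<beta>" using missing_color[of \<delta> _ k c5 u "{u, v}"] uv by auto
    then have "{u, v} = {z, b}"
      using proper_edge_coloringD[OF c5 uv(1) zbF', of u] u c5zb by auto
    then show "v \<in> {z, b}" by auto
  qed
  then have "kempe_component (E - {{a, b}}) c5 \<beta> \<delta> b \<subseteq> {z, b}"
    by (rule kempe_component_least) simp
  then show False using linked ne by auto
qed

end

section \<open>The two sides of a closed curve\<close>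

lemma punctured_ball_connected: "connected (ball (p::complex) r - {p})"
proof (rule connected_punctured_convex)
  show "aff_dim (ball p r) \<noteq> 1"
    by (cases "r > 0") (simp_all add: aff_dim_open ball_empty)
qed simp

text \<open>
  \<open>A\<close> is the curve minus a short open arc around \<open>p\<close> inside the ball. It serves as a connected substitute
  for the part of the curve outside the ball, which may be disconnected.
\<close>

lemma simple_closed_curve_rest_closed:
  fixes C :: "real \<Rightarrow> complex"
  assumes C: "simple_path C" "pathfinish C = pathstart C" and p: "p \<in> path_image C" and r: "r > 0"
  obtains A where "closed A" "connected A" "p \<notin> A" "A \<subseteq> path_image C" "path_image C - ball p r \<subseteq> A"
proof -
  obtain a where a: "a \<in> {0..1}" "C a = p" using p by (auto simp: path_image_def)
  define h where "h = shiftpath a C"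
  have h: "simple_path h" "path_image h = path_image C" "h 0 = p" "h 1 = p"
    using simple_path_shiftpath[OF C] path_image_shiftpath[OF a(1) C(2)] endpoints_shiftpath[OF C(2) a(1)] a
    by (auto simp: h_def pathstart_def pathfinish_def)
  have cont: "continuous_on {0..1} h" using h(1) by (simp add: simple_path_def path_def)
  obtain d0 where d0: "d0 > 0" "\<And>t. t \<in> {0..1} \<Longrightarrow> dist t 0 < d0 \<Longrightarrow> dist (h t) (h 0) < r"
    using cont r unfolding continuous_on_iff by (metis atLeastAtMost_iff order_refl zero_le_one)
  obtain d1 where d1: "d1 > 0" "\<And>t. t \<in> {0..1} \<Longrightarrow> dist t 1 < d1 \<Longrightarrow> dist (h t) (h 1) < r"
    using cont r unfolding continuous_on_iff by (metis atLeastAtMost_iff order_refl zero_le_one)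
  define d where "d = min (min d0 d1) (1/2)"
  have d: "0 < d" "d \<le> d0" "d \<le> d1" "d \<le> 1/2" using d0 d1 by (auto simp: d_def)
  define A where "A = h ` {d..1-d}"
  have sub: "{d..1-d} \<subseteq> {0..1}" using d by auto
  have contA: "continuous_on {d..1-d} h" using cont sub continuous_on_subset by blast
  show thesis
  proof (rule that[of A])
    show "closed A" unfolding A_def by (intro compact_imp_closed compact_continuous_image contA) simp
    show "connected A" unfolding A_def by (intro connected_continuous_image contA) simp
    show "p \<notin> A"
    proof
      assume "p \<in> A"
      then obtain t where t: "t \<in> {d..1-d}" "h t = h 0" using h(3) by (auto simp: A_def)
      then have "t = 0 \<or> t = 1"
        using h(1) sub d unfolding simple_path_def loop_free_def
        by (metis atLeastAtMost_iff order_refl subsetD zero_le_one)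
      then show False using t d by auto
    qed
    show "A \<subseteq> path_image C" using sub h(2) by (auto simp: A_def path_image_def)
    show "path_image C - ball p r \<subseteq> A"
    proof
      fix x assume x: "x \<in> path_image C - ball p r"
      then have "x \<in> path_image h" using h(2) by simp
      then obtain t where t: "t \<in> {0..1}" "x = h t" by (auto simp: path_image_def)
      have far: "\<not> dist (h t) p < r" using x t by (auto simp: dist_commute)
      then have "\<not> t < d" using d0(2)[OF t(1)] h(3) t d by (auto simp: dist_real_def)
      moreover have "\<not> 1 - d < t" using d1(2)[OF t(1)] h(4) t d far by (auto simp: dist_real_def)
      ultimately show "x \<in> A" using t by (auto simp: A_def)
    qed
  qed
qed

text \<open>
  Points near \<open>p\<close> on the same side of the curve are not separated by the curve. They are not separated
  by the complement of the ball together with \<open>A\<close> either, since a smaller ball avoids both. These two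
  closed sets meet in the connected set \<open>A\<close>, so by Janiszewski's theorem their union, which contains
  \<open>G\<close>, does not separate the points.
\<close>

lemma closed_curve_two_sided:
  fixes C :: "real \<Rightarrow> complex"
  assumes C: "simple_path C" "pathfinish C = pathstart C" and p: "p \<in> path_image C" and r: "r > 0"
    and G: "ball p r \<inter> G \<subseteq> path_image C"
  shows "\<exists>s>0. s \<le> r \<and> (\<forall>S\<in>{inside (path_image C), outside (path_image C)}.
    \<forall>u\<in>ball p s \<inter> S. \<forall>v\<in>ball p s \<inter> S. connected_component (- G) u v)"
proof -
  obtain A where A: "closed A" "connected A" "p \<notin> A" "A \<subseteq> path_image C" "path_image C - ball p r \<subseteq> A"
    using simple_closed_curve_rest_closed[OF C p r] by blast
  obtain s0 where s0: "s0 > 0" "ball p s0 \<subseteq> - A"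
    using A(1,3) by (metis Compl_iff open_Compl open_contains_ball)
  define s where "s = min s0 r"
  have ball: "ball p s \<subseteq> - A" "ball p s \<subseteq> ball p r" using s0 by (auto simp: s_def)
  let ?T = "- ball p r \<union> A"
  have J: "connected (inside (path_image C))" "connected (outside (path_image C))"
      "inside (path_image C) \<union> outside (path_image C) = - path_image C"
    using Jordan_inside_outside[OF C] by auto
  show ?thesis
  proof (intro exI[of _ s] conjI ballI)
    show "s > 0" "s \<le> r" using s0 r by (auto simp: s_def)
    fix S u v assume S: "S \<in> {inside (path_image C), outside (path_image C)}"
      and u: "u \<in> ball p s \<inter> S" and v: "v \<in> ball p s \<inter> S"
    have "connected_component (- (path_image C \<union> ?T)) u v"
    proof (rule Janiszewski)
      show "compact (path_image C)" using C by (simp add: compact_simple_path_image)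
      show "closed ?T" using A(1) by (intro closed_Un) (auto simp: closed_Compl)
      have "path_image C \<inter> ?T = A" using A(4,5) by auto
      then show "connected (path_image C \<inter> ?T)" using A(2) by simp
      have "connected S" "S \<subseteq> - path_image C" using S J by blast+
      then show "connected_component (- path_image C) u v"
        using u v unfolding connected_component_def by blast
      show "connected_component (- ?T) u v"
        unfolding connected_component_def using u v ball by (intro exI[of _ "ball p s"]) auto
    qed
    moreover have "- (path_image C \<union> ?T) \<subseteq> - G" using G by auto
    ultimately show "connected_component (- G) u v"
      using connected_component_of_subset by blast
  qed
qed

section \<open>Edges and faces of a plane graph\<close>

lemma plane_graph_mono:
  assumes "plane_graph V E pos \<gamma>" "E' \<subseteq> E"
  shows "plane_graph V E' pos \<gamma>"
  using assms unfolding plane_graph_def simple_graph_def by (meson subsetD)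

locale plane =
  fixes V :: "'a set" and E :: "'a set set" and pos :: "'a \<Rightarrow> complex" and \<gamma> :: "'a set \<Rightarrow> real \<Rightarrow> complex"
  assumes plane: "plane_graph V E pos \<gamma>"
begin

abbreviation D :: "'a set set \<Rightarrow> complex set" where "D E' \<equiv> drawing V E' pos \<gamma>"

abbreviation curve :: "'a set \<Rightarrow> complex set" where "curve e \<equiv> path_image (\<gamma> e)"

abbreviation Faces :: "complex set set" where "Faces \<equiv> faces V E pos \<gamma>"

definition open_edge :: "'a set \<Rightarrow> complex set" where "open_edge e = curve e - pos ` e"

lemma graph: "finite V" "\<And>e. e \<in> E \<Longrightarrow> e \<subseteq> V" "\<And>e. e \<in> E \<Longrightarrow> card e = 2"
  using plane by (auto simp: plane_graph_def simple_graph_def)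

lemma finite_E: "finite E"
  by (rule finite_subset[of _ "Pow V"]) (use graph in auto)

lemma inj_pos: "inj_on pos V" using plane by (simp add: plane_graph_def)

lemma edge_arc: "e \<in> E \<Longrightarrow> arc (\<gamma> e)" and edge_ends: "e \<in> E \<Longrightarrow> {pathstart (\<gamma> e), pathfinish (\<gamma> e)} = pos ` e"
  and edge_vertices: "e \<in> E \<Longrightarrow> curve e \<inter> pos ` V = pos ` e"
  and edges_meet: "e \<in> E \<Longrightarrow> e' \<in> E \<Longrightarrow> e \<noteq> e' \<Longrightarrow> curve e \<inter> curve e' = pos ` (e \<inter> e')"
  using plane by (auto simp: plane_graph_def)

lemma edge_ends_subset: "e \<in> E \<Longrightarrow> pos ` e \<subseteq> curve e"
  using edge_vertices by blast

lemma vertex_on_edge: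
  assumes "e \<in> E" "v \<in> V" "pos v \<in> curve e"
  shows "v \<in> e"
proof -
  have "pos v \<in> pos ` e" using assms edge_vertices by blast
  then show ?thesis using assms inj_pos graph(2)[OF assms(1)] by (auto dest: inj_onD)
qed

lemma path_image_closed: "e \<in> E \<Longrightarrow> closed (curve e)"
  using edge_arc by (simp add: arc_imp_path closed_path_image)

lemma drawing_mono: "E1 \<subseteq> E2 \<Longrightarrow> D E1 \<subseteq> D E2" by (auto simp: drawing_def)

lemma compact_drawing:
  assumes "E' \<subseteq> E"
  shows "compact (D E')"
  unfolding drawing_def
proof (rule compact_Un)
  show "compact (pos ` V)" using graph(1) by (simp add: finite_imp_compact)
  show "compact (\<Union>e\<in>E'. curve e)"
  proof (rule compact_UN)
    show "finite E'" using assms finite_E finite_subset by blast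
    show "compact (curve e)" if "e \<in> E'" for e
      using that assms edge_arc by (blast intro: compact_path_image arc_imp_path)
  qed
qed

lemma closed_drawing: "E' \<subseteq> E \<Longrightarrow> closed (D E')"
  using compact_drawing compact_imp_closed by blast

lemma face_props:
  assumes "E' \<subseteq> E" "f \<in> faces V E' pos \<gamma>"
  shows "open f" "connected f" "f \<noteq> {}" "f \<inter> D E' = {}" "frontier f \<subseteq> D E'"
proof -
  have f: "f \<in> components (- D E')" using assms(2) by (simp add: faces_def)
  show "open f" using f closed_drawing[OF assms(1)] open_components by blast
  show "connected f" "f \<noteq> {}" "f \<inter> D E' = {}"
    using f in_components_connected in_components_nonempty in_components_subset by blast+
  show "frontier f \<subseteq> D E'" using frontier_of_components_closed_complement closed_drawing[OF assms(1)] f by blast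
qed

lemma face_of_point:
  assumes "x \<notin> D E'"
  obtains f where "f \<in> faces V E' pos \<gamma>" "x \<in> f"
  using assms that[of "connected_component_set (- D E') x"]
  by (auto simp: faces_def componentsI connected_component_refl)

lemma face_connected_component:
  assumes "f \<in> faces V E' pos \<gamma>" "x \<in> f" "connected_component (- D E') x y"
  shows "y \<in> f"
proof -
  obtain w where w: "f = connected_component_set (- D E') w"
    using assms(1) unfolding faces_def by (rule componentsE)
  then have "connected_component (- D E') w x" using assms(2) by simp
  then show ?thesis using connected_component_trans[OF _ assms(3)] w by simp
qed

lemma face_connected_subset:
  assumes "f \<in> faces V E' pos \<gamma>" "connected S" "S \<inter> D E' = {}" "S \<inter> f \<noteq> {}"
  shows "S \<subseteq> f"
proof
  fix y assume "y \<in> S"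
  moreover obtain x where "x \<in> S" "x \<in> f" using assms(4) by blast
  ultimately show "y \<in> f"
    using face_connected_component[OF assms(1), of x y] assms(2,3) unfolding connected_component_def by blast
qed

lemma faces_disjoint:
  assumes "f \<in> faces V E' pos \<gamma>" "g \<in> faces V E' pos \<gamma>" "f \<noteq> g"
  shows "f \<inter> g = {}"
  using assms unfolding faces_def by (metis components_nonoverlap)

lemma open_edge_not_in_rest:
  assumes e: "e \<in> E" and p: "p \<in> open_edge e"
  shows "p \<notin> D (E - {e})"
  using p edge_vertices[OF e] edges_meet[OF e] unfolding drawing_def open_edge_def by fastforce

lemma open_edge_away:
  assumes e: "e \<in> E" and p: "p \<in> open_edge e"
  obtains r where "r > 0" "ball p r \<inter> D E \<subseteq> curve e" "\<And>e'. e' \<in> E \<Longrightarrow> e' \<noteq> e \<Longrightarrow> ball p r \<inter> curve e' = {}"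
proof -
  let ?R = "D (E - {e})"
  have "p \<notin> ?R" by (rule open_edge_not_in_rest[OF e p])
  moreover have "closed ?R" using closed_drawing by auto
  ultimately obtain r where r: "r > 0" "ball p r \<subseteq> - ?R"
    by (metis Compl_iff open_Compl open_contains_ball)
  show thesis
    by (rule that[of r]) (use r in \<open>auto simp: drawing_def\<close>)
qed

lemma open_edge_subset_drawing: "e \<in> E' \<Longrightarrow> open_edge e \<subseteq> D E'"
  by (auto simp: open_edge_def drawing_def)

lemma connected_open_edge: "e \<in> E \<Longrightarrow> connected (open_edge e)"
  unfolding open_edge_def using edge_ends[of e] connected_simple_path_endless[of "\<gamma> e"] edge_arc[of e]
  by (simp add: arc_imp_simple_path)

lemma open_edge_image: "e \<in> E \<Longrightarrow> open_edge e = \<gamma> e ` {0<..<1}"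
proof -
  assume e: "e \<in> E"
  have inj: "inj_on (\<gamma> e) {0..1}" using edge_arc[OF e] by (simp add: arc_def)
  have ends: "pos ` e = {\<gamma> e 0, \<gamma> e 1}" using edge_ends[OF e] by (auto simp: pathstart_def pathfinish_def)
  have "{0..1} = insert 0 (insert 1 {0<..<1::real})" by auto
  then have "curve e = insert (\<gamma> e 0) (insert (\<gamma> e 1) (\<gamma> e ` {0<..<1}))"
    unfolding path_image_def by (metis image_insert)
  moreover have "\<gamma> e 0 \<notin> \<gamma> e ` {0<..<1}" "\<gamma> e 1 \<notin> \<gamma> e ` {0<..<1}"
    using inj by (fastforce dest: inj_onD)+
  ultimately show ?thesis unfolding open_edge_def ends by auto
qed

lemma open_edge_nonempty: "e \<in> E \<Longrightarrow> open_edge e \<noteq> {}"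
  by (simp add: open_edge_image)

lemma closed_contains_open_edge:
  assumes e: "e \<in> E" and T: "closed T" "open_edge e \<subseteq> T"
  shows "curve e \<subseteq> T"
proof -
  have "\<gamma> e ` closure {0<..<1} \<subseteq> T"
    by (rule image_closure_subset) (use edge_arc[OF e] T open_edge_image[OF e] in \<open>auto simp: arc_def path_def\<close>)
  then show ?thesis by (simp add: path_image_def)
qed

text \<open>
  The ends of \<open>e\<close> are joined in the drawing of the remaining graph. Since a path component contains an
  arc between any two of its points, \<open>e\<close> then lies on a simple closed curve.
\<close>

definition linked :: "'a set set \<Rightarrow> 'a set \<Rightarrow> bool" where
  "linked E' e \<longleftrightarrow> (\<forall>u\<in>e. \<forall>v\<in>e. path_component (D (E' - {e})) (pos u) (pos v))"

lemma edge_on_closed_curve: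
  assumes e: "e \<in> E" and linked: "linked E e"
  obtains C where "simple_path C" "pathfinish C = pathstart C" "curve e \<subseteq> path_image C" "path_image C \<subseteq> D E"
proof -
  let ?R = "D (E - {e})"
  obtain u v where uv: "u \<in> e" "v \<in> e" "pathstart (\<gamma> e) = pos u" "pathfinish (\<gamma> e) = pos v"
    using edge_ends[OF e] by (metis imageE insertI1 insert_commute)
  have ne: "pos v \<noteq> pos u" using uv edge_arc[OF e] by (metis arc_distinct_ends)
  have "path_component ?R (pos v) (pos u)" using linked uv by (simp add: linked_def)
  then have "pos v \<in> path_component_set ?R (pos v)" "pos u \<in> path_component_set ?R (pos v)"
    by (auto dest: path_component_mem intro: path_component_refl)
  then obtain g where g: "arc g" "path_image g \<subseteq> path_component_set ?R (pos v)" "pathstart g = pos v" "pathfinish g = pos u"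
    using path_connected_path_component[of ?R "pos v"] ne unfolding path_connected_arcwise by metis
  have gR: "path_image g \<subseteq> ?R" using g(2) path_component_subset by blast
  have "curve e \<inter> ?R \<subseteq> pos ` e"
    using edge_vertices[OF e] edges_meet[OF e] unfolding drawing_def by fastforce
  then have meet: "curve e \<inter> path_image g \<subseteq> {pathstart (\<gamma> e), pathstart g}"
    using gR edge_ends[OF e] uv g by auto
  show thesis
  proof (rule that[of "\<gamma> e +++ g"])
    show "simple_path (\<gamma> e +++ g)"
      by (rule simple_path_join_loop) (use edge_arc[OF e] g uv meet in auto)
    show "pathfinish (\<gamma> e +++ g) = pathstart (\<gamma> e +++ g)" using g uv by simp
    have "path_image (\<gamma> e +++ g) = curve e \<union> path_image g" by (rule path_image_join) (use g uv in simp)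
    then show "curve e \<subseteq> path_image (\<gamma> e +++ g)" "path_image (\<gamma> e +++ g) \<subseteq> D E"
      using gR e by (auto simp: drawing_def)
  qed
qed

text \<open>
  The drawing near \<open>p\<close> is contained in the edge, hence in \<open>C\<close>, so the two sides of \<open>C\<close> near \<open>p\<close> each belong
  to one face.
\<close>

lemma faces_near_edge_point:
  assumes e: "e \<in> E" and C: "simple_path C" "pathfinish C = pathstart C" "curve e \<subseteq> path_image C" "path_image C \<subseteq> D E"
    and p: "p \<in> open_edge e"
  shows "\<exists>s f g. s > 0 \<and> f \<in> Faces \<and> g \<in> Faces \<and>
    f \<subseteq> inside (path_image C) \<and> g \<subseteq> outside (path_image C) \<and>
    ball p s \<inter> inside (path_image C) \<subseteq> f \<and> ball p s \<inter> outside (path_image C) \<subseteq> g \<and> ball p s \<inter> D E \<subseteq> curve e"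
proof -
  obtain r where r: "r > 0" "ball p r \<inter> D E \<subseteq> curve e"
    using open_edge_away[OF e p] by metis
  let ?I = "inside (path_image C)" and ?O = "outside (path_image C)"
  have pC: "p \<in> path_image C" using p C(3) by (auto simp: open_edge_def)
  have J: "connected ?I" "connected ?O" "?I \<union> ?O = - path_image C" "?I \<inter> ?O = {}"
      "frontier ?I = path_image C" "frontier ?O = path_image C" "open ?I" "open ?O"
    using Jordan_inside_outside[OF C(1,2)] by auto
  obtain s where s: "s > 0" "s \<le> r"
    "\<forall>S\<in>{?I, ?O}. \<forall>u\<in>ball p s \<inter> S. \<forall>v\<in>ball p s \<inter> S. connected_component (- D E) u v"
    using closed_curve_two_sided[OF C(1,2) pC r(1) subset_trans[OF r(2) C(3)]] by (elim exE conjE) (rule that; assumption)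
  have side: "\<exists>f\<in>Faces. f \<subseteq> S \<and> ball p s \<inter> S \<subseteq> f" if S: "S = ?I \<or> S = ?O" for S
  proof -
    have "p \<in> closure S" using S J(5,6) pC by (metis DiffD1 frontier_def)
    then obtain u where u: "u \<in> S" "dist u p < s" using s(1) by (metis closure_approachable)
    then have u_ball: "u \<in> ball p s" by (simp add: dist_commute)
    have "u \<notin> path_image C" using u S J(3) by blast
    moreover have "u \<in> ball p r" using u_ball s(2) by auto
    ultimately have "u \<notin> D E" using r(2) C(3) by blast
    then obtain f where f: "f \<in> Faces" "u \<in> f" using face_of_point by blast
    have "f \<subseteq> S"
    proof (rule ccontr)
      assume "\<not> f \<subseteq> S"
      then have "f \<inter> frontier S \<noteq> {}"
        using connected_Int_frontier[of f S] face_props(2)[OF _ f(1)] f(2) u by auto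
      then show False using S J(5,6) C(4) face_props(4)[OF _ f(1)] by auto
    qed
    moreover have "ball p s \<inter> S \<subseteq> f"
      using face_connected_component[OF f] s(3) S u_ball u by blast
    ultimately show ?thesis using f(1) by blast
  qed
  obtain f g where "f \<in> Faces" "f \<subseteq> ?I" "ball p s \<inter> ?I \<subseteq> f"
    "g \<in> Faces" "g \<subseteq> ?O" "ball p s \<inter> ?O \<subseteq> g" using side by metis
  moreover have "ball p s \<inter> D E \<subseteq> curve e" using r(2) s(2) by auto
  ultimately show ?thesis using s(1) by blast
qed

text \<open>
  The two faces near a point of the open edge do not change along the edge, because they are locally
  constant and the open edge is connected. They differ since they lie on different sides of \<open>C\<close>.
\<close>

lemma edge_two_faces:
  assumes e: "e \<in> E" and linked: "linked E e"
  shows "\<exists>f g. f \<noteq> g \<and> f \<in> Faces \<and> g \<in> Faces \<and>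
    curve e \<subseteq> frontier f \<and> curve e \<subseteq> frontier g \<and>
    (\<forall>p\<in>open_edge e. \<exists>s>0. ball p s \<subseteq> f \<union> g \<union> curve e) \<and>
    (\<forall>h\<in>Faces. frontier h \<inter> open_edge e \<noteq> {} \<longrightarrow> h = f \<or> h = g)"
proof -
  obtain C where C: "simple_path C" "pathfinish C = pathstart C" "curve e \<subseteq> path_image C" "path_image C \<subseteq> D E"
    using edge_on_closed_curve[OF e linked] by blast
  let ?I = "inside (path_image C)" and ?O = "outside (path_image C)"
  have J: "?I \<union> ?O = - path_image C" "?I \<inter> ?O = {}" "frontier ?I = path_image C" "frontier ?O = path_image C"
    using Jordan_inside_outside[OF C(1,2)] by auto
  obtain s f g where near: "\<And>p. p \<in> open_edge e \<Longrightarrow> s p > 0 \<and> f p \<in> Faces \<and> g p \<in> Faces \<and> f p \<subseteq> ?I \<and> g p \<subseteq> ?O \<and>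
      ball p (s p) \<inter> ?I \<subseteq> f p \<and> ball p (s p) \<inter> ?O \<subseteq> g p \<and> ball p (s p) \<inter> D E \<subseteq> curve e"
    using faces_near_edge_point[OF e C] by metis
  have approach: "\<exists>u. u \<in> S \<and> dist u p < r" if p: "p \<in> open_edge e" and S: "S = ?I \<or> S = ?O" and r: "r > 0" for p S r
  proof -
    have "p \<in> path_image C" using p C(3) by (auto simp: open_edge_def)
    then have "p \<in> frontier S" using S J(3,4) by auto
    then have "p \<in> closure S" by (simp add: frontier_def)
    then show ?thesis using r closure_approachable by blast
  qed
  \<comment> \<open>Close to \<open>x\<close> there are points of either side of \<open>C\<close> that also lie in the ball around \<open>p\<close>.\<close>
  have local: "f x = f p \<and> g x = g p" if p: "p \<in> open_edge e" and x: "x \<in> open_edge e" "dist p x < s p" for p x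
  proof -
    let ?r = "min (s x) (s p - dist p x)"
    have r: "?r > 0" using near[OF x(1)] x(2) by auto
    obtain u where u: "u \<in> ?I" "dist u x < ?r" using approach[OF x(1) _ r] by blast
    have "dist p u < s p" using u(2) dist_triangle[of p u x] by (simp add: dist_commute)
    then have "u \<in> f p" using near[OF p] u(1) by auto
    moreover have "u \<in> f x" using near[OF x(1)] u by (auto simp: dist_commute)
    ultimately have f: "f x = f p" using faces_disjoint near p x(1) by blast
    obtain v where v: "v \<in> ?O" "dist v x < ?r" using approach[OF x(1) _ r] by blast
    have "dist p v < s p" using v(2) dist_triangle[of p v x] by (simp add: dist_commute)
    then have "v \<in> g p" using near[OF p] v(1) by auto
    moreover have "v \<in> g x" using near[OF x(1)] v by (auto simp: dist_commute)
    ultimately have "g x = g p" using faces_disjoint near p x(1) by blast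
    then show ?thesis using f by simp
  qed
  obtain p0 where p0: "p0 \<in> open_edge e" using open_edge_nonempty[OF e] by blast
  have const: "f p = f p0 \<and> g p = g p0" if p: "p \<in> open_edge e" for p
  proof (rule connected_equivalence_relation[where R = "\<lambda>x y. f x = f y \<and> g x = g y", OF connected_open_edge[OF e] p p0])
    fix a assume a: "a \<in> open_edge e"
    show "\<exists>T. openin (top_of_set (open_edge e)) T \<and> a \<in> T \<and> (\<forall>x\<in>T. f a = f x \<and> g a = g x)"
    proof (intro exI[of _ "open_edge e \<inter> ball a (s a)"] conjI ballI)
      show "openin (top_of_set (open_edge e)) (open_edge e \<inter> ball a (s a))"
        by (rule openin_open_Int) simp
      show "a \<in> open_edge e \<inter> ball a (s a)" using a near[OF a] by simp
      fix x assume "x \<in> open_edge e \<inter> ball a (s a)"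
      then show "f a = f x" "g a = g x" using local[OF a, of x] by auto
    qed
  qed auto
  have in_frontier: "curve e \<subseteq> frontier h"
    if h: "h \<in> Faces" and S: "S = ?I \<or> S = ?O" and hS: "\<And>p. p \<in> open_edge e \<Longrightarrow> ball p (s p) \<inter> S \<subseteq> h" for h S
  proof (rule closed_contains_open_edge[OF e])
    show "closed (frontier h)" by simp
    show "open_edge e \<subseteq> frontier h"
    proof
      fix p assume p: "p \<in> open_edge e"
      have "p \<in> closure h"
        unfolding closure_approachable
      proof (intro allI impI)
        fix \<epsilon> :: real assume "\<epsilon> > 0"
        then obtain u where "u \<in> S" "dist u p < min \<epsilon> (s p)"
          using approach[OF p S, of "min \<epsilon> (s p)"] near[OF p] by auto
        then show "\<exists>y\<in>h. dist y p < \<epsilon>" using hS[OF p] by (intro bexI[of _ u]) (auto simp: dist_commute)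
      qed
      moreover have "p \<notin> h" using p face_props(4)[OF order_refl h] open_edge_subset_drawing[OF e] by blast
      ultimately show "p \<in> frontier h" using face_props(1)[OF order_refl h] by (simp add: frontier_def interior_open)
    qed
  qed
  let ?f = "f p0" and ?g = "g p0"
  note n0 = near[OF p0]
  have "?f \<noteq> {}" using n0 face_props(3)[OF order_refl] by blast
  then have ne: "?f \<noteq> ?g" using n0 J(2) by blast
  have fr_f: "curve e \<subseteq> frontier ?f"
    using in_frontier[of ?f ?I] near const n0 by metis
  have fr_g: "curve e \<subseteq> frontier ?g"
    using in_frontier[of ?g ?O] near const n0 by metis
  have ball: "ball p (s p) \<subseteq> ?f \<union> ?g \<union> curve e" if p: "p \<in> open_edge e" for p
  proof
    fix x assume x: "x \<in> ball p (s p)"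
    have "x \<in> ?I \<or> x \<in> ?O \<or> x \<in> path_image C" using J(1) by blast
    then show "x \<in> ?f \<union> ?g \<union> curve e"
      using near[OF p] const[OF p] x C(4) by blast
  qed
  have only: "h = ?f \<or> h = ?g" if h: "h \<in> Faces" "frontier h \<inter> open_edge e \<noteq> {}" for h
  proof -
    obtain p where p: "p \<in> open_edge e" "p \<in> frontier h" using h(2) by blast
    then have "p \<in> closure h" by (simp add: frontier_def)
    moreover have "s p > 0" using near[OF p(1)] by simp
    ultimately obtain x where x: "x \<in> h" "dist x p < s p"
      using closure_approachable[of p h] by blast
    then have "x \<in> ?f \<union> ?g \<union> curve e" using ball[OF p(1)] by (auto simp: dist_commute)
    moreover have "x \<notin> curve e"
      using face_props(4)[OF order_refl h(1)] x(1) e by (auto simp: drawing_def)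
    ultimately show ?thesis using faces_disjoint h(1) n0 x(1) by blast
  qed
  show ?thesis
  proof (rule exI[of _ ?f], rule exI[of _ ?g], intro conjI ballI impI)
    show "\<exists>s>0. ball p s \<subseteq> ?f \<union> ?g \<union> curve e" if "p \<in> open_edge e" for p
      using near[OF that] ball[OF that] by (intro exI[of _ "s p"]) simp
  qed (use n0 ne fr_f fr_g only in simp_all)
qed

end

section \<open>Boundaries of faces of bridgeless plane graphs\<close>

locale bridgeless_plane = plane +
  assumes all_linked: "\<And>e. e \<in> E \<Longrightarrow> linked E e"
    and vertex_covered: "\<And>v. v \<in> V \<Longrightarrow> \<exists>e\<in>E. v \<in> e"
    and nonempty: "E \<noteq> {}"
begin

abbreviation "three_face \<equiv> k_face 3 V E pos \<gamma>"

definition boundary_edges :: "complex set \<Rightarrow> 'a set set" where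
  "boundary_edges f = {e \<in> E. curve e \<subseteq> frontier f}"

lemma edge_in_boundary:
  assumes "e \<in> E" "f \<in> Faces" "frontier f \<inter> open_edge e \<noteq> {}"
  shows "e \<in> boundary_edges f"
  using edge_two_faces[OF assms(1) all_linked[OF assms(1)]] assms unfolding boundary_edges_def by auto

lemma boundary_edge_open: "e \<in> boundary_edges f \<Longrightarrow> frontier f \<inter> open_edge e \<noteq> {}"
  using open_edge_nonempty[of e] by (auto simp: boundary_edges_def open_edge_def)

lemma two_faces_at_edge:
  assumes "e \<in> E"
  shows "\<exists>f g. f \<noteq> g \<and> {h \<in> Faces. e \<in> boundary_edges h} = {f, g} \<and>
    (\<forall>p\<in>open_edge e. \<exists>s>0. ball p s \<subseteq> f \<union> g \<union> curve e)"
proof -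
  obtain f g where fg: "f \<noteq> g" "f \<in> Faces" "g \<in> Faces" "curve e \<subseteq> frontier f" "curve e \<subseteq> frontier g"
    "\<forall>p\<in>open_edge e. \<exists>s>0. ball p s \<subseteq> f \<union> g \<union> curve e"
    "\<forall>h\<in>Faces. frontier h \<inter> open_edge e \<noteq> {} \<longrightarrow> h = f \<or> h = g"
    using edge_two_faces[OF assms all_linked[OF assms]] by (elim exE conjE) (rule that; assumption)
  have "{h \<in> Faces. e \<in> boundary_edges h} = {f, g}"
  proof (intro equalityI subsetI)
    fix h assume "h \<in> {h \<in> Faces. e \<in> boundary_edges h}"
    then show "h \<in> {f, g}" using fg(7) boundary_edge_open[of e h] by blast
  next
    fix h assume "h \<in> {f, g}"
    then show "h \<in> {h \<in> Faces. e \<in> boundary_edges h}" using fg(2-5) assms by (auto simp: boundary_edges_def)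
  qed
  then show ?thesis using fg(1,6) by (intro exI conjI)
qed

lemma vertex_neighbourhood:
  assumes v: "v \<in> V"
  obtains r where "r > 0" "\<And>w. w \<in> V \<Longrightarrow> w \<noteq> v \<Longrightarrow> pos w \<notin> ball (pos v) r"
    "\<And>e. e \<in> E \<Longrightarrow> v \<notin> e \<Longrightarrow> ball (pos v) r \<inter> curve e = {}"
proof -
  let ?R = "pos ` (V - {v}) \<union> (\<Union>e\<in>{e\<in>E. v \<notin> e}. curve e)"
  have R_open: "open (- ?R)"
  proof (intro open_Compl closed_Un)
    show "closed (pos ` (V - {v}))" using graph(1) by (simp add: finite_imp_closed)
    show "closed (\<Union>e\<in>{e\<in>E. v \<notin> e}. curve e)"
      by (rule closed_UN) (use finite_E path_image_closed in auto)
  qed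
  have "pos v \<notin> ?R"
  proof
    assume "pos v \<in> ?R"
    then consider w where "w \<in> V" "w \<noteq> v" "pos v = pos w" | e where "e \<in> E" "v \<notin> e" "pos v \<in> curve e" by auto
    then show False using inj_pos v vertex_on_edge by cases (auto dest: inj_onD)
  qed
  then have v_in: "pos v \<in> - ?R" by (simp only: Compl_iff not_False_eq_True)
  obtain r where r: "r > 0" "ball (pos v) r \<subseteq> - ?R"
    using openE[OF R_open v_in] by metis
  show thesis
  proof (rule that[OF r(1)])
    show "pos w \<notin> ball (pos v) r" if "w \<in> V" "w \<noteq> v" for w using that r(2) by blast
    show "ball (pos v) r \<inter> curve e = {}" if "e \<in> E" "v \<notin> e" for e using that r(2) by blast
  qed
qed

lemma drawing_cases:
  assumes "x \<in> D E"
  obtains w where "w \<in> V" "x = pos w" | e where "e \<in> E" "x \<in> open_edge e"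
proof (cases "x \<in> pos ` V")
  case True
  then show thesis using that(1) by blast
next
  case False
  then obtain e where e: "e \<in> E" "x \<in> curve e" using assms by (auto simp: drawing_def)
  then have "x \<in> open_edge e" using False graph(2)[OF e(1)] by (auto simp: open_edge_def)
  then show thesis using that(2) e(1) by blast
qed

text \<open>
  If no edge at \<open>v\<close> were on the boundary, a punctured ball around \<open>pos v\<close> would avoid the frontier of \<open>f\<close>
  and meet \<open>f\<close>, so it would be contained in \<open>f\<close>; but an edge at \<open>v\<close> runs through it.
\<close>

lemma boundary_edge_at_vertex:
  assumes f: "f \<in> Faces" and v: "v \<in> V" "pos v \<in> frontier f"
  shows "\<exists>e\<in>boundary_edges f. v \<in> e"
proof (rule ccontr)
  assume none: "\<not> (\<exists>e\<in>boundary_edges f. v \<in> e)"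
  note fp = face_props[OF order_refl f]
  obtain r where r: "r > 0" "\<And>w. w \<in> V \<Longrightarrow> w \<noteq> v \<Longrightarrow> pos w \<notin> ball (pos v) r"
    "\<And>e. e \<in> E \<Longrightarrow> v \<notin> e \<Longrightarrow> ball (pos v) r \<inter> curve e = {}"
    using vertex_neighbourhood[OF v(1)] by metis
  let ?B = "ball (pos v) r - {pos v}"
  have "?B \<inter> frontier f = {}"
  proof (rule ccontr)
    assume "?B \<inter> frontier f \<noteq> {}"
    then obtain x where x: "x \<in> ball (pos v) r" "x \<noteq> pos v" "x \<in> frontier f" by blast
    then have "x \<in> D E" using fp(5) by blast
    then show False
    proof (cases rule: drawing_cases)
      case (1 w)
      then show ?thesis using r(2)[of w] x by auto
    next
      case (2 e)
      then have "x \<in> ball (pos v) r \<inter> curve e" using x(1) by (simp add: open_edge_def)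
      then have "v \<in> e" using r(3)[OF 2(1)] by blast
      moreover have "e \<in> boundary_edges f" using edge_in_boundary[OF 2(1) f] 2(2) x(3) by blast
      ultimately show ?thesis using none by blast
    qed
  qed
  moreover have "?B \<inter> f \<noteq> {}"
  proof -
    have "pos v \<in> closure f" using v(2) by (simp add: frontier_def)
    then obtain x where "x \<in> f" "dist x (pos v) < r" using r(1) closure_approachable by blast
    moreover have "pos v \<notin> f" using fp(4) v(1) by (auto simp: drawing_def)
    ultimately show ?thesis by (auto simp: dist_commute)
  qed
  ultimately have B: "?B \<subseteq> f"
    using connected_Int_frontier[OF punctured_ball_connected, of "pos v" r f] by blast
  obtain e where e: "e \<in> E" "v \<in> e" using vertex_covered[OF v(1)] by blast
  have "pos v \<in> closure (open_edge e)"
    using closed_contains_open_edge[OF e(1) closed_closure closure_subset] edge_ends_subset[OF e(1)] e(2) by blast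
  then obtain x where x: "x \<in> open_edge e" "dist x (pos v) < r" using r(1) closure_approachable by blast
  then have "x \<noteq> pos v" using e(2) by (auto simp: open_edge_def)
  then have "x \<in> f" using B x(2) by (auto simp: dist_commute)
  then show False using fp(4) x(1) open_edge_subset_drawing[OF e(1)] by blast
qed

lemma frontier_eq_boundary_edges:
  assumes f: "f \<in> Faces"
  shows "frontier f = (\<Union>e\<in>boundary_edges f. curve e)"
proof (intro equalityI subsetI)
  fix x assume x: "x \<in> frontier f"
  then have "x \<in> D E" using face_props(5)[OF order_refl f] by blast
  then show "x \<in> (\<Union>e\<in>boundary_edges f. curve e)"
  proof (cases rule: drawing_cases)
    case (1 w)
    then obtain e where "e \<in> boundary_edges f" "w \<in> e" using boundary_edge_at_vertex[OF f] x by blast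
    then show ?thesis using edge_ends_subset[of e] 1 by (auto simp: boundary_edges_def)
  next
    case (2 e)
    then have "e \<in> boundary_edges f" using edge_in_boundary[OF 2(1) f] x by blast
    then show ?thesis using 2 by (auto simp: open_edge_def)
  qed
qed (auto simp: boundary_edges_def)

lemma boundary_edges_nonempty:
  assumes f: "f \<in> Faces"
  shows "boundary_edges f \<noteq> {}"
proof
  assume "boundary_edges f = {}"
  then have "frontier f = {}" using frontier_eq_boundary_edges[OF f] by simp
  then have "f = UNIV" using face_props(3)[OF order_refl f] frontier_eq_empty[of f] by blast
  then have "D E = {}" using face_props(4)[OF order_refl f] by blast
  moreover obtain e where "e \<in> E" using nonempty by blast
  ultimately show False using open_edge_nonempty open_edge_subset_drawing by blast
qed

text \<open>
  Otherwise \<open>e\<close> would meet the rest of the boundary of \<open>f\<close> in at most one point. By Janiszewski's theorem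
  the frontier of \<open>f\<close> would not separate two points on different sides of \<open>e\<close> and close to it, although
  one of them is in \<open>f\<close> and the other is not.
\<close>

lemma boundary_edge_continues:
  assumes f: "f \<in> Faces" and e: "e \<in> boundary_edges f" and w: "w \<in> e"
  shows "\<exists>e'\<in>boundary_edges f. e' \<noteq> e \<and> w \<in> e'"
proof (rule ccontr)
  assume "\<not> (\<exists>e'\<in>boundary_edges f. e' \<noteq> e \<and> w \<in> e')"
  then have none: "w \<notin> e'" if "e' \<in> boundary_edges f" "e' \<noteq> e" for e' using that by blast
  have eE: "e \<in> E" and bE: "boundary_edges f \<subseteq> E" using e by (auto simp: boundary_edges_def)
  let ?S = "curve e" and ?T = "\<Union>e'\<in>boundary_edges f - {e}. curve e'"
  have front: "frontier f = ?S \<union> ?T" using frontier_eq_boundary_edges[OF f] e by blast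
  obtain u where u: "e = {w, u}"
    using graph(3)[OF eE] w by (auto simp: card_2_iff insert_commute)
  have ST: "?S \<inter> ?T \<subseteq> {pos u}"
  proof
    fix x assume "x \<in> ?S \<inter> ?T"
    then obtain e' where e': "e' \<in> boundary_edges f" "e' \<noteq> e" "x \<in> ?S \<inter> curve e'" by blast
    then have "x \<in> pos ` (e \<inter> e')" using edges_meet[OF eE, of e'] bE by blast
    then show "x \<in> {pos u}" using none[OF e'(1,2)] u by auto
  qed
  obtain g where g: "g \<in> Faces" "g \<noteq> f" "e \<in> boundary_edges g"
  proof -
    obtain f1 f2 where f12: "f1 \<noteq> f2" "{h \<in> Faces. e \<in> boundary_edges h} = {f1, f2}"
      using two_faces_at_edge[OF eE] by metis
    have "f1 \<in> Faces" "f2 \<in> Faces" "e \<in> boundary_edges f1" "e \<in> boundary_edges f2" using f12(2) by blast+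
    then show thesis using that[of f1] that[of f2] f12(1) by metis
  qed
  obtain p where p: "p \<in> open_edge e" using open_edge_nonempty[OF eE] by blast
  obtain r where r: "r > 0" "\<And>e'. e' \<in> E \<Longrightarrow> e' \<noteq> e \<Longrightarrow> ball p r \<inter> curve e' = {}"
    using open_edge_away[OF eE p] by metis
  have near: "\<exists>x. x \<in> h \<and> x \<in> ball p r" if h: "e \<in> boundary_edges h" for h
  proof -
    have "p \<in> frontier h" using h p by (auto simp: boundary_edges_def open_edge_def)
    then have "p \<in> closure h" by (simp add: frontier_def)
    then show ?thesis using r(1) closure_approachable by (metis dist_commute mem_ball)
  qed
  obtain a where a: "a \<in> f" "a \<in> ball p r" using near[OF e] by blast
  obtain b where b: "b \<in> g" "b \<in> ball p r" using near[OF g(3)] by blast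
  have outside: "a \<notin> ?S" "b \<notin> ?S"
    using a(1) b(1) face_props(4)[OF order_refl f] face_props(4)[OF order_refl g(1)] eE by (auto simp: drawing_def)
  have "connected_component (- (?S \<union> ?T)) a b"
  proof (rule Janiszewski)
    show "compact ?S" using edge_arc[OF eE] by (simp add: arc_imp_path compact_path_image)
    have "finite (boundary_edges f - {e})" using bE finite_E finite_subset by blast
    then show "closed ?T" using bE path_image_closed by (intro closed_UN) auto
    have "?S \<inter> ?T = {} \<or> ?S \<inter> ?T = {pos u}" using ST by blast
    then show "connected (?S \<inter> ?T)" by auto
    have "connected (- ?S)" using connected_arc_complement[OF edge_arc[OF eE]] by simp
    then show "connected_component (- ?S) a b"
      unfolding connected_component_def using outside by blast
    have "ball p r \<subseteq> - ?T" using r(2) bE by blast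
    then show "connected_component (- ?T) a b"
      unfolding connected_component_def using a b connected_ball by blast
  qed
  then obtain W where W: "connected W" "W \<inter> frontier f = {}" "a \<in> W" "b \<in> W"
    unfolding connected_component_def front by blast
  have "b \<notin> f" using faces_disjoint[OF f g(1)] g(2) b(1) by blast
  then show False using connected_Int_frontier[OF W(1), of f] W a(1) by blast
qed

end

lemma small_closed_edge_set:
  assumes fin: "finite B" and ne: "B \<noteq> {}" and two: "\<And>e. e \<in> B \<Longrightarrow> card e = 2"
    and continues: "\<And>e w. e \<in> B \<Longrightarrow> w \<in> e \<Longrightarrow> \<exists>e'\<in>B. e' \<noteq> e \<and> w \<in> e'"
  shows "3 \<le> card B"
    and "card B \<le> 3 \<Longrightarrow> \<exists>a b c. a \<noteq> b \<and> b \<noteq> c \<and> a \<noteq> c \<and> B = {{a, b}, {b, c}, {a, c}}"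
proof -
  obtain e where e: "e \<in> B" using ne by blast
  then obtain a b where ab: "e = {a, b}" "a \<noteq> b" using two by (meson card_2_iff)
  obtain e' where e': "e' \<in> B" "e' \<noteq> e" "b \<in> e'" using continues[OF e, of b] ab by blast
  obtain c where c: "e' = {b, c}" "c \<noteq> b" using two[OF e'(1)] e'(3) by (auto simp: card_2_iff)
  have "c \<noteq> a" using c e'(2) ab by auto
  obtain e'' where e'': "e'' \<in> B" "e'' \<noteq> e'" "c \<in> e''" using continues[OF e'(1), of c] c by blast
  have "e'' \<noteq> e" using e''(3) ab c \<open>c \<noteq> a\<close> by auto
  then have three: "card {e, e', e''} = 3" using e'(2) e''(2) by auto
  have sub: "{e, e', e''} \<subseteq> B" using e e' e'' by blast
  show "3 \<le> card B" using card_mono[OF fin sub] three by simp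
  assume "card B \<le> 3"
  then have B: "B = {e, e', e''}" using card_subset_eq[OF fin sub] card_mono[OF fin sub] three by simp
  obtain d where d: "d \<in> B" "d \<noteq> e" "a \<in> d" using continues[OF e, of a] ab by blast
  have "a \<notin> e'" using ab c \<open>c \<noteq> a\<close> by auto
  then have "d = e''" using d B by blast
  then have "e'' = {a, c}" using d(3) e''(3) \<open>c \<noteq> a\<close> two[OF e''(1)] by (auto simp: card_2_iff)
  then show "\<exists>a b c. a \<noteq> b \<and> b \<noteq> c \<and> a \<noteq> c \<and> B = {{a, b}, {b, c}, {a, c}}"
    using B ab c \<open>c \<noteq> a\<close> by metis
qed

context bridgeless_plane
begin

lemma boundary_edges_closed:
  assumes f: "f \<in> Faces"
  shows "finite (boundary_edges f)" and "3 \<le> card (boundary_edges f)"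
    and "card (boundary_edges f) \<le> 3 \<Longrightarrow>
      \<exists>a b c. a \<noteq> b \<and> b \<noteq> c \<and> a \<noteq> c \<and> boundary_edges f = {{a, b}, {b, c}, {a, c}}"
proof -
  show fin: "finite (boundary_edges f)" using finite_E by (simp add: boundary_edges_def)
  have two: "card e = 2" if "e \<in> boundary_edges f" for e using that graph(3) by (simp add: boundary_edges_def)
  note s = small_closed_edge_set[OF fin boundary_edges_nonempty[OF f] two boundary_edge_continues[OF f]]
  show "3 \<le> card (boundary_edges f)"
    "card (boundary_edges f) \<le> 3 \<Longrightarrow>
      \<exists>a b c. a \<noteq> b \<and> b \<noteq> c \<and> a \<noteq> c \<and> boundary_edges f = {{a, b}, {b, c}, {a, c}}"
    using s by blast+
qed

lemma walk_edges_3: "walk_edges [a, b, c] = [{a, b}, {b, c}, {c, a}]"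
  by (simp add: walk_edges_def upt_rec)

text \<open>
  The boundary is a triangle by \<open>small_closed_edge_set\<close>. Each of its edges is also on the boundary of a
  second face, so a facial circuit uses it once.
\<close>

lemma three_face_if_short_boundary:
  assumes f: "f \<in> Faces" and short: "card (boundary_edges f) \<le> 3"
  shows "three_face f"
proof -
  obtain a b c where abc: "a \<noteq> b" "b \<noteq> c" "a \<noteq> c" "boundary_edges f = {{a, b}, {b, c}, {a, c}}"
    using boundary_edges_closed(3)[OF f short] by blast
  have set: "set (walk_edges [a, b, c]) = boundary_edges f"
    using abc by (auto simp: walk_edges_3 insert_commute)
  have other: "\<exists>g\<in>Faces. g \<noteq> f \<and> curve e \<subseteq> frontier g" if e: "e \<in> boundary_edges f" for e
  proof -
    have "e \<in> E" using e by (simp add: boundary_edges_def)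
    then obtain f1 f2 where "f1 \<noteq> f2" "{h \<in> Faces. e \<in> boundary_edges h} = {f1, f2}"
      using two_faces_at_edge by metis
    then obtain g where "g \<in> {h \<in> Faces. e \<in> boundary_edges h}" "g \<noteq> f" by blast
    then show ?thesis by (auto simp: boundary_edges_def)
  qed
  have "facial_circuit V E pos \<gamma> f [a, b, c]"
    unfolding facial_circuit_def
  proof (intro conjI ballI)
    show "set (walk_edges [a, b, c]) \<subseteq> E" unfolding set by (auto simp: boundary_edges_def)
    show "(\<Union>e\<in>set (walk_edges [a, b, c]). curve e) = frontier f"
      unfolding set using frontier_eq_boundary_edges[OF f] by simp
    fix e assume e: "e \<in> set (walk_edges [a, b, c])"
    have "count_list (walk_edges [a, b, c]) e = 1"
      using e abc by (auto simp: walk_edges_3 doubleton_eq_iff)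
    then show "count_list (walk_edges [a, b, c]) e =
        (if \<exists>g\<in>Faces. g \<noteq> f \<and> curve e \<subseteq> frontier g then 1 else 2)"
      using other e unfolding set by auto
  qed
  then show ?thesis using f unfolding k_face_def by fastforce
qed

lemma three_face_boundary:
  assumes "three_face f"
  shows "f \<in> Faces" and "\<exists>a b c. a \<noteq> b \<and> b \<noteq> c \<and> a \<noteq> c \<and> boundary_edges f = {{a, b}, {b, c}, {a, c}}"
proof -
  show f: "f \<in> Faces" using assms by (simp add: k_face_def)
  obtain w where w: "facial_circuit V E pos \<gamma> f w" "length w = 3" using assms by (auto simp: k_face_def)
  obtain a b c where abc: "w = [a, b, c]" using w(2) by (auto simp: numeral_3_eq_3 length_Suc_conv)
  have sub: "{{a, b}, {b, c}, {c, a}} \<subseteq> E" and front: "frontier f = (\<Union>e\<in>{{a, b}, {b, c}, {c, a}}. curve e)"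
    using w(1) unfolding abc facial_circuit_def walk_edges_3 by auto
  have "card {a, b} = 2" "card {b, c} = 2" "card {c, a} = 2" using sub graph(3) by auto
  then have ne: "a \<noteq> b" "b \<noteq> c" "a \<noteq> c" by auto
  have "boundary_edges f = {{a, b}, {b, c}, {c, a}}"
  proof (intro equalityI subsetI)
    fix e assume e: "e \<in> boundary_edges f"
    then have eE: "e \<in> E" by (simp add: boundary_edges_def)
    obtain p where p: "p \<in> frontier f" "p \<in> open_edge e" using boundary_edge_open[OF e] by blast
    then obtain e' where e': "e' \<in> {{a, b}, {b, c}, {c, a}}" "p \<in> curve e'" unfolding front by blast
    have "e' = e"
    proof (rule ccontr)
      assume "e' \<noteq> e"
      moreover have "e' \<in> E" using e'(1) sub by blast
      ultimately have "p \<in> pos ` (e \<inter> e')" using edges_meet[OF eE] p(2) e'(2) by (auto simp: open_edge_def)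
      then show False using p(2) by (auto simp: open_edge_def)
    qed
    then show "e \<in> {{a, b}, {b, c}, {c, a}}" using e' by simp
  next
    fix e assume "e \<in> {{a, b}, {b, c}, {c, a}}"
    then show "e \<in> boundary_edges f" using sub unfolding boundary_edges_def front by blast
  qed
  then have "a \<noteq> b \<and> b \<noteq> c \<and> a \<noteq> c \<and> boundary_edges f = {{a, b}, {b, c}, {a, c}}"
    using ne by (simp add: insert_commute)
  then show "\<exists>a b c. a \<noteq> b \<and> b \<noteq> c \<and> a \<noteq> c \<and> boundary_edges f = {{a, b}, {b, c}, {a, c}}" by blast
qed

definition corners :: "complex set \<Rightarrow> 'a set" where "corners f = \<Union> (boundary_edges f)"

lemma three_face_corners:
  assumes f: "three_face f"
  shows "\<exists>a b c. a \<noteq> b \<and> b \<noteq> c \<and> a \<noteq> c \<and> corners f = {a, b, c} \<and> boundary_edges f = {{a, b}, {b, c}, {a, c}} \<and>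
    {a, b} \<in> E \<and> {b, c} \<in> E \<and> {a, c} \<in> E"
proof -
  obtain a b c where abc: "a \<noteq> b" "b \<noteq> c" "a \<noteq> c" "boundary_edges f = {{a, b}, {b, c}, {a, c}}"
    using three_face_boundary(2)[OF f] by blast
  have "boundary_edges f \<subseteq> E" by (auto simp: boundary_edges_def)
  then have "{a, b} \<in> E" "{b, c} \<in> E" "{a, c} \<in> E" unfolding abc(4) by simp_all
  moreover have "corners f = {a, b, c}" unfolding corners_def abc(4) by auto
  ultimately show ?thesis using abc by blast
qed

lemma three_face_boundary_from_corners:
  assumes f: "three_face f"
  shows "boundary_edges f = {e. e \<subseteq> corners f \<and> card e = 2}"
proof -
  obtain a b c where "a \<noteq> b" "b \<noteq> c" "a \<noteq> c" "corners f = {a, b, c}" "boundary_edges f = {{a, b}, {b, c}, {a, c}}"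
    using three_face_corners[OF f] by metis
  then show ?thesis by (auto simp: card_2_iff)
qed

lemma incident_three_face:
  assumes f: "three_face f" and v: "v \<in> V"
  shows "incident pos v f \<longleftrightarrow> v \<in> corners f"
proof
  assume "incident pos v f"
  then have "pos v \<in> frontier f" by (simp add: incident_def)
  then show "v \<in> corners f"
    using boundary_edge_at_vertex[OF three_face_boundary(1)[OF f] v] by (auto simp: corners_def)
next
  assume "v \<in> corners f"
  then obtain e where "e \<in> boundary_edges f" "v \<in> e" by (auto simp: corners_def)
  then show "incident pos v f"
    using edge_ends_subset[of e] by (auto simp: boundary_edges_def incident_def)
qed

text \<open>
  Two triangular faces with the same corners fill, together with their common boundary, a closed set
  which contains a neighbourhood of each of its points, except possibly of the three corners. The plane
  without the corners is connected, so this set is the whole plane, and all vertices are corners.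
\<close>

lemma corners_inj:
  assumes V: "card V > 3"
  shows "inj_on corners {f. three_face f}"
proof (rule inj_onI, rule ccontr)
  fix f g assume fg: "f \<in> {f. three_face f}" "g \<in> {f. three_face f}" "corners f = corners g" "f \<noteq> g"
  then have f: "three_face f" and g: "three_face g" by auto
  note fF = three_face_boundary(1)[OF f] and gF = three_face_boundary(1)[OF g]
  have B: "boundary_edges g = boundary_edges f"
    using three_face_boundary_from_corners f g fg(3) by simp
  then have front: "frontier g = frontier f" using frontier_eq_boundary_edges fF gF by simp
  obtain a b c where abc: "corners f = {a, b, c}" using three_face_corners[OF f] by metis
  let ?W = "f \<union> g \<union> frontier f"
  have cl: "closure f \<union> closure g = ?W"
    using front closure_Un_frontier by (metis Un_assoc Un_commute Un_left_commute Un_absorb)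
  have pt: "\<exists>s>0. ball p s \<subseteq> ?W" if p: "p \<in> ?W" "p \<notin> pos ` corners f" for p
  proof -
    consider "p \<in> f" | "p \<in> g" | "p \<in> frontier f" using p(1) by blast
    then show ?thesis
    proof cases
      case 1
      then obtain s where "s > 0" "ball p s \<subseteq> f" using openE[OF face_props(1)[OF order_refl fF]] by metis
      then show ?thesis by blast
    next
      case 2
      then obtain s where "s > 0" "ball p s \<subseteq> g" using openE[OF face_props(1)[OF order_refl gF]] by metis
      then show ?thesis by blast
    next
      case 3
      then obtain e where e: "e \<in> boundary_edges f" "p \<in> curve e"
        using frontier_eq_boundary_edges[OF fF] by blast
      then have eE: "e \<in> E" "curve e \<subseteq> frontier f" by (auto simp: boundary_edges_def)
      have "e \<subseteq> corners f" using e(1) by (auto simp: corners_def)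
      then have po: "p \<in> open_edge e" using p(2) e(2) by (auto simp: open_edge_def)
      obtain f' g' where fg': "{h \<in> Faces. e \<in> boundary_edges h} = {f', g'}"
        "\<forall>p\<in>open_edge e. \<exists>s>0. ball p s \<subseteq> f' \<union> g' \<union> curve e"
        using two_faces_at_edge[OF eE(1)] by (elim exE conjE) (rule that; assumption)
      have "f \<in> {f', g'}" "g \<in> {f', g'}" using fg'(1) fF gF e(1) B by blast+
      then have "f' \<union> g' = f \<union> g" using fg(4) by blast
      moreover obtain s where "s > 0" "ball p s \<subseteq> f' \<union> g' \<union> curve e" using fg'(2) po by blast
      moreover have "f \<union> g \<union> curve e \<subseteq> ?W" using eE(2) by blast
      ultimately have "ball p s \<subseteq> ?W" by (metis subset_trans)
      then show ?thesis using \<open>s > 0\<close> by blast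
    qed
  qed
  let ?X = "- pos ` corners f"
  have "connected ?X"
    by (rule path_connected_imp_connected, rule path_connected_complement_countable)
      (simp_all add: abc)
  moreover have "?X \<inter> frontier ?W = {}"
  proof -
    have "p \<in> interior ?W" if "p \<in> ?W" "p \<in> ?X" for p
      using pt[OF that(1)] that(2) unfolding mem_interior by blast
    moreover have "closure ?W = ?W" using cl by (metis closed_Un closed_closure closure_closed)
    ultimately show ?thesis unfolding frontier_def by blast
  qed
  moreover have "?X \<inter> ?W \<noteq> {}"
  proof -
    obtain x where x: "x \<in> f" using face_props(3)[OF order_refl fF] by blast
    have "corners f \<subseteq> V" using graph(2) by (auto simp: corners_def boundary_edges_def)
    then have "x \<notin> pos ` corners f" using x face_props(4)[OF order_refl fF] by (auto simp: drawing_def)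
    then show ?thesis using x by blast
  qed
  ultimately have W: "?X \<subseteq> ?W" using connected_Int_frontier[of ?X ?W] by blast
  have "V \<subseteq> corners f"
  proof
    fix v assume v: "v \<in> V"
    show "v \<in> corners f"
    proof (rule ccontr)
      assume nv: "v \<notin> corners f"
      have "corners f \<subseteq> V" using graph(2) by (auto simp: corners_def boundary_edges_def)
      then have "pos v \<notin> pos ` corners f" using nv v inj_pos by (auto dest: inj_onD)
      then have "pos v \<in> ?W" using W by blast
      moreover have "pos v \<notin> f" "pos v \<notin> g"
        using v face_props(4)[OF order_refl fF] face_props(4)[OF order_refl gF] by (auto simp: drawing_def)
      ultimately have "incident pos v f" by (simp add: incident_def)
      then show False using incident_three_face[OF f v] nv by simp
    qed
  qed
  then have "card V \<le> card {a, b, c}" using abc by (metis card_mono finite.emptyI finite_insert)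
  also have "\<dots> \<le> 3" by (simp add: card_insert_if)
  finally show False using V by simp
qed

end

section \<open>A lower bound for the number of faces\<close>

definition adjacency :: "'a set set \<Rightarrow> ('a \<times> 'a) set" where
  "adjacency E = {(u, v). {u, v} \<in> E}"

definition component_count :: "'a set \<Rightarrow> 'a set set \<Rightarrow> nat" where
  "component_count V E = card ((\<lambda>v. (adjacency E)\<^sup>* `` {v}) ` V)"

lemma adjacency_rtrancl_sym: "(u, v) \<in> (adjacency E)\<^sup>* \<Longrightarrow> (v, u) \<in> (adjacency E)\<^sup>*"
proof -
  have "sym (adjacency E)" by (auto simp: sym_def adjacency_def insert_commute)
  then show "(u, v) \<in> (adjacency E)\<^sup>* \<Longrightarrow> (v, u) \<in> (adjacency E)\<^sup>*" using sym_rtrancl symD by metis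
qed

text \<open>
  \<open>h\<close> maps the old components onto the new ones and identifies those of \<open>u\<close> and \<open>v\<close>.
\<close>

lemma component_count_insert:
  assumes fin: "finite V" and uv: "u \<in> V" "v \<in> V" and sep: "(u, v) \<notin> (adjacency T)\<^sup>*"
  shows "component_count V (insert {u, v} T) + 1 \<le> component_count V T"
proof -
  let ?T = "insert {u, v} T"
  define cl where "cl x = (adjacency T)\<^sup>* `` {x}" for x
  define cl' where "cl' x = (adjacency ?T)\<^sup>* `` {x}" for x
  define h where "h X = (\<Union>x\<in>X. cl' x)" for X
  have mono: "(adjacency T)\<^sup>* \<subseteq> (adjacency ?T)\<^sup>*" by (rule rtrancl_mono) (auto simp: adjacency_def)
  have h: "h (cl x) = cl' x" for x
    unfolding h_def cl_def cl'_def using mono by (auto intro: rtrancl_trans)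
  have "(u, v) \<in> (adjacency ?T)\<^sup>*" by (auto simp: adjacency_def)
  then have "cl' u = cl' v"
    unfolding cl'_def using adjacency_rtrancl_sym[of u v ?T] by (auto intro: rtrancl_trans)
  then have same: "h (cl u) = h (cl v)" by (simp add: h)
  have "v \<in> cl v" "v \<notin> cl u" using sep by (auto simp: cl_def)
  then have ne: "cl u \<noteq> cl v" by blast
  have "cl' ` V = h ` (cl ` V)" using h by (auto simp: image_image)
  also have "\<dots> \<subseteq> h ` (cl ` V - {cl v})"
  proof
    fix Y assume "Y \<in> h ` (cl ` V)"
    then obtain x where x: "x \<in> V" "Y = h (cl x)" by blast
    show "Y \<in> h ` (cl ` V - {cl v})"
    proof (cases "cl x = cl v")
      case True
      then have "Y = h (cl u)" using x same by simp
      then show ?thesis using uv ne by blast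
    qed (use x in blast)
  qed
  finally have "card (cl' ` V) \<le> card (h ` (cl ` V - {cl v}))" using fin by (intro card_mono) auto
  also have "\<dots> \<le> card (cl ` V - {cl v})" using fin by (intro card_image_le) auto
  also have "\<dots> < card (cl ` V)" using fin uv by (intro card_Diff1_less) auto
  finally show ?thesis unfolding component_count_def cl_def cl'_def by simp
qed

text \<open>
  \<open>T\<close> is an edge set of maximal size subject to \<open>|T| + components \<le> |V|\<close>. If an edge outside \<open>T\<close> joined
  two components of \<open>T\<close>, it could be added.
\<close>

lemma spanning_forest:
  assumes fin: "finite V" "finite E" and V: "V \<noteq> {}" and E: "\<And>e. e \<in> E \<Longrightarrow> e \<subseteq> V \<and> card e = 2"
  obtains T where "T \<subseteq> E" "card T + 1 \<le> card V" "\<And>u v. {u, v} \<in> E - T \<Longrightarrow> (u, v) \<in> (adjacency T)\<^sup>*"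
proof -
  define S where "S = {T. T \<subseteq> E \<and> card T + component_count V T \<le> card V}"
  have finS: "finite S" unfolding S_def using fin(2) by simp
  have "component_count V {} \<le> card V" unfolding component_count_def using fin(1) by (rule card_image_le)
  then have "{} \<in> S" by (simp add: S_def)
  then have "Max (card ` S) \<in> card ` S" using finS by (intro Max_in) auto
  then obtain T where T: "T \<in> S" "card T = Max (card ` S)" by (metis imageE)
  have max: "card T' \<le> card T" if "T' \<in> S" for T' using that finS T(2) by simp
  have TE: "T \<subseteq> E" "card T + component_count V T \<le> card V" using T by (auto simp: S_def)
  have "component_count V T > 0"
    unfolding component_count_def using fin(1) V by (simp add: card_gt_0_iff)
  then have "card T + 1 \<le> card V" using TE(2) by linarith
  moreover have "(u, v) \<in> (adjacency T)\<^sup>*" if uv: "{u, v} \<in> E - T" for u v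
  proof (rule ccontr)
    assume "(u, v) \<notin> (adjacency T)\<^sup>*"
    moreover have "u \<in> V" "v \<in> V" using uv E by auto
    ultimately have "component_count V (insert {u, v} T) + 1 \<le> component_count V T"
      using component_count_insert[OF fin(1)] by metis
    moreover have "card (insert {u, v} T) = card T + 1"
      using uv TE fin(2) finite_subset by (metis DiffD2 card_insert_disjoint Suc_eq_plus1)
    ultimately have "insert {u, v} T \<in> S" using TE uv by (auto simp: S_def)
    then show False using max \<open>card (insert {u, v} T) = card T + 1\<close> by fastforce
  qed
  ultimately show thesis using that TE(1) by blast
qed

context plane
begin

lemma adjacency_path_component:
  assumes "(u, v) \<in> (adjacency E')\<^sup>*" "E' \<subseteq> E" "u \<in> V"
  shows "path_component (D E') (pos u) (pos v)"
  using assms(1)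
proof (induction rule: rtrancl_induct)
  case base
  show ?case using assms(3) by (auto simp: drawing_def intro: path_component_refl)
next
  case (step v w)
  then have e: "{v, w} \<in> E'" "{v, w} \<in> E" using assms(2) by (auto simp: adjacency_def)
  let ?P = "curve {v, w}"
  have "path_connected ?P" using edge_arc[OF e(2)] by (simp add: arc_imp_path path_connected_path_image)
  moreover have "pos v \<in> ?P" "pos w \<in> ?P" using edge_ends_subset[OF e(2)] by auto
  ultimately have "path_component ?P (pos v) (pos w)" by (simp add: path_connected_component)
  moreover have "?P \<subseteq> D E'" using e(1) by (auto simp: drawing_def)
  ultimately have "path_component (D E') (pos v) (pos w)" by (rule path_component_of_subset[rotated])
  with step.IH show ?case by (rule path_component_trans)
qed

text \<open>
  The open edge runs through a single face \<open>f0\<close> of the smaller graph. Other faces survive, while \<open>f0\<close>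
  contains the two different faces on the two sides of the edge.
\<close>

lemma linked_edge_splits_face:
  assumes e: "e \<in> E" and linked: "linked E e" and F: "F \<subseteq> faces V (E - {e}) pos \<gamma>" "finite F"
  shows "\<exists>F'. F' \<subseteq> Faces \<and> finite F' \<and> card F + 1 \<le> card F'"
proof -
  let ?E = "E - {e}"
  have DE: "D ?E \<subseteq> D E" by (rule drawing_mono) blast
  have DE': "D E = D ?E \<union> curve e" using e by (auto simp: drawing_def)
  obtain p where p: "p \<in> open_edge e" using open_edge_nonempty[OF e] by blast
  obtain f0 where f0: "f0 \<in> faces V ?E pos \<gamma>" "p \<in> f0" using face_of_point open_edge_not_in_rest[OF e p] by blast
  have edge_f0: "open_edge e \<subseteq> f0"
    by (rule face_connected_subset[OF f0(1) connected_open_edge[OF e]])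
      (use open_edge_not_in_rest[OF e] p f0(2) in blast)+
  obtain f g where fg: "f \<noteq> g" "f \<in> Faces" "g \<in> Faces"
      "curve e \<subseteq> frontier f" "curve e \<subseteq> frontier g"
    using edge_two_faces[OF e linked] by blast
  have below: "h \<subseteq> f0" if h: "h \<in> Faces" "curve e \<subseteq> frontier h" for h
  proof (rule face_connected_subset[OF f0(1)])
    show "connected h" "h \<inter> D ?E = {}" using face_props[OF order_refl h(1)] DE by auto
    have "p \<in> closure h" using h(2) p by (auto simp: open_edge_def frontier_def)
    moreover have "open f0" using face_props(1)[OF _ f0(1)] by blast
    ultimately show "h \<inter> f0 \<noteq> {}" using f0(2) open_Int_closure_eq_empty[of f0 h] by blast
  qed
  have survive: "h \<in> Faces \<and> h \<inter> f0 = {}" if h: "h \<in> F - {f0}" for h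
  proof -
    have hF: "h \<in> faces V ?E pos \<gamma>" using h F(1) by blast
    have disj: "h \<inter> f0 = {}" using faces_disjoint[OF hF f0(1)] h by blast
    have hp: "connected h" "h \<noteq> {}" "h \<inter> D ?E = {}" using face_props[OF _ hF] by auto
    have "curve e \<subseteq> open_edge e \<union> D ?E"
      using graph(2)[OF e] by (auto simp: open_edge_def drawing_def)
    then have hD: "h \<inter> D E = {}" using hp(3) disj edge_f0 unfolding DE' by blast
    obtain x where x: "x \<in> h" using hp(2) by blast
    then obtain h' where h': "h' \<in> Faces" "x \<in> h'" using hD face_of_point by blast
    have "h \<subseteq> h'" by (rule face_connected_subset[OF h'(1) hp(1) hD]) (use x h' in blast)
    moreover have "h' \<subseteq> h"
      by (rule face_connected_subset[OF hF]) (use face_props[OF order_refl h'(1)] DE x h'(2) in blast)+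
    ultimately have "h = h'" by (rule subset_antisym)
    then show ?thesis using h'(1) disj by simp
  qed
  let ?F' = "insert f (insert g (F - {f0}))"
  have "f \<noteq> {}" "g \<noteq> {}" using face_props(3)[OF order_refl] fg(2,3) by blast+
  then have "f \<notin> F - {f0}" "g \<notin> F - {f0}" using below[OF fg(2,4)] below[OF fg(3,5)] survive by blast+
  then have "card ?F' = card (F - {f0}) + 2" using fg(1) F(2) by simp
  moreover have "card F \<le> card (F - {f0}) + 1"
    using card_Suc_Diff1[OF F(2), of f0] by (cases "f0 \<in> F") auto
  ultimately have "card F + 1 \<le> card ?F'" by linarith
  moreover have "?F' \<subseteq> Faces" using fg(2,3) survive by blast
  ultimately show ?thesis using F(2) by (intro exI[of _ ?F']) simp
qed

end

text \<open>
  One half of Euler's formula. A spanning forest has at least one face and at most \<open>|V| - 1\<close> edges, and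
  each further edge increases the number of faces. The faces are collected in a finite set \<open>F\<close> because
  \<open>card\<close> is \<open>0\<close> on infinite sets.
\<close>

lemma euler_inequality:
  assumes plane: "plane_graph V E pos \<gamma>" and V: "V \<noteq> {}"
  obtains F where "F \<subseteq> faces V E pos \<gamma>" "finite F" "card E + 2 \<le> card F + card V"
proof -
  interpret plane V E pos \<gamma> by (unfold_locales) (rule plane)
  obtain T where T: "T \<subseteq> E" "card T + 1 \<le> card V" "\<And>u v. {u, v} \<in> E - T \<Longrightarrow> (u, v) \<in> (adjacency T)\<^sup>*"
    using spanning_forest[OF graph(1) finite_E V] graph(2,3) by metis
  have build: "\<exists>F. F \<subseteq> faces V (T \<union> X) pos \<gamma> \<and> finite F \<and> card X + 1 \<le> card F" if "finite X" "X \<subseteq> E - T" for X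
    using that
  proof (induction X rule: finite_induct)
    case empty
    have "D T \<noteq> UNIV" using compact_drawing[OF T(1)] compact_imp_bounded not_bounded_UNIV by metis
    then obtain x f where "f \<in> faces V T pos \<gamma>" "x \<in> f" using face_of_point[of _ T] by blast
    then show ?case by (intro exI[of _ "{f}"]) auto
  next
    case (insert e X)
    let ?E = "T \<union> insert e X"
    have sub: "?E \<subseteq> E" using insert.prems T(1) by auto
    interpret sub: plane V ?E pos \<gamma> by unfold_locales (rule plane_graph_mono[OF plane sub])
    have rest: "?E - {e} = T \<union> X" using insert.hyps insert.prems by auto
    have e: "e \<in> E - T" using insert.prems by auto
    have "sub.linked ?E e"
      unfolding sub.linked_def rest
    proof (intro ballI)
      fix u v assume uv: "u \<in> e" "v \<in> e"
      have "(u, v) \<in> (adjacency T)\<^sup>*"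
      proof (cases "u = v")
        case False
        then have "e = {u, v}" using uv graph(3)[of e] e by (auto simp: card_2_iff)
        then show ?thesis using T(3) e by blast
      qed simp
      then have "path_component (D T) (pos u) (pos v)"
        using adjacency_path_component[OF _ T(1)] uv graph(2)[of e] e by blast
      moreover have "D T \<subseteq> D (T \<union> X)" by (rule drawing_mono) blast
      ultimately show "path_component (D (T \<union> X)) (pos u) (pos v)" by (meson path_component_of_subset)
    qed
    moreover obtain F where F: "F \<subseteq> faces V (T \<union> X) pos \<gamma>" "finite F" "card X + 1 \<le> card F"
      using insert by auto
    ultimately obtain F' where "F' \<subseteq> faces V ?E pos \<gamma>" "finite F'" "card F + 1 \<le> card F'"
      using sub.linked_edge_splits_face[of e F] rest by auto
    then show ?case using F(3) insert.hyps by (intro exI[of _ F']) auto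
  qed
  have "T \<union> (E - T) = E" using T(1) by auto
  then obtain F where F: "F \<subseteq> faces V E pos \<gamma>" "finite F" "card (E - T) + 1 \<le> card F"
    using build[of "E - T"] finite_E by auto
  have "card (E - T) + card T = card E"
    using T(1) finite_E by (metis card_Diff_subset card_mono finite_subset le_add_diff_inverse2)
  then have "card E + 2 \<le> card F + card V" using F(3) T(2) by linarith
  then show thesis using that F by blast
qed

context bridgeless_plane
begin

text \<open>
  From here on a triangular face is represented by its set of corners, which determines it by
  \<open>corners_inj\<close>.
\<close>

definition triangles :: "'a set set" where "triangles = corners ` {f. three_face f}"

lemma finite_triangles: "finite triangles"
proof (rule finite_subset)
  show "triangles \<subseteq> Pow V" using graph(2) by (auto simp: triangles_def corners_def boundary_edges_def)
qed (simp add: graph(1))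

lemma triangles_complete:
  assumes "t \<in> triangles"
  shows "\<exists>a b c. t = {a, b, c} \<and> a \<noteq> b \<and> b \<noteq> c \<and> a \<noteq> c \<and> {a, b} \<in> E \<and> {b, c} \<in> E \<and> {a, c} \<in> E"
proof -
  obtain f where "three_face f" "t = corners f" using assms by (auto simp: triangles_def)
  then show ?thesis using three_face_corners[of f] by blast
qed

lemma triangles_at_vertex:
  assumes "v \<in> V" "finite {f. three_face f \<and> incident pos v f}"
    "card {f. three_face f \<and> incident pos v f} \<le> n"
  shows "card {t \<in> triangles. v \<in> t} \<le> n"
proof -
  have "{t \<in> triangles. v \<in> t} = corners ` {f. three_face f \<and> incident pos v f}"
    using incident_three_face assms(1) by (auto simp: triangles_def)
  then show ?thesis using card_image_le[OF assms(2), of corners] assms(3) by simp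
qed

lemma triangles_at_edge:
  assumes e: "e \<in> E"
  shows "card {t \<in> triangles. e \<subseteq> t} \<le> 2"
proof -
  obtain f g where fg: "{h \<in> Faces. e \<in> boundary_edges h} = {f, g}" using two_faces_at_edge[OF e] by metis
  have "{t \<in> triangles. e \<subseteq> t} \<subseteq> corners ` {f, g}"
  proof
    fix t assume "t \<in> {t \<in> triangles. e \<subseteq> t}"
    then obtain h where h: "three_face h" "t = corners h" "e \<subseteq> corners h" by (auto simp: triangles_def)
    then have "e \<in> boundary_edges h" using three_face_boundary_from_corners graph(3)[OF e] by blast
    then have "h \<in> {f, g}" using fg three_face_boundary(1)[OF h(1)] by blast
    then show "t \<in> corners ` {f, g}" using h(2) by blast
  qed
  then have "card {t \<in> triangles. e \<subseteq> t} \<le> card (corners ` {f, g})" by (intro card_mono) auto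
  also have "\<dots> \<le> card {f, g}" by (rule card_image_le) simp
  also have "\<dots> \<le> 2" by (simp add: card_insert_if)
  finally show ?thesis .
qed

text \<open>
  Count the pairs of a face and an edge on its boundary: there are at most two for each edge, at least
  three for each face, and at least four for each face that is not triangular.
\<close>

lemma many_triangles:
  assumes V: "card V > 3"
  shows "2 * card E + 8 \<le> 4 * card V + card triangles"
proof -
  have "V \<noteq> {}" using V by auto
  then obtain F where F: "F \<subseteq> Faces" "finite F" "card E + 2 \<le> card F + card V"
    using euler_inequality[OF plane] by blast
  let ?F3 = "{f \<in> F. three_face f}"
  have "(\<Sum>f\<in>F. card (boundary_edges f)) = (\<Sum>f\<in>F. \<Sum>e\<in>E. if e \<in> boundary_edges f then 1 else 0)"
  proof (rule sum.cong[OF refl])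
    fix f
    have filter: "{e \<in> E. e \<in> boundary_edges f} = boundary_edges f" by (auto simp: boundary_edges_def)
    have "card {e \<in> E. e \<in> boundary_edges f} = (\<Sum>e\<in>E. if e \<in> boundary_edges f then 1 else 0)"
      using finite_E by (simp add: sum.inter_filter[symmetric])
    then show "card (boundary_edges f) = (\<Sum>e\<in>E. if e \<in> boundary_edges f then 1 else 0)"
      unfolding filter .
  qed
  also have "\<dots> = (\<Sum>e\<in>E. \<Sum>f\<in>F. if e \<in> boundary_edges f then 1 else 0)" by (rule sum.swap)
  also have "\<dots> = (\<Sum>e\<in>E. card {f \<in> F. e \<in> boundary_edges f})"
    using F(2) by (simp add: sum.inter_filter[symmetric])
  also have "\<dots> \<le> (\<Sum>e\<in>E. 2)"
  proof (rule sum_mono)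
    fix e assume "e \<in> E"
    then obtain f g where fg: "{h \<in> Faces. e \<in> boundary_edges h} = {f, g}" using two_faces_at_edge by metis
    then have "card {f \<in> F. e \<in> boundary_edges f} \<le> card {f, g}"
      using F(1) by (intro card_mono) auto
    also have "\<dots> \<le> 2" by (simp add: card_insert_if)
    finally show "card {f \<in> F. e \<in> boundary_edges f} \<le> 2" .
  qed
  finally have upper: "(\<Sum>f\<in>F. card (boundary_edges f)) \<le> 2 * card E" by simp
  have "4 * card F = (\<Sum>f\<in>F. 4)" by simp
  also have "\<dots> \<le> (\<Sum>f\<in>F. card (boundary_edges f) + (if three_face f then 1 else 0))"
  proof (rule sum_mono)
    fix f assume "f \<in> F"
    then have f: "f \<in> Faces" using F(1) by blast
    then show "4 \<le> card (boundary_edges f) + (if three_face f then 1 else 0)"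
      using boundary_edges_closed(2)[OF f] three_face_if_short_boundary[OF f]
      by (cases "card (boundary_edges f) \<le> 3") simp_all
  qed
  also have "\<dots> = (\<Sum>f\<in>F. card (boundary_edges f)) + card ?F3"
    using F(2) by (simp add: sum.distrib sum.inter_filter[symmetric])
  finally have lower: "4 * card F \<le> (\<Sum>f\<in>F. card (boundary_edges f)) + card ?F3" .
  have "inj_on corners ?F3" using corners_inj[OF V] by (rule inj_on_subset) auto
  then have "card ?F3 = card (corners ` ?F3)" by (simp add: card_image)
  also have "\<dots> \<le> card triangles"
    by (rule card_mono[OF finite_triangles]) (auto simp: triangles_def)
  finally show ?thesis using upper lower F(3) by linarith
qed

end

section \<open>Discharging\<close>

lemma sum_two_level:
  fixes f :: "'b \<Rightarrow> nat"
  assumes "finite S" "card S \<le> n" "card {t \<in> S. P t} \<le> m" "card {t \<in> S. Q t} \<le> m'"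
    and "\<And>t. t \<in> S \<Longrightarrow> f t \<le> b + (if P t then c else 0) + (if Q t then c' else 0)"
  shows "sum f S \<le> n * b + m * c + m' * c'"
proof -
  have "sum f S \<le> (\<Sum>t\<in>S. b + (if P t then c else 0) + (if Q t then c' else 0))"
    by (rule sum_mono) (rule assms(5))
  also have "\<dots> = card S * b + card {t \<in> S. P t} * c + card {t \<in> S. Q t} * c'"
    using assms(1) by (simp add: sum.distrib sum.inter_filter[symmetric])
  also have "\<dots> \<le> n * b + m * c + m' * c'"
    using assms(2-4) by (intro add_mono mult_right_mono) auto
  finally show ?thesis .
qed

lemma handshake:
  assumes V: "finite V" and E: "finite E" "\<And>e. e \<in> E \<Longrightarrow> e \<subseteq> V \<and> card e = 2"
  shows "(\<Sum>v\<in>V. vertex_degree E v) = 2 * card E"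
proof -
  have "(\<Sum>v\<in>V. vertex_degree E v) = (\<Sum>v\<in>V. \<Sum>e\<in>E. if v \<in> e then 1 else 0)"
    using E(1) by (simp add: vertex_degree_def sum.inter_filter[symmetric])
  also have "\<dots> = (\<Sum>e\<in>E. \<Sum>v\<in>V. if v \<in> e then 1 else 0)" by (rule sum.swap)
  also have "\<dots> = (\<Sum>e\<in>E. 2)"
  proof (rule sum.cong[OF refl])
    fix e assume "e \<in> E"
    then have "{v \<in> V. v \<in> e} = e" "card e = 2" using E(2) by auto
    then show "(\<Sum>v\<in>V. if v \<in> e then 1 else 0) = (2::nat)"
      using V by (simp add: sum.inter_filter[symmetric])
  qed
  finally show ?thesis by simp
qed

text \<open>
  What a vertex of degree \<open>x\<close> gives to a triangle whose other corners have degrees \<open>y\<close> and \<open>z\<close>, in units of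
  1/24. A triangle needs 24. Where one corner has degree at most 4 and the others degree 6, the
  latter pay half each. A corner of degree 5 has only 24 units in all for up to three triangles, so it
  pays 6 as a rule and the corners of degree 6 cover the rest; the exceptions are the triangles
  without a corner of degree 6. If two corners have degree 4, the third one has degree 6 and pays all.
\<close>

definition share :: "nat \<Rightarrow> nat \<Rightarrow> nat \<Rightarrow> nat" where
  "share x y z =
    (if x \<le> 4 then 0
     else if x = 5 then (if {y, z} = {4, 5} then 12 else if {y, z} = {5} then 8 else 6)
     else if {y, z} = {4} then 24
     else if {y, z} = {3, 5} \<or> {y, z} = {4, 5} then 18
     else if {y, z} = {5, 6} \<or> {y, z} = {6} then 9
     else 12)"

lemma share_commute: "share x y z = share x z y"
  by (simp add: share_def insert_commute)

lemma shares_suffice: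
  assumes range: "x \<in> {2..6}" "y \<in> {2..6}" "z \<in> {2..6}"
    and sums: "8 \<le> x + y" "8 \<le> y + z" "8 \<le> x + z"
    and low: "x < 6 \<Longrightarrow> y < 6 \<Longrightarrow> z < 6 \<Longrightarrow> 9 \<le> x + y \<and> 9 \<le> y + z \<and> 9 \<le> x + z"
  shows "24 \<le> share x y z + share y x z + share z x y"
proof -
  have "x = 2 \<or> x = 3 \<or> x = 4 \<or> x = 5 \<or> x = 6" "y = 2 \<or> y = 3 \<or> y = 4 \<or> y = 5 \<or> y = 6"
    "z = 2 \<or> z = 3 \<or> z = 4 \<or> z = 5 \<or> z = 6" using range by auto
  then show ?thesis
    using sums low by (elim disjE) (simp_all add: share_def doubleton_eq_iff)
qed

text \<open>
  What a vertex of degree \<open>x\<close> gives to a neighbour of degree \<open>y\<close>. A vertex of degree 2 lacks 48 units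
  and has two neighbours of degree 6. One of degree 3 lacks 24 units; at most one of its neighbours
  has degree 5, and \<open>6 + 9 + 9 = 24\<close>.
\<close>

definition gift :: "nat \<Rightarrow> nat \<Rightarrow> nat" where
  "gift x y = (if y = 2 then 24 else if y = 3 then (if x = 6 then 9 else 6) else 0)"

locale triangle_system = edge_critical V E 6 for V :: "'a set" and E +
  fixes T :: "'a set set"
  assumes finite_T: "finite T"
    and triangle: "\<And>t. t \<in> T \<Longrightarrow> \<exists>a b c. t = {a, b, c} \<and> a \<noteq> b \<and> b \<noteq> c \<and> a \<noteq> c \<and> {a, b} \<in> E \<and> {b, c} \<in> E \<and> {a, c} \<in> E"
    and at_vertex: "\<And>v. v \<in> V \<Longrightarrow> card {t \<in> T. v \<in> t} \<le> 3"
    and at_edge: "\<And>e. e \<in> E \<Longrightarrow> card {t \<in> T. e \<subseteq> t} \<le> 2"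
    and vertex_covered: "\<And>v. v \<in> V \<Longrightarrow> \<exists>e\<in>E. v \<in> e"
begin

abbreviation "d \<equiv> vertex_degree E"
abbreviation "N \<equiv> neighbours E"

lemma N_iff: "u \<in> N v \<longleftrightarrow> {v, u} \<in> E" and N_neq: "u \<in> N v \<Longrightarrow> u \<noteq> v"
  using edge_ends_neq by (auto simp: neighbours_def)

lemma N_sym: "u \<in> N v \<longleftrightarrow> v \<in> N u" by (simp add: N_iff insert_commute)

lemma N_subset: "N v \<subseteq> V" and finite_V: "finite V"
  using simple by (auto simp: neighbours_def simple_graph_def)

lemma finite_N: "finite (N v)" using N_subset finite_V finite_subset by blast

lemma card_N: "card (N v) = d v" using vertex_degree_eq_card_neighbours two by metis

definition low :: "'a \<Rightarrow> 'a set" where "low v = {u \<in> N v. d u < 6}"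

lemma finite_low: "finite (low v)" using finite_N by (simp add: low_def)

text \<open>
  Vizing's adjacency lemma in the form used below: a neighbour of small degree leaves room for
  few further neighbours of degree less than 6.
\<close>

lemma low_bound:
  assumes "y \<in> N x" "d y < 6"
  shows "card (low x) + 7 \<le> d x + d y"
proof -
  have "{z \<in> N x - {y}. d z = 6} = N x - low x"
    using assms degree_le by (force simp: low_def le_less)
  then have "card {z \<in> N x - {y}. d z = 6} = card (N x - low x)" by simp
  moreover have "card (N x - low x) + card (low x) = d x"
    using finite_N card_N[of x] by (metis card_Diff_subset card_mono finite_low le_add_diff_inverse2 low_def mem_Collect_eq subsetI)
  moreover have "{x, y} \<in> E" using assms by (simp add: N_iff)
  ultimately show ?thesis using vizing_adjacency[of x y] by linarith
qed

lemma degree_sum: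
  assumes "y \<in> N x"
  shows "8 \<le> d x + d y"
proof (cases "d y < 6")
  case True
  then have "y \<in> low x" using assms by (simp add: low_def)
  then have "card (low x) > 0" using finite_low card_gt_0_iff by blast
  then show ?thesis using low_bound[OF assms True] by linarith
next
  case False
  then have y: "d y = 6" using degree_le[of y] by simp
  have "card {z \<in> N x - {y}. d z = 6} \<le> card (N x - {y})"
    using finite_N by (intro card_mono) auto
  moreover have "card (N x - {y}) = d x - 1" using assms card_N[of x] by simp
  moreover have "{x, y} \<in> E" using assms by (simp add: N_iff)
  ultimately show ?thesis using vizing_adjacency[of x y] y by linarith
qed

lemma degree_range:
  assumes "v \<in> V"
  shows "d v \<in> {2..6}"
proof -
  obtain e where e: "e \<in> E" "v \<in> e" using vertex_covered[OF assms] by blast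
  then obtain u where "e = {v, u}" using edges_at_vertex by metis
  then have "u \<in> N v" using e by (simp add: N_iff)
  then show ?thesis using degree_sum[of u v] degree_le[of u] degree_le[of v] by auto
qed

lemma low_card_ge:
  assumes "A \<subseteq> low v"
  shows "card A \<le> card (low v)"
  using card_mono[OF finite_low assms] .

lemma triangle_at:
  assumes "t \<in> T" "v \<in> t"
  obtains p q where "t = {v, p, q}" "p \<noteq> q" "p \<in> N v" "q \<in> N v" "q \<in> N p" "p \<noteq> v" "q \<noteq> v"
proof -
  obtain a b c where abc: "t = {a, b, c}" "a \<noteq> b" "b \<noteq> c" "a \<noteq> c" "{a, b} \<in> E" "{b, c} \<in> E" "{a, c} \<in> E"
    using triangle[OF assms(1)] by blast
  have sym: "{b, a} \<in> E" "{c, b} \<in> E" "{c, a} \<in> E" using abc by (simp_all add: insert_commute)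
  consider "v = a" | "v = b" | "v = c" using assms(2) abc(1) by blast
  then show thesis
  proof cases
    case 1
    then show thesis using that[of b c] abc sym by (auto simp: N_iff)
  next
    case 2
    then show thesis using that[of a c] abc sym by (auto simp: N_iff insert_commute)
  next
    case 3
    then show thesis using that[of a b] abc sym by (auto simp: N_iff insert_commute)
  qed
qed

text \<open>
  A vertex of degree 6 that supports a neighbour of degree 2 cannot pay the regular share to all its
  triangles.
\<close>

definition poor :: "'a \<Rightarrow> bool" where "poor v \<longleftrightarrow> (\<exists>x\<in>N v. d x = 2)"

lemma poor_neighbourhood:
  assumes "x \<in> N v" "d x = 2" "p \<in> N v" "q \<in> N p" "p \<noteq> x" "q \<noteq> x" "q \<noteq> v"
  shows "5 \<le> d q"
  using path_from_degree_two_vertex[of x v p q] assms by (auto simp: N_iff insert_commute)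

lemma degree_two_neighbours:
  assumes "d x = 2" "y \<in> N x"
  shows "d y = 6"
  using degree_sum[OF assms(2)] degree_le[of y] assms(1) by simp

text \<open>
  Adjacent poor vertices share their neighbour of degree 2, which has room for only two of them.
\<close>

lemma not_all_poor:
  assumes "v \<noteq> p" "p \<noteq> q" "v \<noteq> q" "p \<in> N v" "q \<in> N v"
  shows "\<not> (poor v \<and> poor p \<and> poor q)"
proof
  assume "poor v \<and> poor p \<and> poor q"
  then obtain x y z where x: "x \<in> N v" "d x = 2" and y: "y \<in> N p" "d y = 2" and z: "z \<in> N q" "d z = 2"
    by (auto simp: poor_def)
  have v6: "d v = 6" using degree_two_neighbours[OF x(2)] x(1) N_sym by blast
  have p6: "d p = 6" using degree_two_neighbours[OF y(2)] y(1) N_sym by blast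
  have q6: "d q = 6" using degree_two_neighbours[OF z(2)] z(1) N_sym by blast
  have "y = x"
  proof (rule ccontr)
    assume "y \<noteq> x"
    moreover have "p \<noteq> x" "y \<noteq> v" using p6 x(2) v6 y(2) by auto
    ultimately have "5 \<le> d y" using poor_neighbourhood[OF x assms(4) y(1)] by blast
    then show False using y(2) by simp
  qed
  moreover have "z = x"
  proof (rule ccontr)
    assume "z \<noteq> x"
    moreover have "q \<noteq> x" "z \<noteq> v" using q6 x(2) v6 z(2) by auto
    ultimately have "5 \<le> d z" using poor_neighbourhood[OF x assms(5) z(1)] by blast
    then show False using z(2) by simp
  qed
  ultimately have "{v, p, q} \<subseteq> N x" using x y z N_sym by blast
  then have "card {v, p, q} \<le> d x" using card_mono[OF finite_N] card_N[of x] by metis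
  then show False using x(2) assms(1-3) by simp
qed

text \<open>
  If all corners have degree 6 and some are poor, the poor ones pay only 6, and the others, of which
  there is at least one, pay 12. The latter can afford this because they have no neighbour of degree 3
  or 4, by \<open>poor_neighbourhood\<close>.
\<close>

definition corner_weight :: "'a \<Rightarrow> 'a \<Rightarrow> 'a \<Rightarrow> nat" where
  "corner_weight v p q = (if d v = 6 \<and> d p = 6 \<and> d q = 6 \<and> (poor v \<or> poor p \<or> poor q)
     then (if poor v then 6 else 12) else share (d v) (d p) (d q))"

text \<open>
  The minimum and the maximum of \<open>S\<close> are the degrees of the two elements of \<open>t - {v}\<close>; by
  \<open>share_commute\<close> it does not matter which is which.
\<close>

definition weight :: "'a \<Rightarrow> 'a set \<Rightarrow> nat" where
  "weight v t = (if d ` t = {6} \<and> (\<exists>u\<in>t. poor u) then (if poor v then 6 else 12)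
     else (let S = d ` (t - {v}) in share (d v) (Min S) (Max S)))"

lemma weight_eq:
  assumes "t = {v, p, q}" "p \<noteq> v" "q \<noteq> v"
  shows "weight v t = corner_weight v p q"
proof -
  have "t - {v} = {p, q}" using assms by auto
  then have "(let S = d ` (t - {v}) in share (d v) (Min S) (Max S)) = share (d v) (min (d p) (d q)) (max (d p) (d q))"
    by simp
  also have "\<dots> = share (d v) (d p) (d q)"
    using share_commute by (auto simp: min_def max_def)
  moreover have "d ` t = {6} \<longleftrightarrow> d v = 6 \<and> d p = 6 \<and> d q = 6" using assms(1) by auto
  ultimately show ?thesis using assms(1) by (auto simp: weight_def corner_weight_def)
qed

lemma triangle_receives:
  assumes "t \<in> T"
  shows "24 \<le> (\<Sum>v\<in>t. weight v t)"
proof -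
  obtain a b c where abc: "t = {a, b, c}" "a \<noteq> b" "b \<noteq> c" "a \<noteq> c" "{a, b} \<in> E" "{b, c} \<in> E" "{a, c} \<in> E"
    using triangle[OF assms] by blast
  then have N: "b \<in> N a" "c \<in> N b" "c \<in> N a" "a \<in> N b" "b \<in> N c" "a \<in> N c" by (auto simp: N_iff insert_commute)
  have inV: "a \<in> V" "b \<in> V" "c \<in> V" using N N_subset by blast+
  have sum: "(\<Sum>v\<in>t. weight v t) = weight a t + weight b t + weight c t" using abc by simp
  have "t = {b, a, c}" "t = {c, a, b}" using abc(1) by auto
  then have w: "weight a t = corner_weight a b c" "weight b t = corner_weight b a c" "weight c t = corner_weight c a b"
    using weight_eq[OF abc(1)] weight_eq[of t b a c] weight_eq[of t c a b] abc(2-4) by metis+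
  show ?thesis
  proof (cases "d a = 6 \<and> d b = 6 \<and> d c = 6 \<and> (poor a \<or> poor b \<or> poor c)")
    case True
    then show ?thesis using not_all_poor[of a b c] abc(2-4) N unfolding sum w corner_weight_def by auto
  next
    case False
    have "9 \<le> d x + d y" if "x \<in> N y" "y \<in> N x" "z \<in> N x" "z \<noteq> y" "d x < 6" "d y < 6" "d z < 6" for x y z
    proof -
      have "{y, z} \<subseteq> low x" using that by (simp add: low_def)
      then have "card {y, z} \<le> card (low x)" by (rule low_card_ge)
      then show ?thesis using low_bound[OF that(2,6)] that(4) by simp
    qed
    then have "24 \<le> share (d a) (d b) (d c) + share (d b) (d a) (d c) + share (d c) (d a) (d b)"
      using N abc(2-4) degree_range inV degree_sum[of b a] degree_sum[of c b] degree_sum[of c a]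
      by (intro shares_suffice) (metis add.commute)+
    then show ?thesis using False unfolding sum w corner_weight_def by auto
  qed
qed

end

lemma share_at_6: "share 6 y z \<le> 12 \<or> {y, z} = {4} \<or> {y, z} = {3, 5} \<or> {y, z} = {4, 5}"
  by (simp add: share_def)

context triangle_system
begin

abbreviation "Tri v \<equiv> {t \<in> T. v \<in> t}"

lemma finite_at: "finite (Tri v)" using finite_T by simp

lemma weight_at:
  assumes "t \<in> Tri v"
  shows "\<exists>p q. t = {v, p, q} \<and> p \<noteq> q \<and> p \<in> N v \<and> q \<in> N v \<and> q \<in> N p \<and> p \<noteq> v \<and> q \<noteq> v \<and>
    weight v t = corner_weight v p q"
proof -
  obtain p q where pq: "t = {v, p, q}" "p \<noteq> q" "p \<in> N v" "q \<in> N v" "q \<in> N p" "p \<noteq> v" "q \<noteq> v"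
    using triangle_at assms by blast
  show ?thesis by (rule exI[of _ p], rule exI[of _ q]) (use pq weight_eq[OF pq(1,6,7)] in simp)
qed

lemma degree_le_6: "d u \<le> 6" using degree_le[of u] .

lemma low_pair:
  assumes "card (low v) \<le> 2" "p \<in> low v" "q \<in> low v" "p \<noteq> q"
  shows "low v = {p, q}"
proof -
  have "{p, q} \<subseteq> low v" "card (low v) \<le> card {p, q}" using assms by auto
  then show ?thesis using card_seteq[OF finite_low] by metis
qed

lemma low_single:
  assumes "card (low v) \<le> 1" "p \<in> low v"
  shows "low v = {p}"
  using assms card_seteq[OF finite_low[of v], of "{p}"] by auto

lemma gifts_le:
  assumes "\<And>x. x \<in> N v - A \<Longrightarrow> 3 < d x" "finite A" "card A \<le> m" "\<And>x. x \<in> A \<Longrightarrow> gift (d v) (d x) \<le> g"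
  shows "(\<Sum>x\<in>N v. gift (d v) (d x)) \<le> m * g"
proof -
  have "(\<Sum>x\<in>N v. gift (d v) (d x)) \<le> card (N v) * 0 + m * g + 0 * 0"
  proof (rule sum_two_level[where P = "\<lambda>x. x \<in> A" and Q = "\<lambda>x. False"])
    have "card {x \<in> N v. x \<in> A} \<le> card A" by (rule card_mono[OF assms(2)]) auto
    then show "card {x \<in> N v. x \<in> A} \<le> m" using assms(3) by simp
    show "gift (d v) (d x) \<le> 0 + (if x \<in> A then g else 0) + (if False then 0 else 0)" if "x \<in> N v" for x
      using assms(1)[of x] assms(4)[of x] that by (cases "x \<in> A") (auto simp: gift_def)
  qed (use finite_N in auto)
  then show ?thesis by simp
qed

text \<open>
  The form in which the payments of a vertex are bounded in all cases: \<open>b\<close> for each of at most three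
  triangles, and surcharges for the few triangles with property \<open>P\<close> or \<open>Q\<close>.
\<close>

lemma weights_le:
  assumes v: "v \<in> V" and P: "card {t \<in> Tri v. P t} \<le> m" and Q: "card {t \<in> Tri v. Q t} \<le> m'"
    and w: "\<And>t. t \<in> Tri v \<Longrightarrow> weight v t \<le> b + (if P t then c else 0) + (if Q t then c' else 0)"
  shows "(\<Sum>t\<in>Tri v. weight v t) \<le> 3 * b + m * c + m' * c'"
  by (rule sum_two_level[OF finite_at at_vertex[OF v] P Q w])

lemma weights_le_uniform:
  assumes "v \<in> V" "\<And>t. t \<in> Tri v \<Longrightarrow> weight v t \<le> b"
  shows "(\<Sum>t\<in>Tri v. weight v t) \<le> 3 * b"
  using weights_le[OF assms(1), of "\<lambda>t. False" 0 "\<lambda>t. False" 0 b 0 0] assms(2) by simp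

lemma weights_le_surcharge:
  assumes "v \<in> V" "card {t \<in> Tri v. P t} \<le> m"
    and "\<And>t. t \<in> Tri v \<Longrightarrow> weight v t \<le> b + (if P t then c else 0)"
  shows "(\<Sum>t\<in>Tri v. weight v t) \<le> 3 * b + m * c"
  using weights_le[OF assms(1,2), of "\<lambda>t. False" 0 b c 0] assms(3) by simp

lemma card_at_unique: "card {t \<in> Tri v. t = s} \<le> 1"
proof -
  have "card {t \<in> Tri v. t = s} \<le> card {s}" by (rule card_mono) auto
  then show ?thesis by simp
qed

lemma no_gifts:
  assumes "\<And>x. x \<in> N v \<Longrightarrow> 3 < d x"
  shows "(\<Sum>x\<in>N v. gift (d v) (d x)) = 0"
  using gifts_le[of v "{}" 0 0] assms by simp

text \<open>
  The initial charge of \<open>v\<close> is \<open>24 * d v - 96\<close>. Since subtraction of natural numbers is truncated, \<open>96\<close>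
  is added on the other side.
\<close>

definition balanced :: "'a \<Rightarrow> bool" where
  "balanced v \<longleftrightarrow> (\<Sum>t\<in>Tri v. weight v t) + (\<Sum>x\<in>N v. gift (d v) (d x)) + 96 \<le>
     24 * d v + (\<Sum>u\<in>N v. gift (d u) (d v))"

lemma balanced_degree_at_most_4:
  assumes v: "v \<in> V" and dv: "d v \<le> 4"
  shows "balanced v"
proof -
  have "weight v t = 0" if "t \<in> Tri v" for t
    using weight_at[OF that] dv by (auto simp: corner_weight_def share_def)
  then have W: "(\<Sum>t\<in>Tri v. weight v t) = 0" by simp
  have nb: "4 \<le> d x" if "x \<in> N v" for x using degree_sum[OF that] dv by simp
  then have G: "(\<Sum>x\<in>N v. gift (d v) (d x)) = 0" by (intro no_gifts) force
  have "d v = 2 \<or> d v = 3 \<or> d v = 4" using degree_range[OF v] dv by auto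
  then have "96 \<le> 24 * d v + (\<Sum>u\<in>N v. gift (d u) (d v))"
  proof (elim disjE)
    assume "d v = 2"
    then show ?thesis using card_N[of v] by (simp add: gift_def)
  next
    assume dv3: "d v = 3"
    have "card (low v) \<le> 1"
    proof (cases "low v = {}")
      case False
      then obtain y where y: "y \<in> N v" "d y < 6" by (auto simp: low_def)
      then show ?thesis using low_bound[OF y] dv3 by simp
    qed simp
    moreover have "(\<Sum>u\<in>N v. 9) \<le> (\<Sum>u\<in>N v. gift (d u) (d v) + (if d u < 6 then 3 else 0))"
      using degree_le_6 dv3 by (intro sum_mono) (auto simp: gift_def le_less)
    then have "27 \<le> (\<Sum>u\<in>N v. gift (d u) (d v)) + 3 * card (low v)"
      using card_N[of v] dv3 finite_N by (simp add: sum.distrib sum.inter_filter[symmetric] low_def mult.commute)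
    ultimately show ?thesis using dv3 by linarith
  qed simp
  then show ?thesis using W G by (simp add: balanced_def)
qed

text \<open>
  The number of neighbours of degree less than 6 is at most 1, 2 or 3 if the smallest degree among the
  neighbours is 3, 4 or 5, respectively. In the second case a payment above 6 goes
  only to the triangle formed by \<open>v\<close> and both of these neighbours. In the third case no payment exceeds 8.
\<close>

lemma balanced_degree_5:
  assumes v: "v \<in> V" and dv: "d v = 5"
  shows "balanced v"
proof -
  have nb: "3 \<le> d x" if "x \<in> N v" for x using degree_sum[OF that] dv by simp
  have w: "\<exists>p q. t = {v, p, q} \<and> p \<noteq> q \<and> p \<in> N v \<and> q \<in> N v \<and> weight v t = share 5 (d p) (d q)" if "t \<in> Tri v" for t
    using weight_at[OF that] dv by (auto simp: corner_weight_def)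
  have "(\<Sum>t\<in>Tri v. weight v t) + (\<Sum>x\<in>N v. gift (d v) (d x)) \<le> 24"
  proof (cases "\<exists>x\<in>N v. d x = 3")
    case True
    then obtain x where x: "x \<in> N v" "d x = 3" by blast
    then have low: "low v = {x}" using low_bound[OF x(1)] dv by (intro low_single) (auto simp: low_def)
    have "weight v t \<le> 6" if t: "t \<in> Tri v" for t
    proof -
      obtain p q where pq: "p \<noteq> q" "p \<in> N v" "q \<in> N v" "weight v t = share 5 (d p) (d q)" using w[OF t] by blast
      have "\<not> (p \<in> low v \<and> q \<in> low v)" using low pq(1) by auto
      then have "d p = 6 \<or> d q = 6" using pq(2,3) degree_le_6[of p] degree_le_6[of q] by (auto simp: low_def le_less)
      then show ?thesis using pq(4) by (auto simp: share_def doubleton_eq_iff)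
    qed
    then have "(\<Sum>t\<in>Tri v. weight v t) \<le> 3 * 6" by (rule weights_le_uniform[OF v])
    moreover have "(\<Sum>x\<in>N v. gift (d v) (d x)) \<le> 1 * 6"
    proof (rule gifts_le[where A = "{x}"])
      show "3 < d y" if "y \<in> N v - {x}" for y using that low degree_le_6[of y] by (force simp: low_def)
    qed (use x dv in \<open>auto simp: gift_def\<close>)
    ultimately show ?thesis by linarith
  next
    case False
    then have nb4: "4 \<le> d x" if "x \<in> N v" for x using nb[OF that] that by (force simp: le_less)
    have gifts: "(\<Sum>x\<in>N v. gift (d v) (d x)) = 0" by (rule no_gifts) (use nb4 in force)
    have "(\<Sum>t\<in>Tri v. weight v t) \<le> 24"
    proof (cases "\<exists>x\<in>N v. d x = 4")
      case True
      then obtain x where x: "x \<in> N v" "d x = 4" by blast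
      then have card: "card (low v) \<le> 2" using low_bound[OF x(1)] dv by simp
      have xl: "x \<in> low v" using x by (simp add: low_def)
      have "(\<Sum>t\<in>Tri v. weight v t) \<le> 3 * 6 + 1 * 6"
      proof (rule weights_le_surcharge[OF v, where P = "\<lambda>t. t = insert v (low v)"])
        fix t assume t: "t \<in> Tri v"
        obtain p q where pq: "t = {v, p, q}" "p \<noteq> q" "p \<in> N v" "q \<in> N v" "weight v t = share 5 (d p) (d q)"
          using w[OF t] by blast
        show "weight v t \<le> 6 + (if t = insert v (low v) then 6 else 0)"
        proof (cases "d p < 6 \<and> d q < 6")
          case True
          then have "low v = {p, q}" using low_pair[OF card _ _ pq(2)] pq(3,4) by (simp add: low_def)
          then show ?thesis using pq(1,5) by (auto simp: share_def)
        next
          case False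
          then have "d p = 6 \<or> d q = 6" using degree_le_6[of p] degree_le_6[of q] by auto
          then show ?thesis using pq(5) by (auto simp: share_def doubleton_eq_iff)
        qed
      qed (use card_at_unique in simp_all)
      then show ?thesis by simp
    next
      case False
      then have nb5: "5 \<le> d x" if "x \<in> N v" for x using nb4[OF that] that by (force simp: le_less)
      have "(\<Sum>t\<in>Tri v. weight v t) \<le> 3 * 8"
      proof (rule weights_le_uniform[OF v])
        fix t assume t: "t \<in> Tri v"
        obtain p q where pq: "p \<in> N v" "q \<in> N v" "weight v t = share 5 (d p) (d q)" using w[OF t] by blast
        then show "weight v t \<le> 8"
          using nb5[OF pq(1)] nb5[OF pq(2)] by (auto simp: share_def doubleton_eq_iff)
      qed
      then show ?thesis by simp
    qed
    then show ?thesis using gifts by simp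
  qed
  then show ?thesis using dv by (simp add: balanced_def)
qed

lemma no_three_three_triangle:
  assumes "d v = 6" "y \<in> N v" "z \<in> N v" "y \<noteq> z" "d y = 3" "d z = 3" "b \<in> N v" "b \<in> N z"
  shows False
proof -
  have "b \<noteq> y" using degree_sum[OF assms(8)] assms(5,6) by auto
  then show False
    using no_triangle_at_second_degree_three_neighbour[of v y z b] assms by (simp add: N_iff)
qed

text \<open>
  All neighbours except \<open>x\<close> have degree 6, and at most one triangle contains \<open>x\<close>, because \<open>x\<close> together with
  its neighbours is its set of corners. The payments are at most \<open>24 + 12 + 6 + 6 = 48\<close>.
\<close>

lemma balanced_degree_6_two:
  assumes v: "v \<in> V" and dv: "d v = 6" and x: "x \<in> N v" "d x = 2"
  shows "balanced v"
proof -
  have low: "low v = {x}" using low_bound[OF x(1)] dv x by (intro low_single) (auto simp: low_def)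
  have six: "d y = 6" if "y \<in> N v" "y \<noteq> x" for y using that low degree_le_6[of y] by (force simp: low_def)
  have poor: "poor v" using x by (auto simp: poor_def)
  have "(\<Sum>t\<in>Tri v. weight v t) \<le> 3 * 6 + 1 * 6"
  proof (rule weights_le_surcharge[OF v, where P = "\<lambda>t. x \<in> t"])
    have "{t \<in> Tri v. x \<in> t} \<subseteq> {insert x (N x)}"
    proof
      fix t assume t: "t \<in> {t \<in> Tri v. x \<in> t}"
      then have tT: "t \<in> T" "x \<in> t" by auto
      obtain p q where pq: "t = {x, p, q}" "p \<noteq> q" "p \<in> N x" "q \<in> N x" "q \<in> N p" "p \<noteq> x" "q \<noteq> x"
        by (rule triangle_at[OF tT])
      have "{p, q} = N x"
        using card_seteq[OF finite_N[of x], of "{p, q}"] card_N[of x] x(2) pq(2-4) by auto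
      then show "t \<in> {insert x (N x)}" using pq(1) by auto
    qed
    then have "card {t \<in> Tri v. x \<in> t} \<le> card {insert x (N x)}" by (intro card_mono) auto
    then show "card {t \<in> Tri v. x \<in> t} \<le> 1" by simp
    fix t assume t: "t \<in> Tri v"
    obtain p q where pq: "t = {v, p, q}" "p \<noteq> q" "p \<in> N v" "q \<in> N v"
      "weight v t = corner_weight v p q" using weight_at[OF t] by blast
    show "weight v t \<le> 6 + (if x \<in> t then 6 else 0)"
    proof (cases "p = x \<or> q = x")
      case True
      then have "d p = 2 \<and> d q = 6 \<or> d p = 6 \<and> d q = 2" using six[OF pq(3)] six[OF pq(4)] pq(2) x(2) by auto
      then have "weight v t = 12" unfolding pq(5) corner_weight_def dv by (elim disjE) (simp_all add: share_def doubleton_eq_iff)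
      moreover have "x \<in> t" using True pq(1) by auto
      ultimately show ?thesis by simp
    next
      case False
      then show ?thesis using six[OF pq(3)] six[OF pq(4)] pq(5) dv poor by (simp add: corner_weight_def)
    qed
  qed
  moreover have "(\<Sum>x\<in>N v. gift (d v) (d x)) \<le> 1 * 24"
    by (rule gifts_le[where A = "{x}"]) (use six x in \<open>auto simp: gift_def\<close>)
  ultimately show ?thesis using dv by (simp add: balanced_def)
qed

text \<open>
  At most one other neighbour has degree less than 6. If it has degree 3 too, no triangle at \<open>v\<close>
  contains either of them, and \<open>9 + 9 + 3 * 9 < 48\<close>. If it has degree 4, no triangle receives more
  than 12, and \<open>9 + 3 * 12 < 48\<close>. If it has degree 5, the worst case is one triangle with
  \<open>x\<close> and this neighbour, one more with \<open>x\<close>, and a third one: \<open>9 + 18 + 12 + 9 = 48\<close>.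
\<close>

lemma balanced_degree_6_three:
  assumes v: "v \<in> V" and dv: "d v = 6" and x: "x \<in> N v" "d x = 3" and no2: "\<And>y. y \<in> N v \<Longrightarrow> d y \<noteq> 2"
  shows "balanced v"
proof -
  have nb: "3 \<le> d y" if "y \<in> N v" for y using degree_sum[OF that] no2[OF that] dv by simp
  have card: "card (low v) \<le> 2" using low_bound[OF x(1)] x dv by simp
  have xl: "x \<in> low v" using x by (simp add: low_def)
  have not_poor: "\<not> poor u" if u: "u \<in> N v" "d u = 6" for u
  proof
    assume "poor u"
    then obtain x' where x': "x' \<in> N u" "d x' = 2" by (auto simp: poor_def)
    have "v \<in> N u" using u N_sym by blast
    then have "5 \<le> d x"
      using poor_neighbourhood[OF x' _ x(1)] x x'(2) dv u(2) by fastforce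
    then show False using x by simp
  qed
  have "\<not> poor v" using no2 by (auto simp: poor_def)
  then have w: "\<exists>p q. t = {v, p, q} \<and> p \<noteq> q \<and> p \<in> N v \<and> q \<in> N v \<and> q \<in> N p \<and> p \<in> N q \<and> weight v t = share 6 (d p) (d q)"
    if "t \<in> Tri v" for t
    using weight_at[OF that, unfolded corner_weight_def] dv not_poor N_sym by metis
  have "(\<Sum>t\<in>Tri v. weight v t) + (\<Sum>x\<in>N v. gift (d v) (d x)) \<le> 48"
  proof (cases "\<exists>z\<in>N v. z \<noteq> x \<and> d z = 3")
    case True
    then obtain z where z: "z \<in> N v" "z \<noteq> x" "d z = 3" by blast
    then have low: "low v = {x, z}" using low_pair[OF card xl] by (auto simp: low_def)
    have not_xz: "p \<noteq> x \<and> p \<noteq> z" if p: "p \<in> N v" "q \<in> N v" "q \<in> N p" for p q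
      using no_three_three_triangle[OF dv x(1) z(1) _ x(2) z(3) p(2)]
        no_three_three_triangle[OF dv z(1) x(1) z(2) z(3) x(2) p(2)] p z(2) by metis
    have "(\<Sum>t\<in>Tri v. weight v t) \<le> 3 * 9"
    proof (rule weights_le_uniform[OF v])
      fix t assume t: "t \<in> Tri v"
      obtain p q where pq: "p \<in> N v" "q \<in> N v" "q \<in> N p" "p \<in> N q" "weight v t = share 6 (d p) (d q)"
        using w[OF t] by blast
      have "p \<notin> low v" "q \<notin> low v" using not_xz[OF pq(1-3)] not_xz[OF pq(2,1,4)] low by auto
      then have "d p = 6" "d q = 6" using pq(1,2) degree_le_6[of p] degree_le_6[of q] by (auto simp: low_def)
      then show "weight v t \<le> 9"
        using pq(5) by (simp add: share_def)
    qed
    moreover have "(\<Sum>x\<in>N v. gift (d v) (d x)) \<le> 2 * 9"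
    proof (rule gifts_le[where A = "{x, z}"])
      show "3 < d y" if "y \<in> N v - {x, z}" for y using that low degree_le_6[of y] by (force simp: low_def)
    qed (use x z dv in \<open>auto simp: gift_def\<close>)
    ultimately show ?thesis by linarith
  next
    case False
    then have only: "y = x" if "y \<in> N v" "d y = 3" for y using that by blast
    have nb4: "4 \<le> d y" if "y \<in> N v" "y \<noteq> x" for y using nb[OF that(1)] only[OF that(1)] that(2) by (force simp: le_less)
    have gifts: "(\<Sum>x\<in>N v. gift (d v) (d x)) \<le> 1 * 9"
    proof (rule gifts_le[where A = "{x}"])
      show "3 < d y" if "y \<in> N v - {x}" for y using nb4[of y] that by simp
    qed (use x dv in \<open>auto simp: gift_def\<close>)
    have both_low: "low v = {p, q} \<and> (p = x \<or> q = x)" if "p \<in> N v" "q \<in> N v" "p \<noteq> q" "d p < 6" "d q < 6" for p q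
      using low_pair[OF card _ _ that(3)] xl that by (auto simp: low_def)
    have "(\<Sum>t\<in>Tri v. weight v t) \<le> 39"
    proof (cases "\<exists>z\<in>N v. d z = 4")
      case True
      then obtain z where z: "z \<in> N v" "d z = 4" by blast
      have "z \<noteq> x" using z(2) x(2) by auto
      then have low: "low v = {x, z}" using both_low[OF x(1) z(1)] x(2) z(2) by auto
      have "(\<Sum>t\<in>Tri v. weight v t) \<le> 3 * 12"
      proof (rule weights_le_uniform[OF v])
        fix t assume t: "t \<in> Tri v"
        obtain p q where pq: "p \<noteq> q" "p \<in> N v" "q \<in> N v" "q \<in> N p" "weight v t = share 6 (d p) (d q)"
          using w[OF t] by blast
        have "\<not> (d p < 6 \<and> d q < 6)"
        proof
          assume "d p < 6 \<and> d q < 6"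
          then have "{p, q} = {x, z}" using low both_low[OF pq(2,3,1)] by simp
          then have "d p + d q = 7" using x(2) z(2) pq(1) by (auto simp: doubleton_eq_iff)
          then show False using degree_sum[OF pq(4)] by simp
        qed
        then have "d p = 6 \<or> d q = 6" using degree_le_6[of p] degree_le_6[of q] by auto
        then show "weight v t \<le> 12"
          using pq(5) share_at_6[of "d p" "d q"] by (auto simp: doubleton_eq_iff)
      qed
      then show ?thesis by simp
    next
      case False
      then have nb5: "5 \<le> d y" if "y \<in> N v" "y \<noteq> x" for y using nb4[OF that] that by (force simp: le_less)
      have "(\<Sum>t\<in>Tri v. weight v t) \<le> 3 * 9 + 2 * 3 + 1 * 6"
      proof (rule weights_le[OF v, where P = "\<lambda>t. x \<in> t" and Q = "\<lambda>t. t = insert v (low v)"])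
        have "{t \<in> Tri v. x \<in> t} = {t \<in> T. {v, x} \<subseteq> t}" by auto
        then show "card {t \<in> Tri v. x \<in> t} \<le> 2" using at_edge[of "{v, x}"] x(1) by (simp add: N_iff)
        fix t assume t: "t \<in> Tri v"
        obtain p q where pq: "t = {v, p, q}" "p \<noteq> q" "p \<in> N v" "q \<in> N v" "q \<in> N p" "weight v t = share 6 (d p) (d q)"
          using w[OF t] by blast
        have dp: "p \<noteq> x \<Longrightarrow> d p = 5 \<or> d p = 6" and dq: "q \<noteq> x \<Longrightarrow> d q = 5 \<or> d q = 6"
          using nb5[OF pq(3)] nb5[OF pq(4)] degree_le_6[of p] degree_le_6[of q] by auto
        show "weight v t \<le> 9 + (if x \<in> t then 3 else 0) + (if t = insert v (low v) then 6 else 0)"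
        proof (cases "d p < 6 \<and> d q < 6")
          case True
          then have "low v = {p, q}" "p = x \<or> q = x" using both_low[OF pq(3,4,2)] by auto
          then have "x \<in> t" "t = insert v (low v)" using pq(1) by auto
          moreover have "{d p, d q} = {3, 5}" using \<open>p = x \<or> q = x\<close> dp dq pq(2) True x(2) by auto
          then have "share 6 (d p) (d q) = 18" by (auto simp: share_def doubleton_eq_iff)
          ultimately show ?thesis using pq(6) by simp
        next
          case False
          then have six: "d p = 6 \<or> d q = 6" using degree_le_6[of p] degree_le_6[of q] by auto
          show ?thesis
          proof (cases "x \<in> t")
            case True
            then show ?thesis using six pq(6) share_at_6[of "d p" "d q"] by (auto simp: doubleton_eq_iff)
          next
            case False
            then have "p \<noteq> x" "q \<noteq> x" using pq(1) by auto
            then have "{d p, d q} = {5, 6} \<or> {d p, d q} = {6}" using dp dq six by auto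
            then show ?thesis using pq(6) by (auto simp: share_def doubleton_eq_iff)
          qed
        qed
      qed (use card_at_unique in simp_all)
      then show ?thesis by simp
    qed
    then show ?thesis using gifts by simp
  qed
  then show ?thesis using dv by (simp add: balanced_def)
qed

lemma adjacent_degree_four:
  assumes "q \<in> N p" "d p = 4" "d q = 4"
  shows "low p = {q}"
  using low_bound[OF assms(1)] assms by (intro low_single) (auto simp: low_def)

text \<open>
  There are at most three neighbours of degree less than 6 if one of them has degree 4. A triangle with
  two corners of degree 4 costs 24, but those corners have no other neighbours of degree less than 6, so the
  other triangles cost at most 12. Otherwise only triangles with corners of degrees 4 and 5 cost more
  than 12, namely 18, and among three neighbours there are at most two pairs with these degrees.
\<close>

lemma balanced_degree_6_other:
  assumes v: "v \<in> V" and dv: "d v = 6" and nb: "\<And>y. y \<in> N v \<Longrightarrow> 4 \<le> d y"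
  shows "balanced v"
proof -
  have gifts: "(\<Sum>x\<in>N v. gift (d v) (d x)) = 0" by (rule no_gifts) (use nb in force)
  have w: "\<exists>p q. t = {v, p, q} \<and> p \<noteq> q \<and> p \<in> N v \<and> q \<in> N v \<and> q \<in> N p \<and> p \<in> N q \<and>
      (weight v t \<le> 12 \<or> d p = 4 \<and> d q = 4 \<and> weight v t = 24 \<or> d p = 4 \<and> d q = 5 \<and> weight v t = 18)"
    if t: "t \<in> Tri v" for t
  proof -
    obtain p q where pq: "t = {v, p, q}" "p \<noteq> q" "p \<in> N v" "q \<in> N v" "q \<in> N p"
      "weight v t = corner_weight v p q" using weight_at[OF t] by blast
    then have N: "p \<in> N q" "t = {v, q, p}" using N_sym by auto
    have "weight v t \<le> 12 \<or> weight v t = share 6 (d p) (d q)" using pq(6) dv by (auto simp: corner_weight_def)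
    then consider "weight v t \<le> 12" | "weight v t = share 6 (d p) (d q)" "{d p, d q} = {4}"
      | "weight v t = share 6 (d p) (d q)" "{d p, d q} = {4, 5}"
      using share_at_6[of "d p" "d q"] nb[OF pq(3)] nb[OF pq(4)] by (auto simp: doubleton_eq_iff)
    then show ?thesis
    proof cases
      case 1
      then show ?thesis using pq N by blast
    next
      case 2
      then have "d p = 4" "d q = 4" "weight v t = 24" by (auto simp: share_def)
      then show ?thesis using pq N by blast
    next
      case 3
      then have w18: "weight v t = 18" by (simp add: share_def doubleton_eq_iff)
      have "d p = 4 \<and> d q = 5 \<or> d q = 4 \<and> d p = 5" using 3(2) by (auto simp: doubleton_eq_iff)
      then show ?thesis using w18 pq N by blast
    qed
  qed
  have "(\<Sum>t\<in>Tri v. weight v t) \<le> 48"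
  proof (cases "\<exists>x\<in>N v. d x = 4")
    case False
    have "(\<Sum>t\<in>Tri v. weight v t) \<le> 3 * 12"
    proof (rule weights_le_uniform[OF v])
      fix t assume t: "t \<in> Tri v"
      show "weight v t \<le> 12"
        using w[OF t] False by auto
    qed
    then show ?thesis by simp
  next
    case True
    then obtain x where x: "x \<in> N v" "d x = 4" by blast
    then have card: "card (low v) \<le> 3" using low_bound[OF x(1)] dv by simp
    have lowI: "u \<in> low v" if "u \<in> N v" "d u < 6" for u using that by (simp add: low_def)
    show ?thesis
    proof (cases "\<exists>t0\<in>Tri v. weight v t0 = 24")
      case True
      then obtain t0 where t0: "t0 \<in> Tri v" "weight v t0 = 24" by blast
      then obtain p q where pq: "t0 = {v, p, q}" "p \<noteq> q" "p \<in> N v" "q \<in> N v" "q \<in> N p" "p \<in> N q" "d p = 4" "d q = 4"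
        using w[OF t0(1)] by auto
      have lowpq: "low p = {q}" "low q = {p}" using adjacent_degree_four pq by auto
      have "(\<Sum>t\<in>Tri v. weight v t) \<le> 3 * 12 + 1 * 12"
      proof (rule weights_le_surcharge[OF v, where P = "\<lambda>t. t = t0"])
        fix t assume t: "t \<in> Tri v"
        have "weight v t \<le> 12" if "t \<noteq> t0"
        proof (rule ccontr)
          assume heavy: "\<not> weight v t \<le> 12"
          obtain a b where ab: "t = {v, a, b}" "a \<noteq> b" "a \<in> N v" "b \<in> N v" "b \<in> N a" "a \<in> N b" "d a < 6" "d b < 6"
            using w[OF t] heavy by force
          have adj: "a \<in> low b" "b \<in> low a" using ab by (auto simp: low_def)
          have "a \<notin> {p, q} \<or> b \<notin> {p, q}" using that ab(1,2) pq(1) by auto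
          then have "a \<notin> {p, q} \<and> b \<notin> {p, q}" using adj lowpq by auto
          then have "card {p, q, a, b} = 4" using pq(2) ab(2) by auto
          moreover have "{p, q, a, b} \<subseteq> low v" using pq ab lowI by auto
          then have "card {p, q, a, b} \<le> card (low v)" by (rule low_card_ge)
          ultimately show False using card by linarith
        qed
        then show "weight v t \<le> 12 + (if t = t0 then 12 else 0)"
          using t0(2) by auto
      qed (use card_at_unique in simp_all)
      then show ?thesis by simp
    next
      case False
      define A where "A i = {u \<in> N v. d u = i}" for i
      let ?H = "(\<lambda>(a, b). {v, a, b}) ` (A 4 \<times> A 5)"
      have fin: "finite (A i)" for i using finite_N by (simp add: A_def)
      have "A 4 \<union> A 5 \<subseteq> low v" by (auto simp: A_def low_def)
      then have "card (A 4 \<union> A 5) \<le> 3" using low_card_ge card le_trans by blast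
      moreover have "card (A 4 \<union> A 5) = card (A 4) + card (A 5)"
        by (rule card_Un_disjoint) (use fin in \<open>auto simp: A_def\<close>)
      ultimately have A3: "card (A 4) + card (A 5) \<le> 3" by simp
      have prod: "m * n \<le> 2" if "m + n \<le> 3" for m n :: nat
      proof -
        have "m = 0 \<or> m = 1 \<or> m = 2 \<or> m = 3" using that by auto
        then show ?thesis using that by auto
      qed
      have "card ?H \<le> card (A 4 \<times> A 5)" by (rule card_image_le) (use fin in simp)
      then have H: "card ?H \<le> 2" using prod[OF A3] by (simp add: card_cartesian_product)
      have "(\<Sum>t\<in>Tri v. weight v t) \<le> 3 * 12 + 2 * 6"
      proof (rule weights_le_surcharge[OF v, where P = "\<lambda>t. t \<in> ?H"])
        have "card {t \<in> Tri v. t \<in> ?H} \<le> card ?H" by (rule card_mono) (use fin in auto)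
        then show "card {t \<in> Tri v. t \<in> ?H} \<le> 2" using H by simp
        fix t assume t: "t \<in> Tri v"
        have "weight v t \<le> 18 \<and> (t \<in> ?H \<or> weight v t \<le> 12)"
        proof -
          obtain p q where pq: "t = {v, p, q}" "p \<in> N v" "q \<in> N v"
            "weight v t \<le> 12 \<or> d p = 4 \<and> d q = 4 \<and> weight v t = 24 \<or> d p = 4 \<and> d q = 5 \<and> weight v t = 18"
            using w[OF t] by blast
          then consider "weight v t \<le> 12" | "d p = 4" "d q = 5" "weight v t = 18" using False t by blast
          then show ?thesis
          proof cases
            case 2
            then have "(p, q) \<in> A 4 \<times> A 5" using pq(2,3) by (simp add: A_def)
            then have "t \<in> ?H" using pq(1) by blast
            then show ?thesis using 2 by simp
          qed simp
        qed
        then show "weight v t \<le> 12 + (if t \<in> ?H then 6 else 0)" by auto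
      qed
      then show ?thesis by simp
    qed
  qed
  then show ?thesis using gifts dv by (simp add: balanced_def)
qed

lemma all_balanced:
  assumes v: "v \<in> V"
  shows "balanced v"
proof -
  have nb2: "2 \<le> d y" if "y \<in> N v" for y using degree_range N_subset that by fastforce
  consider "d v \<le> 4" | "d v = 5" | "d v = 6" using degree_le_6[of v] by linarith
  then show ?thesis
  proof cases
    case 3
    have nb234: "d y = 2 \<or> d y = 3 \<or> 4 \<le> d y" if "y \<in> N v" for y using nb2[OF that] by linarith
    consider x where "x \<in> N v" "d x = 2" | x where "x \<in> N v" "d x = 3" "\<forall>y\<in>N v. d y \<noteq> 2" | "\<forall>y\<in>N v. 4 \<le> d y"
      using nb234 by metis
    then show ?thesis
      using balanced_degree_6_two[OF v 3] balanced_degree_6_three[OF v 3] balanced_degree_6_other[OF v 3] by cases blast+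
  qed (use balanced_degree_at_most_4 balanced_degree_5 v in auto)
qed

text \<open>
  Summing \<open>all_balanced\<close> over all vertices, the gifts cancel.
\<close>

lemma few_triangles: "card T + 4 * card V \<le> 2 * card E"
proof -
  let ?gift = "\<lambda>u v. gift (d u) (d v)"
  have N_eq: "N v = {u \<in> V. u \<in> N v}" for v using N_subset by auto
  have "(\<Sum>v\<in>V. \<Sum>x\<in>N v. ?gift v x) = (\<Sum>v\<in>V. \<Sum>x\<in>{x \<in> V. x \<in> N v}. ?gift v x)" using N_eq by simp
  also have "\<dots> = (\<Sum>x\<in>V. \<Sum>v\<in>{v \<in> V. x \<in> N v}. ?gift v x)"
    by (rule sum.swap_restrict) (use finite_V in auto)
  also have "\<dots> = (\<Sum>x\<in>V. \<Sum>v\<in>N x. ?gift v x)"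
  proof (rule sum.cong[OF refl])
    fix x
    have "{v \<in> V. x \<in> N v} = N x" using N_eq[of x] N_sym by blast
    then show "(\<Sum>v\<in>{v \<in> V. x \<in> N v}. ?gift v x) = (\<Sum>v\<in>N x. ?gift v x)" by simp
  qed
  finally have gifts: "(\<Sum>v\<in>V. \<Sum>x\<in>N v. ?gift v x) = (\<Sum>v\<in>V. \<Sum>u\<in>N v. ?gift u v)" .
  have "24 * card T = (\<Sum>t\<in>T. 24)" by simp
  also have "\<dots> \<le> (\<Sum>t\<in>T. \<Sum>v\<in>t. weight v t)" by (rule sum_mono) (rule triangle_receives)
  also have "\<dots> = (\<Sum>t\<in>T. \<Sum>v\<in>{v \<in> V. v \<in> t}. weight v t)"
  proof (rule sum.cong[OF refl])
    fix t assume "t \<in> T"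
    then have "t \<subseteq> V" using triangle[of t] simple by (fastforce simp: simple_graph_def)
    then have "{v \<in> V. v \<in> t} = t" by auto
    then show "(\<Sum>v\<in>t. weight v t) = (\<Sum>v\<in>{v \<in> V. v \<in> t}. weight v t)" by simp
  qed
  also have "\<dots> = (\<Sum>v\<in>V. \<Sum>t\<in>Tri v. weight v t)"
    by (rule sum.swap_restrict) (use finite_V finite_T in auto)
  finally have weights: "24 * card T \<le> (\<Sum>v\<in>V. \<Sum>t\<in>Tri v. weight v t)" .
  have "(\<Sum>v\<in>V. (\<Sum>t\<in>Tri v. weight v t) + (\<Sum>x\<in>N v. ?gift v x) + 96) \<le>
      (\<Sum>v\<in>V. 24 * d v + (\<Sum>u\<in>N v. ?gift u v))"
    by (rule sum_mono) (use all_balanced in \<open>simp add: balanced_def\<close>)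
  then have "(\<Sum>v\<in>V. \<Sum>t\<in>Tri v. weight v t) + (\<Sum>v\<in>V. \<Sum>x\<in>N v. ?gift v x) + 96 * card V \<le>
      24 * (\<Sum>v\<in>V. d v) + (\<Sum>v\<in>V. \<Sum>u\<in>N v. ?gift u v)"
    by (simp add: sum.distrib sum_distrib_left)
  moreover have "(\<Sum>v\<in>V. d v) = 2 * card E"
    by (rule handshake) (use finite_V finite_E simple in \<open>auto simp: simple_graph_def\<close>)
  ultimately show ?thesis using gifts weights by linarith
qed

end

section \<open>Critical graphs\<close>

lemma proper_edge_coloring_mono:
  assumes "proper_edge_coloring E m c" "m \<le> k"
  shows "proper_edge_coloring E k c"
  using assms unfolding proper_edge_coloring_def by fastforce

lemma chromatic_index_coloring:
  assumes "finite E"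
  shows "\<exists>c. proper_edge_coloring E (chromatic_index E) c"
  unfolding chromatic_index_def
proof (rule LeastI_ex)
  obtain h where "bij_betw h E {0..<card E}" using ex_bij_betw_finite_nat[OF assms] by blast
  then have "proper_edge_coloring E (card E) h"
    unfolding proper_edge_coloring_def bij_betw_def inj_on_def by auto
  then show "\<exists>k c. proper_edge_coloring E k c" by blast
qed

lemma no_coloring_below_chromatic_index:
  "k < chromatic_index E \<Longrightarrow> \<not> proper_edge_coloring E k c"
  unfolding chromatic_index_def using not_less_Least by blast

lemma vertex_degree_le_max_degree:
  assumes "simple_graph V E"
  shows "vertex_degree E v \<le> max_degree V E"
proof (cases "v \<in> V")
  case True
  then show ?thesis using assms by (simp add: max_degree_def simple_graph_def)
next
  case False
  then have "{e \<in> E. v \<in> e} = {}" using assms by (auto simp: simple_graph_def)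
  then have "vertex_degree E v = 0" unfolding vertex_degree_def by (metis card.empty)
  then show ?thesis by simp
qed

lemma max_degree_attained:
  assumes "simple_graph V E" "0 < max_degree V E"
  obtains v where "v \<in> V" "vertex_degree E v = max_degree V E"
proof -
  have "max_degree V E \<in> insert 0 (vertex_degree E ` V)"
    unfolding max_degree_def by (rule Max_in) (use assms(1) in \<open>auto simp: simple_graph_def\<close>)
  then show thesis using that assms(2) by auto
qed

text \<open>
  With \<open>k\<close> one less than the chromatic index, the graph satisfies the assumptions of the locale for \<open>k\<close>
  in place of \<open>\<Delta>\<close>; then the adjacency lemma shows \<open>k = \<Delta>\<close>.
\<close>

lemma critical_imp_edge_critical:
  assumes crit: "critical \<Delta> V E" and pos: "0 < \<Delta>"
  shows "edge_critical V E \<Delta>"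
proof -
  have simple: "simple_graph V E" and max: "max_degree V E = \<Delta>" and class2: "chromatic_index E \<noteq> \<Delta>"
    and smaller: "\<And>V' E'. proper_subgraph V' E' V E \<Longrightarrow> chromatic_index E' < chromatic_index E"
    using crit by (auto simp: critical_def class_two_def)
  note fin = simple_graph_finite_edges[OF simple]
  obtain v where v: "v \<in> V" "vertex_degree E v = \<Delta>" using max_degree_attained[OF simple] max pos by metis
  obtain c where c: "proper_edge_coloring E (chromatic_index E) c" using chromatic_index_coloring[OF fin] by blast
  have "\<Delta> \<le> chromatic_index E" using card_missing[OF fin c, of v] v by linarith
  then have less: "\<Delta> < chromatic_index E" using class2 by simp
  define k where "k = chromatic_index E - 1"
  have k: "\<Delta> \<le> k" "k < chromatic_index E" using less by (auto simp: k_def)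
  interpret edge_critical V E k
  proof
    show "simple_graph V E" by (rule simple)
    show "vertex_degree E u \<le> k" for u using vertex_degree_le_max_degree[OF simple, of u] max k by simp
    show "\<not> proper_edge_coloring E k c" for c by (rule no_coloring_below_chromatic_index[OF k(2)])
    show "\<exists>c. proper_edge_coloring (E - {e}) k c" if "e \<in> E" for e
    proof -
      have "proper_subgraph V (E - {e}) V E"
        using simple that by (auto simp: proper_subgraph_def simple_graph_def)
      then have "chromatic_index (E - {e}) \<le> k" using smaller k_def by fastforce
      moreover obtain c where "proper_edge_coloring (E - {e}) (chromatic_index (E - {e})) c"
        using chromatic_index_coloring[of "E - {e}"] fin by auto
      ultimately show ?thesis using proper_edge_coloring_mono by blast
    qed
  qed
  have "{e \<in> E. v \<in> e} \<noteq> {}" using v(2) pos unfolding vertex_degree_def by (metis card.empty less_irrefl)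
  then obtain e where e: "e \<in> E" "v \<in> e" by blast
  then obtain u where "{v, u} \<in> E" using edges_at_vertex by metis
  then have "k + 1 \<le> card {z \<in> neighbours E v - {u}. vertex_degree E z = k} + vertex_degree E u"
    by (rule vizing_adjacency)
  then have "card {z \<in> neighbours E v - {u}. vertex_degree E z = k} \<noteq> 0" using degree_le[of u] by linarith
  then have "{z \<in> neighbours E v - {u}. vertex_degree E z = k} \<noteq> {}" by (metis card.empty)
  then obtain z where "vertex_degree E z = k" by blast
  then have "k = \<Delta>" using vertex_degree_le_max_degree[OF simple, of z] max k(1) by simp
  then show ?thesis using edge_critical_axioms by simp
qed

lemma critical_vertex_covered:
  assumes crit: "critical \<Delta> V E" and v: "v \<in> V"
  shows "\<exists>e\<in>E. v \<in> e"
proof (rule ccontr)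
  assume "\<not> (\<exists>e\<in>E. v \<in> e)"
  then have "proper_subgraph (V - {v}) E V E"
    using crit v by (auto simp: critical_def class_two_def proper_subgraph_def simple_graph_def)
  then show False using crit by (auto simp: critical_def)
qed

text \<open>
  A critical graph has no bridge, because the ends of an edge are linked by a Kempe chain.
\<close>

lemma (in edge_critical) edge_ends_adjacency_connected:
  assumes "{x, y} \<in> E"
  shows "(x, y) \<in> (adjacency (E - {{x, y}}))\<^sup>*"
proof -
  obtain c where c: "pcol {x, y} c" using deletion_colorable[OF assms] by blast
  obtain \<alpha> \<beta> where "\<alpha> \<in> miss {x, y} c x" "\<beta> \<in> miss {x, y} c y"
    using miss_end_nonempty[OF c assms] by blast
  then have "(x, y) \<in> (kempe_rel (E - {{x, y}}) c \<alpha> \<beta>)\<^sup>*"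
    using ends_linked[OF c assms] by (simp add: kempe_component_def)
  moreover have "kempe_rel (E - {{x, y}}) c \<alpha> \<beta> \<subseteq> adjacency (E - {{x, y}})"
    by (auto simp: kempe_rel_def adjacency_def)
  ultimately show ?thesis using rtrancl_mono by blast
qed

theorem theorem1p1:
  "\<not> (\<exists>(V :: 'a set) E pos \<gamma>.
        plane_graph V E pos \<gamma> \<and> critical 6 V E \<and>
        (\<forall>v\<in>V. finite {f. k_face 3 V E pos \<gamma> f \<and> incident pos v f} \<and>
                card {f. k_face 3 V E pos \<gamma> f \<and> incident pos v f} \<le> 3))"
proof (rule notI, elim exE conjE)
  fix V :: "'a set" and E pos \<gamma>
  assume plane: "plane_graph V E pos \<gamma>" and crit: "critical 6 V E"
    and three: "\<forall>v\<in>V. finite {f. k_face 3 V E pos \<gamma> f \<and> incident pos v f} \<and>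
      card {f. k_face 3 V E pos \<gamma> f \<and> incident pos v f} \<le> 3"
  interpret edge_critical V E 6 by (rule critical_imp_edge_critical[OF crit]) simp
  interpret plane V E pos \<gamma> by unfold_locales (rule plane)
  obtain v where v: "v \<in> V" "vertex_degree E v = 6"
    using max_degree_attained[OF simple] crit by (metis critical_def zero_less_numeral)
  interpret bridgeless_plane V E pos \<gamma>
  proof
    show "linked E e" if e: "e \<in> E" for e
      unfolding linked_def
    proof (intro ballI)
      fix x y assume xy: "x \<in> e" "y \<in> e"
      have "(x, y) \<in> (adjacency (E - {e}))\<^sup>*"
      proof (cases "x = y")
        case False
        then have "e = {x, y}" using xy graph(3)[OF e] by (auto simp: card_2_iff)
        then show ?thesis using edge_ends_adjacency_connected e by blast
      qed simp
      then show "path_component (D (E - {e})) (pos x) (pos y)"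
        using xy graph(2)[OF e] by (intro adjacency_path_component) auto
    qed
    show "\<exists>e\<in>E. u \<in> e" if "u \<in> V" for u using critical_vertex_covered[OF crit that] .
    then show "E \<noteq> {}" using v(1) by blast
  qed
  have "card (neighbours E v) = 6" using vertex_degree_eq_card_neighbours[OF two] v(2) by simp
  moreover have "neighbours E v \<subseteq> V" using graph(2) by (auto simp: neighbours_def)
  ultimately have "card V > 3" using card_mono[OF graph(1), of "neighbours E v"] by simp
  then have "2 * card E + 8 \<le> 4 * card V + card triangles" by (rule many_triangles)
  moreover interpret triangle_system V E triangles
  proof
    show "finite triangles" by (rule finite_triangles)
    show "\<exists>a b c. t = {a, b, c} \<and> a \<noteq> b \<and> b \<noteq> c \<and> a \<noteq> c \<and> {a, b} \<in> E \<and> {b, c} \<in> E \<and> {a, c} \<in> E"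
      if "t \<in> triangles" for t using triangles_complete[OF that] .
    show "card {t \<in> triangles. u \<in> t} \<le> 3" if "u \<in> V" for u
      using triangles_at_vertex[OF that] three that by blast
    show "card {t \<in> triangles. e \<subseteq> t} \<le> 2" if "e \<in> E" for e using triangles_at_edge[OF that] .
    show "\<exists>e\<in>E. u \<in> e" if "u \<in> V" for u using critical_vertex_covered[OF crit that] .
  qed
  have "card triangles + 4 * card V \<le> 2 * card E" by (rule few_triangles)
  ultimately show False by linarith
qed

end
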